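(* Let $\gamma>0$ and assume Hypothesis $Z(\gamma)$. Fix a nonzero integer $a$, a real $A>0$ and a real $\alpha$ with $0<\alpha<\gamma$. Let $2\le y\le x$ and let $T_1,\dots,T_m$ be pairwise disjoint nonempty sets of primes in $[2,y]$. For each $1\le i\le m$, let $f_i$ be either the function $n\mapsto \omega(n,T_i)$ or the function $n\mapsto \Omega(n,T_i)$. Then for every subset $\mathscr{R}\subset \mathbb{N}_0^m$, \[ \Big|\mathbb{P}\big((f_1(n),\dots,f_m(n))\in\mathscr{R}\big)-\mathbb{P}\big((f_1(p+a),\dots,f_m(p+a))\in\mathscr{R}\big)\Big| \ll_{a,A,\alpha} \sum_{j=1}^m\frac{H_2(T_j)}{1+\sqrt{H_1(T_j)}} + e^{-\alpha u\log u}+\frac{1}{(\log x)^A}, \] where $u=\frac{\log x}{\log y}$, the first probability is over an integer $n$ chosen uniformly at random from $\{1,\dots,\lfloor x\rfloor\}$, and the second is over a prime $p$ chosen uniformly at random from the primes in $(|a|+1,x]$. The implied constant depends only on $a,A,\alpha$.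
   Context: Notation: $\mathbb{N}_0=\{0,1,2,\dots\}$; $\pi(x)$ counts primes $\le x$; $\pi(x;m,b)$ counts primes $p\le x$ with $p\equiv b\pmod m$; $\phi$ is Euler's function; $P^+(n)$ is the largest prime factor of $n$ ($P^+(1)=0$). Hypothesis $Z(\gamma)$: for every $\varepsilon>0$ there is $\delta>0$ such that for every $B\ge1$ and every nonzero integer $a$, \[ \sum_{\substack{m\le x^{\gamma-\varepsilon}\\ P^+(m)\le x^{\delta}\\ (m,a)=1}} \Big|\pi(x;m,-a)-\frac{\pi(x)}{\phi(m)}\Big| \ll_{B,\varepsilon,a} \frac{x}{(\log x)^B}. \] For a positive integer $n=\prod_p p^{v_p}$ and a finite set $T$ of primes: $\omega(n,T)=\#\{p\in T: p\mid n\}$, $\Omega(n,T)=\sum_{p\in T}v_p$, $H_1(T)=\sum_{q\in T}\frac{1}{q-1}$, $H_2(T)=\sum_{q\in T}\frac{1}{q^2}$. *)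

theory Defs
  imports
    "HOL-Probability.Probability_Mass_Function"
    "HOL-Number_Theory.Totient"
begin

definition prime_count :: "real \<Rightarrow> nat" where
  "prime_count x = card {p::nat. prime p \<and> real p \<le> x}"

definition prime_count_cong :: "real \<Rightarrow> nat \<Rightarrow> int \<Rightarrow> nat" where
  "prime_count_cong x m b =
     card {p::nat. prime p \<and> real p \<le> x \<and> [int p = b] (mod int m)}"

definition largest_prime_factor :: "nat \<Rightarrow> nat" where
  "largest_prime_factor n = (if n \<le> 1 then 0 else Max (prime_factors n))"

text \<open>On bounded ranges of \<open>x \<ge> 2\<close> the bound is trivial, so requiring it for all \<open>x \<ge> 2\<close> agrees
  with requiring it for sufficiently large \<open>x\<close>, up to the implied constant.\<close>

definition hypothesis_Z :: "real \<Rightarrow> bool" where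
  "hypothesis_Z \<gamma> \<longleftrightarrow>
     (\<forall>\<epsilon>>0. \<exists>\<delta>>0. \<forall>B\<ge>(1::real). \<forall>a::int. a \<noteq> 0 \<longrightarrow>
       (\<exists>C::real. \<forall>x::real. x \<ge> 2 \<longrightarrow>
         (\<Sum>m | m \<ge> 1 \<and> real m \<le> x powr (\<gamma> - \<epsilon>) \<and>
                real (largest_prime_factor m) \<le> x powr \<delta> \<and> coprime (int m) a.
            \<bar>real (prime_count_cong x m (- a)) - real (prime_count x) / real (totient m)\<bar>)
         \<le> C * (x / (ln x) powr B)))"

definition small_omega :: "nat \<Rightarrow> nat set \<Rightarrow> nat" where
  "small_omega n T = card {p \<in> T. p dvd n}"

definition big_Omega :: "nat \<Rightarrow> nat set \<Rightarrow> nat" where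
  "big_Omega n T = (\<Sum>p\<in>T. multiplicity p n)"

definition H1 :: "nat set \<Rightarrow> real" where
  "H1 T = (\<Sum>q\<in>T. 1 / (real q - 1))"

definition H2 :: "nat set \<Rightarrow> real" where
  "H2 T = (\<Sum>q\<in>T. 1 / (real q)\<^sup>2)"

end

theory Submission
  imports
    Defs
    "HOL-Real_Asymp.Real_Asymp"
    "HOL-Probability.Product_PMF"
    "HOL-Analysis.Weierstrass_Theorems"
begin

text \<open>
  Both random integers are compared with a Kubilius model in which the exponents of the primes
  are independent. For a function of the exponents, Moebius inversion over the divisors is truncated
  along a tree: prime factors are listed in decreasing order and an expansion stops as soon as
  the \<open>k\<close>-th largest one exceeds a threshold \<open>t\<^sub>k\<close>, with \<open>t\<^sub>k = y\<close> for \<open>k \<le> K \<approx> \<kappa>u\<close> and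
  \<open>t\<^sub>k = y\<^bsup>\<theta>(K/k)\<^sup>2\<^esup>\<close> afterwards. All moduli stay below \<open>x\<^bsup>\<beta>\<^esup>\<close> with \<open>\<alpha> < \<kappa> < \<beta> < \<gamma>\<close>, so that
  Hypothesis \<open>Z(\<gamma>)\<close> controls the remainders, while Rankin's trick bounds the stopped branches
  by \<open>e\<^bsup>-\<alpha> u log u\<^esup> + (log x)\<^bsup>-A\<^esup>\<close>. The hypothesis forces \<open>\<gamma> \<le> 1\<close>.

  The two models are then compared by replacing one prime at a time. The laws at \<open>q\<close> differ by
  \<open>O(1/q\<^sup>2)\<close>, and such a change only shifts the sum over the remaining primes of \<open>T\<^sub>j\<close> by a bounded
  amount. That sum contains independent fair coins, so its law moves by \<open>O((1 + H\<^sub>1(T\<^sub>j))\<^bsup>-1/2\<^esup>)\<close>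
  in total variation when shifted by one.
\<close>

section \<open>Chebyshev and Mertens bounds\<close>

text \<open>Stopping every branch after exactly \<open>K\<close> prime factors would cost about (log
  log y)^K / K!, which is too large when u is small compared with log log y. Falling thresholds cure
  this: the primes in (t_l, y] have reciprocal sum O(1 + log (l/K)), so that Rankin's trick with
  parameter \<open>K\<close> yields K^(-K) up to a factor C^K and a geometric tail in l, while
  convergence of the sum of (K/l)^2 keeps the extra factors of a modulus below y^(\<theta>K). The
  parameter \<open>K\<close> is admissible only while t_l exceeds it by a constant factor. This
  holds until l reaches a multiple of log log x; beyond that the constant parameter 3/2 already
  turns the length of a branch into a negative power of log x. The bound \<gamma> \<le> 1 is needed
  on the side of the integers: their rounding errors add up to a multiple of x^(\<beta> - 1), which
  is negligible only for \<beta> < 1.\<close>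

lemma finite_primes_real_le [simp, intro]: "finite {p::nat. prime p \<and> real p \<le> x}"
  by (rule finite_subset[of _ "{..nat \<lfloor>x\<rfloor>}"]) (auto simp: le_nat_floor)

text \<open>The quotient is \<open>Lcm\<close> times an entry of Leibniz' harmonic triangle, whose entries are integer combinations
  of \<open>1, 1/2, \<dots>, 1/N\<close>.\<close>

lemma Lcm_mult_leibniz_in_Ints:
  assumes "k \<le> n" "n < N"
  shows "real (Lcm {1..N}) / (real (n + 1) * real (n choose k)) \<in> \<int>"
  using assms
proof (induction k arbitrary: n)
  case 0
  have "(n + 1) dvd Lcm {1..N}" using 0 by (intro dvd_Lcm) auto
  then obtain c where "Lcm {1..N} = (n + 1) * c" by (elim dvdE)
  then have "real (Lcm {1..N}) = real (n + 1) * real c" by (metis of_nat_mult)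
  then have "real (Lcm {1..N}) / (real (n + 1) * real (n choose 0)) = real c"
    by (simp only: binomial_n_0 of_nat_1 mult_1_right) simp
  then show ?case by (metis Ints_of_nat)
next
  case (Suc k)
  obtain n' where n: "n = Suc n'" using Suc.prems by (cases n) auto
  have k: "k \<le> n'" using Suc.prems n by auto
  define L where "L = real (Lcm {1..N})"
  have b1: "real (n' choose k) > 0" "real (Suc n' choose k) > 0" "real (Suc n' choose Suc k) > 0"
    using k by (auto simp: zero_less_binomial_iff simp del: binomial_Suc_Suc)
  have e1: "real (Suc k) * real (Suc n' choose Suc k) = real (Suc n') * real (n' choose k)"
    using Suc_times_binomial[of k n'] by (metis of_nat_mult)
  have e2: "real (Suc n' - k) * real (Suc n' choose k) = real (Suc n') * real (n' choose k)"
    using Suc_times_binomial_add[of k "n' - k"] k binomial_symmetric[of k "Suc n'"]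
      binomial_symmetric[of k "n'"] Suc_times_binomial[of "n' - k" n']
    by (metis Suc_diff_le le_SucI of_nat_mult)
  have "1 / (real (n + 1) * real (n choose Suc k)) =
      1 / (real (n' + 1) * real (n' choose k)) - 1 / (real (n + 1) * real (n choose k))"
  proof -
    define b where "b = real (n' choose k)"
    define s where "s = real n'"
    define r where "r = real k"
    have f1: "real (Suc n' choose Suc k) = (s + 1) * b / (r + 1)"
      using e1 unfolding b_def s_def r_def by (simp add: field_simps del: binomial_Suc_Suc)
    have f2: "real (Suc n' choose k) = (s + 1) * b / (s + 1 - r)"
      using e2 k unfolding b_def s_def r_def by (simp add: field_simps of_nat_diff)
    have p: "b > 0" "s \<ge> 0" "r \<ge> 0" "s - r \<ge> 0" using b1 k by (auto simp: b_def s_def r_def)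
    have "1 / ((s + 2) * ((s + 1) * b / (r + 1))) =
      1 / ((s + 1) * b) - 1 / ((s + 2) * ((s + 1) * b / (s + 1 - r)))"
      using p by (simp add: divide_simps)
    then show ?thesis unfolding n using f1 f2 by (simp add: b_def s_def add.commute del: binomial_Suc_Suc)
  qed
  then have "L / (real (n + 1) * real (n choose Suc k)) =
      L / (real (n' + 1) * real (n' choose k)) - L / (real (n + 1) * real (n choose k))"
    by (metis (no_types, lifting) divide_inverse inverse_eq_divide right_diff_distrib)
  moreover have "L / (real (n' + 1) * real (n' choose k)) \<in> \<int>"
    unfolding L_def using k n Suc.prems by (intro Suc.IH) auto
  moreover have "L / (real (n + 1) * real (n choose k)) \<in> \<int>"
    unfolding L_def using Suc.prems by (intro Suc.IH) auto
  ultimately show ?case unfolding L_def by (metis Ints_diff)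
qed

lemma Lcm_upto_pos: "Lcm {1..N::nat} > 0"
proof -
  have "Lcm {1..N} \<noteq> 0" by (subst Lcm_0_iff) auto
  then show ?thesis by (rule neq0_conv[THEN iffD1])
qed

text \<open>The Lcm times the central entry of Leibniz' triangle is a positive integer, hence at
  least 1. So the Lcm is at least \<open>(2 * n + 1) * (2 * n choose n)\<close>, and the lower bound
  for central binomial coefficients finishes.\<close>

lemma Lcm_upto_ge: "4 ^ n \<le> Lcm {1..2 * n + 1}"
proof (cases "n = 0")
  case True
  have "Lcm {1..1::nat} = 1" by simp
  then show ?thesis using True by simp
next
  case False
  define L where "L = Lcm {1..2 * n + 1}"
  have "real L / (real (2 * n + 1) * real (2 * n choose n)) \<in> \<int>"
    unfolding L_def by (rule Lcm_mult_leibniz_in_Ints) auto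
  moreover have "real L / (real (2 * n + 1) * real (2 * n choose n)) > 0"
    using Lcm_upto_pos[of "2 * n + 1"] unfolding L_def by (auto simp: zero_less_binomial_iff)
  ultimately have "real L / (real (2 * n + 1) * real (2 * n choose n)) \<ge> 1"
    by (metis Ints_cases of_int_0_less_iff of_int_1_le_iff int_one_le_iff_zero_less)
  then have "real L \<ge> real (2 * n + 1) * real (2 * n choose n)"
    by (subst (asm) le_divide_eq_1_pos) (auto simp: zero_less_binomial_iff)
  moreover have "real (2 * n + 1) * real (2 * n choose n) \<ge> (2 * real n) * (4 ^ n / (2 * real n))"
    using False central_binomial_lower_bound[of n] by (intro mult_mono) auto
  moreover have "(2 * real n) * (4 ^ n / (2 * real n)) = real (4 ^ n)" using False by simp
  ultimately have "real (4 ^ n) \<le> real L" by linarith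
  then show ?thesis unfolding L_def by (simp only: of_nat_le_iff)
qed

lemma prime_power_dvd_Lcm:
  assumes "finite A" "0 \<notin> A" "prime (p::nat)" "k > 0" "p ^ k dvd Lcm A"
  shows "\<exists>a\<in>A. p ^ k dvd a"
  using assms
proof (induction A rule: finite_induct)
  case empty
  then have "p ^ k = 1" by simp
  then have "p = 1" using empty by (simp add: power_eq_1_iff)
  then show ?case using empty by simp
next
  case (insert a A)
  have z: "a \<noteq> 0" "Lcm A \<noteq> 0" using insert by (auto simp: Lcm_0_iff)
  have "k \<le> multiplicity p (lcm a (Lcm A))"
    using insert z by (intro multiplicity_geI) (auto simp: lcm_eq_0_iff)
  also have "\<dots> = max (multiplicity p a) (multiplicity p (Lcm A))"
    using z insert.prems by (intro multiplicity_lcm) auto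
  finally have "k \<le> multiplicity p a \<or> k \<le> multiplicity p (Lcm A)" by linarith
  then show ?case using insert by (auto intro: multiplicity_dvd')
qed

lemma sum_UNION_le:
  fixes g :: "'b \<Rightarrow> real"
  assumes "finite I" "\<And>i. i \<in> I \<Longrightarrow> finite (A i)" "\<And>x. g x \<ge> 0"
  shows "sum g (\<Union>i\<in>I. A i) \<le> (\<Sum>i\<in>I. sum g (A i))"
  using assms
proof (induction I rule: finite_induct)
  case (insert i I)
  have "sum g (A i \<union> (\<Union>i\<in>I. A i)) \<le> sum g (A i) + sum g (\<Union>i\<in>I. A i)"
    using insert by (subst sum.union_inter[symmetric]) (auto intro!: sum_nonneg)
  then show ?case using insert by simp
qed simp

text \<open>A prime power dividing the Lcm divides one of the numbers up to \<open>N\<close>, so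
  each of the at most \<pi>(N) primary factors is at most \<open>N\<close>. Against
  \<open>Lcm_upto_ge\<close> this bounds \<pi>(N) from below.\<close>

lemma Lcm_upto_le: "Lcm {1..N::nat} \<le> N ^ card {p. prime p \<and> p \<le> N}"
proof -
  define L where "L = Lcm {1..N}"
  have L0: "L \<noteq> 0" using Lcm_upto_pos[of N] unfolding L_def by simp
  have pp: "p ^ multiplicity p L \<le> N \<and> p \<le> N" if "p \<in> prime_factors L" for p
  proof -
    have p: "prime p" "p dvd L" using that by (auto simp: in_prime_factors_iff)
    have m0: "multiplicity p L \<ge> 1" using p L0 by (simp add: prime_multiplicity_gt_zero_iff Suc_le_eq)
    have N0: "N \<ge> 1"
    proof (rule ccontr)
      assume "\<not> N \<ge> 1" then have "L = 1" unfolding L_def by simp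
      then show False using p by auto
    qed
    obtain k where k: "k \<in> {1..N}" and d: "p ^ multiplicity p L dvd k"
      using prime_power_dvd_Lcm[of "{1..N}" p "multiplicity p L"] p m0 multiplicity_dvd[of p L]
      unfolding L_def by auto
    have "p ^ multiplicity p L \<le> N" using dvd_imp_le[OF d] k by auto
    moreover have "p \<le> p ^ multiplicity p L"
      using m0 prime_gt_0_nat[OF p(1)] by (metis One_nat_def Suc_le_eq dvd_imp_le dvd_power zero_less_power)
    ultimately show ?thesis by linarith
  qed
  have "L = (\<Prod>p\<in>prime_factors L. p ^ multiplicity p L)"
    using prime_factorization_nat[of L] L0 by simp
  also have "\<dots> \<le> (\<Prod>p\<in>prime_factors L. N)"
    using pp by (intro prod_mono) auto
  also have "\<dots> = N ^ card (prime_factors L)" by simp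
  also have "\<dots> \<le> N ^ card {p. prime p \<and> p \<le> N}"
  proof (cases "N = 0")
    case True
    then have "{p. prime p \<and> p \<le> N} = {}" by auto
    then have c: "card {p. prime p \<and> p \<le> N} = 0" by (simp only: card.empty)
    have "L = 1" using True by (simp add: L_def)
    then have "card (prime_factors L) = 0" by simp
    then show ?thesis by (simp only: c)
  next
    case False
    then show ?thesis using pp by (intro power_increasing card_mono) (auto simp: in_prime_factors_iff)
  qed
  finally show ?thesis unfolding L_def .
qed

lemma prime_count_lower_nat:
  "real n * ln 4 \<le> real (card {p. prime p \<and> p \<le> 2 * n + 1}) * ln (2 * real n + 1)"
proof -
  define c where "c = card {p. prime p \<and> p \<le> 2 * n + 1}"
  have "4 ^ n \<le> (2 * n + 1) ^ c"
    using Lcm_upto_ge[of n] Lcm_upto_le[of "2 * n + 1"] unfolding c_def by linarith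
  then have "real (4 ^ n) \<le> real ((2 * n + 1) ^ c)" using of_nat_le_iff by blast
  then have "ln (real (4 ^ n)) \<le> ln (real ((2 * n + 1) ^ c))"
    by (subst ln_le_cancel_iff) auto
  then show ?thesis unfolding c_def[symmetric] by (simp add: ln_realpow add.commute)
qed

lemma prime_count_eq_card_nat: "prime_count x = card {p. prime p \<and> p \<le> nat \<lfloor>x\<rfloor>}"
proof -
  have "real p \<le> x \<longleftrightarrow> p \<le> nat \<lfloor>x\<rfloor>" if "prime p" for p
    using prime_gt_0_nat[OF that] by linarith
  then show ?thesis unfolding prime_count_def by (metis (mono_tags, lifting))
qed

lemma prime_count_lower:
  assumes "x \<ge> 2"
  shows "prime_count x \<ge> x / (8 * ln x)"
proof -
  define n where "n = (nat \<lfloor>x\<rfloor> - 1) div 2"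
  have n1: "2 * n + 1 \<le> nat \<lfloor>x\<rfloor>" using assms unfolding n_def by linarith
  have n2: "nat \<lfloor>x\<rfloor> \<le> 2 * n + 2" unfolding n_def by linarith
  have "real (2 * n + 1) \<le> x" using n1 assms by linarith
  have xl: "x \<le> 2 * real n + 3" using n2 assms by linarith
  have lx: "ln x > 0" using assms by simp
  have c: "real (card {p. prime p \<and> p \<le> 2 * n + 1}) \<le> real (prime_count x)"
    unfolding prime_count_eq_card_nat using n1 by (intro of_nat_mono card_mono) auto
  have l4: "ln 4 \<ge> (1::real)" 
  proof -
    have "exp 1 \<le> (4::real)" using exp_le by simp
    then show ?thesis by (subst ln_ge_iff) auto
  qed
  show ?thesis
  \<comment> \<open>For \<open>n = 0\<close> the Lcm bound is void, but then x \<le> 3 and the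
    single prime 2 suffices. Otherwise the 8 absorbs x \<le> 2n + 3.\<close>
  proof (cases "n = 0")
    case True
    have "2 \<in> {p. prime p \<and> real p \<le> x}" using assms by simp
    then have "card {2::nat} \<le> prime_count x"
      unfolding prime_count_def by (intro card_mono) auto
    then have a: "real (prime_count x) \<ge> 1" by simp
    have "ln 2 \<ge> (1/2::real)" using l4 ln_realpow[of 2 2] by simp
    moreover have "ln 2 \<le> ln x" using assms by simp
    ultimately have "ln x \<ge> 1/2" by linarith
    then have "x \<le> 8 * ln x" using xl True by simp
    then have "x / (8 * ln x) \<le> 1" using lx by simp
    then show ?thesis using a by linarith
  next
    case False
    have "real n \<le> real n * ln 4" using l4 by (simp add: mult_le_cancel_left1)
    also have "\<dots> \<le> real (card {p. prime p \<and> p \<le> 2 * n + 1}) * ln (2 * real n + 1)"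
      by (rule prime_count_lower_nat)
    also have "\<dots> \<le> real (prime_count x) * ln x"
      using c \<open>real (2 * n + 1) \<le> x\<close> by (intro mult_mono) auto
    finally have "real n \<le> real (prime_count x) * ln x" .
    moreover have "x \<le> 8 * real n" using xl False by linarith
    ultimately have "x \<le> real (prime_count x) * (8 * ln x)" by linarith
    then show ?thesis using lx by (simp add: pos_divide_le_eq)
  qed
qed

section \<open>Upper bounds for sums of reciprocals of primes\<close>

lemma prod_primes_dvd:
  assumes "finite S" "\<And>p. p \<in> S \<Longrightarrow> prime p" "\<And>p. p \<in> S \<Longrightarrow> p dvd (n::nat)"
  shows "\<Prod>S dvd n"
  using assms
proof (induction S rule: finite_induct)
  case (insert p S)
  have "coprime p (\<Prod>S)"
    using insert by (intro prod_coprime_right primes_coprime) auto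
  then show ?case using insert by (auto intro: divides_mult)
qed simp

text \<open>With n = 2^k, all primes in (n, 2n] divide \<open>(2 * n) choose n\<close>, which is at
  most 4^n. Comparing powers of 2 leaves at most 2n/k such primes, each with reciprocal below
  1/n.\<close>

lemma sum_inverse_primes_dyadic:
  assumes "k \<ge> 1"
  shows "(\<Sum>q | prime q \<and> 2 ^ k < q \<and> q \<le> 2 ^ Suc k. 1 / real q) \<le> 2 / real k"
proof -
  define n where "n = (2::nat) ^ k"
  define S where "S = {q. prime q \<and> n < q \<and> q \<le> 2 * n}"
  have fin: "finite S" unfolding S_def by auto
  have n0: "n > 0" unfolding n_def by simp
  have "\<Prod>S dvd ((2 * n) choose n)"
  proof (rule prod_primes_dvd[OF fin])
    fix p assume p: "p \<in> S"
    then show pp: "prime p" unfolding S_def by auto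
    have "p dvd fact (2 * n)" using p by (subst prime_dvd_fact_iff) (auto simp: S_def)
    also have "fact (2 * n) = fact n * fact n * ((2 * n) choose n)"
      using binomial_fact_lemma[of n "2 * n"] by simp
    finally show "p dvd ((2 * n) choose n)"
      using p pp by (auto simp: prime_dvd_mult_iff prime_dvd_fact_iff S_def)
  qed
  then have "\<Prod>S \<le> (2 * n) choose n" by (rule dvd_imp_le) (auto simp: zero_less_binomial_iff)
  also have "\<dots> \<le> 2 ^ (2 * n)" by (rule binomial_le_pow2)
  finally have b: "\<Prod>S \<le> 2 ^ (2 * n)" .
  have "(2 ^ k) ^ card S = (\<Prod>q\<in>S. n)" by (simp add: n_def)
  also have "\<dots> \<le> \<Prod>S" by (intro prod_mono) (auto simp: S_def)
  finally have "(2::nat) ^ (k * card S) \<le> 2 ^ (2 * n)" using b by (simp add: power_mult)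
  then have "k * card S \<le> 2 * n" by (simp add: power_le_imp_le_exp)
  then have "real k * real (card S) \<le> 2 * real n"
    by (metis of_nat_le_iff of_nat_mult of_nat_numeral)
  then have c: "real (card S) \<le> 2 * real n / real k" using assms by (simp add: field_simps)
  have "(\<Sum>q\<in>S. 1 / real q) \<le> (\<Sum>q\<in>S. 1 / real n)"
    using n0 by (intro sum_mono divide_left_mono) (auto simp: S_def)
  also have "\<dots> = real (card S) / real n" by simp
  also have "\<dots> \<le> (2 * real n / real k) / real n" using c by (intro divide_right_mono) auto
  also have "\<dots> = 2 / real k" using n0 by simp
  finally show ?thesis unfolding S_def n_def by simp
qed

lemma sum_inverse_nat_le_ln:
  assumes "1 \<le> m" "m \<le> n"
  shows "(\<Sum>k = Suc m..n. 1 / real k) \<le> ln (real n / real m)"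
  using assms(2)
proof (induction n rule: dec_induct)
  case base
  then show ?case using assms by simp
next
  case (step n)
  have n: "n \<ge> 1" using step assms by simp
  have "ln (real n / real (Suc n)) \<le> real n / real (Suc n) - 1"
    using n by (intro ln_le_minus_one) auto
  also have "\<dots> = - (1 / real (Suc n))" by (simp add: field_simps)
  finally have "1 / real (Suc n) \<le> ln (real (Suc n)) - ln (real n)"
    using n by (simp add: ln_div)
  moreover have "(\<Sum>k = Suc m..Suc n. 1 / real k) = (\<Sum>k = Suc m..n. 1 / real k) + 1 / real (Suc n)"
    using step by simp
  moreover have "ln (real n / real m) = ln (real n) - ln (real m)"
    "ln (real (Suc n) / real m) = ln (real (Suc n)) - ln (real m)"
    using n assms by (auto simp: ln_div)
  ultimately show ?case using step.IH by linarith
qed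

text \<open>Dyadic blocks contribute 2/k each, and the harmonic sum over k between log w and log y
  gives the double logarithm. Only upper bounds are needed later, so the constant 4 is not
  optimised.\<close>

lemma sum_inverse_primes_le:
  fixes w y :: real
  assumes "2 \<le> w" "w \<le> y"
  shows "(\<Sum>q | prime q \<and> w < real q \<and> real q \<le> y. 1 / real q) \<le> 4 * (1 + ln (ln y / ln w))"
proof -
  define k0 where "k0 = nat \<lfloor>log 2 w\<rfloor>"
  define k1 where "k1 = nat \<lfloor>log 2 y\<rfloor>"
  have lw: "log 2 w \<ge> 1" using assms by (simp add: le_log_iff)
  have lwy: "log 2 w \<le> log 2 y" using assms by simp
  have k0: "1 \<le> k0" "real k0 \<le> log 2 w" "log 2 w < real k0 + 1"
    unfolding k0_def using lw by linarith+
  have k1: "real k1 \<le> log 2 y" "log 2 y < real k1 + 1"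
    unfolding k1_def using lw lwy by linarith+
  have k01: "k0 \<le> k1" unfolding k0_def k1_def using lwy by (intro nat_mono floor_mono)
  define S where "S = (\<lambda>k. {q::nat. prime q \<and> 2 ^ k < q \<and> q \<le> 2 ^ Suc k})"
  have finS: "finite (S k)" for k unfolding S_def by auto
  have "{q. prime q \<and> w < real q \<and> real q \<le> y} \<subseteq> (\<Union>k\<in>{k0..k1}. S k)"
  proof
    fix q assume "q \<in> {q. prime q \<and> w < real q \<and> real q \<le> y}"
    then have q: "prime q" "w < real q" "real q \<le> y" by auto
    define l where "l = nat (\<lceil>log 2 q\<rceil> - 1)"
    have lq: "log 2 w < log 2 q" "log 2 q \<le> log 2 y" using q assms by auto
    have l: "real l < log 2 q" "log 2 q \<le> real l + 1" unfolding l_def using lq lw by linarith+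
    have "2 powr real l < q" using l q by (simp add: less_log_iff prime_gt_0_nat)
    then have "real (2 ^ l) < real q" by (simp add: powr_realpow)
    moreover have "q \<le> 2 powr real (Suc l)" using l q by (simp add: log_le_iff prime_gt_0_nat add.commute)
    then have "real q \<le> real (2 ^ Suc l)" by (simp only: powr_realpow) simp
    ultimately have "q \<in> S l" unfolding S_def using q by (simp only: of_nat_less_iff of_nat_le_iff) simp
    moreover have "l \<in> {k0..k1}"
    proof -
      have "real k0 < real l + 1" using k0 lq l by linarith
      moreover have "real l < real k1 + 1" using k1 lq l by linarith
      ultimately show ?thesis by simp
    qed
    ultimately show "q \<in> (\<Union>k\<in>{k0..k1}. S k)" by blast
  qed
  then have "(\<Sum>q | prime q \<and> w < real q \<and> real q \<le> y. 1 / real q) \<le> (\<Sum>q\<in>(\<Union>k\<in>{k0..k1}. S k). 1 / real q)"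
    using finS by (intro sum_mono2) auto
  also have "\<dots> \<le> (\<Sum>k\<in>{k0..k1}. \<Sum>q\<in>S k. 1 / real q)"
    using finS by (intro sum_UNION_le) auto
  also have "\<dots> \<le> (\<Sum>k\<in>{k0..k1}. 2 / real k)"
    unfolding S_def using k0 by (intro sum_mono sum_inverse_primes_dyadic) auto
  also have "\<dots> = 2 / real k0 + 2 * (\<Sum>k = Suc k0..k1. 1 / real k)"
    using k01 by (subst sum.atLeast_Suc_atMost) (auto simp: sum_distrib_left)
  also have "\<dots> \<le> 2 + 2 * ln (real k1 / real k0)"
    using sum_inverse_nat_le_ln[of k0 k1] k0 k01 by (intro add_mono mult_left_mono) (auto simp: field_simps)
  \<comment> \<open>Since \<open>k0 \<ge> 1\<close>, rounding down at most halves log w. This costs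
    the summand ln 2 \<le> 1.\<close>
  also have "ln (real k1 / real k0) \<le> ln (2 * (ln y / ln w))"
  proof -
    have "real k1 / real k0 \<le> log 2 y / (log 2 w / 2)"
    proof (intro frac_le)
      have "1 \<le> real k0" using k0 by simp
      then show "log 2 w / 2 \<le> real k0" using k0(3) by simp
    qed (use k1 lw lwy in auto)
    also have "\<dots> = 2 * (ln y / ln w)" by (simp add: log_def)
    finally show ?thesis using k0 k01 assms by (subst ln_le_cancel_iff) auto
  qed
  also have "ln (2 * (ln y / ln w)) = ln 2 + ln (ln y / ln w)"
    using assms by (subst ln_mult) auto
  also have "ln (2::real) \<le> 1" using ln_le_minus_one[of "2::real"] by simp
  also have "2 + 2 * (1 + ln (ln y / ln w)) \<le> 4 * (1 + ln (ln y / ln w))"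
    using assms by simp
  finally show ?thesis by simp
qed

lemma sum_inverse_primes_le_all:
  fixes y :: real
  assumes "2 \<le> y"
  shows "(\<Sum>q | prime q \<and> real q \<le> y. 1 / real q) \<le> 9 + 4 * ln (ln y)"
proof -
  have "{q. prime q \<and> real q \<le> y} = insert 2 {q. prime q \<and> 2 < real q \<and> real q \<le> y}"
    using assms by (auto dest: prime_ge_2_nat)
  moreover have "finite {q. prime q \<and> 2 < real q \<and> real q \<le> y}"
    by (rule finite_subset[OF _ finite_primes_real_le[of y]]) auto
  ultimately have "(\<Sum>q | prime q \<and> real q \<le> y. 1 / real q) =
      1 / 2 + (\<Sum>q | prime q \<and> 2 < real q \<and> real q \<le> y. 1 / real q)"
    by simp
  also have "\<dots> \<le> 1 / 2 + 4 * (1 + ln (ln y / ln 2))"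
    using assms by (intro add_left_mono sum_inverse_primes_le) auto
  also have "ln (ln y / ln 2) = ln (ln y) - ln (ln 2)" using assms by (simp add: ln_div)
  finally have b: "(\<Sum>q | prime q \<and> real q \<le> y. 1 / real q) \<le> 1 / 2 + 4 * (1 + (ln (ln y) - ln (ln 2)))" .
  have "ln (ln (2::real)) \<ge> - 1"
  proof -
    have "ln (2::real) \<ge> 1 / 2"
      using ln_le_minus_one[of "1/2::real"] by (simp add: ln_div)
    moreover have "exp (- 1) \<le> (1 / 2 :: real)"
      using exp_ge_add_one_self[of "1::real"] by (simp add: exp_minus field_simps)
    ultimately show ?thesis by (subst ln_ge_iff) auto
  qed
  then show ?thesis using b by simp
qed

section \<open>The level of distribution is at most one\<close>

lemma finite_hypothesis_Z_moduli:
  "finite {m::nat. m \<ge> 1 \<and> real m \<le> X \<and> P m}"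
  by (rule finite_subset[of _ "{..nat \<lfloor>X\<rfloor>}"]) (auto simp: le_nat_floor)

lemma prime_factors_prod_primes:
  assumes "finite S" "\<And>p. p \<in> S \<Longrightarrow> prime (p::nat)"
  shows "prime_factors (\<Prod>S) = S"
  using assms
proof (induction S rule: finite_induct)
  case (insert p S)
  have "\<Prod>S \<noteq> 0" using insert by (auto dest: prime_gt_0_nat)
  then have "prime_factors (p * \<Prod>S) = prime_factors p \<union> prime_factors (\<Prod>S)"
    using insert by (intro prime_factors_product) (auto dest: prime_gt_0_nat)
  then show ?case using insert by (auto simp: prime_prime_factors)
qed simp

text \<open>For \<open>\<gamma> > 1\<close> take \<open>x = z\<^sup>k\<close> and the products of \<open>k + 1\<close> distinct primes up to \<open>z\<close>: nearly all of these
  smooth moduli exceed \<open>x + 1\<close>, so they divide no \<open>p + 1\<close>, but their number is at least \<open>x\<^bsup>1 + 1/k\<^esup>\<close> up to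
  a power of \<open>log x\<close>.\<close>

lemma hypothesis_Z_le_1:
  assumes "hypothesis_Z \<gamma>"
  shows "\<gamma> \<le> 1"
proof (rule ccontr)
  assume "\<not> \<gamma> \<le> 1"
  define \<epsilon> where "\<epsilon> = (\<gamma> - 1) / 2"
  have \<epsilon>: "\<epsilon> > 0" "\<gamma> - \<epsilon> = 1 + \<epsilon>" using \<open>\<not> \<gamma> \<le> 1\<close> by (auto simp: \<epsilon>_def field_simps)
  obtain \<delta> where \<delta>: "\<delta> > 0" and Z: "\<forall>B\<ge>(1::real). \<forall>a::int. a \<noteq> 0 \<longrightarrow>
       (\<exists>C::real. \<forall>x::real. x \<ge> 2 \<longrightarrow>
         (\<Sum>m | m \<ge> 1 \<and> real m \<le> x powr (\<gamma> - \<epsilon>) \<and>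
                real (largest_prime_factor m) \<le> x powr \<delta> \<and> coprime (int m) a.
            \<bar>real (prime_count_cong x m (- a)) - real (prime_count x) / real (totient m)\<bar>)
         \<le> C * (x / (ln x) powr B))"
    using assms \<epsilon>(1) unfolding hypothesis_Z_def by blast
  \<comment> \<open>The condition 1/k \<le> \<delta> makes primes up to z = x^(1/k) small enough for
    the smoothness condition, and 1/k \<le> \<epsilon> keeps z^(k+1) = x^(1+1/k) inside the range
    x^(1+\<epsilon>) of moduli.\<close>
  obtain k0 :: nat where k0: "real k0 > max (1 / \<delta>) (1 / \<epsilon>)" using reals_Archimedean2 by blast
  define k where "k = Suc k0"
  have k: "k \<ge> 1" "1 / real k \<le> \<delta>" "1 / real k \<le> \<epsilon>"
    using k0 \<delta> \<epsilon>(1) unfolding k_def by (auto simp: field_simps)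
  \<comment> \<open>Of the k + 3 logarithms saved, k + 1 pay for the density of the primes up to z
    in the number of moduli and one for \<pi>(x). The last one produces the contradiction.\<close>
  obtain C where C: "\<And>x::real. x \<ge> 2 \<Longrightarrow>
         (\<Sum>m | m \<ge> 1 \<and> real m \<le> x powr (\<gamma> - \<epsilon>) \<and>
                real (largest_prime_factor m) \<le> x powr \<delta> \<and> coprime (int m) 1.
            \<bar>real (prime_count_cong x m (- 1)) - real (prime_count x) / real (totient m)\<bar>)
         \<le> C * (x / (ln x) powr (real k + 3))"
    using Z[rule_format, of "real k + 3" 1] by auto
  have main: "(1 / (8 * (real k + 1))) ^ (k + 1) - 2 * ln z ^ (k + 1) / z \<le> 8 * \<bar>C\<bar> / ln z"
    if z: "z = real zn" "z \<ge> 3" "z / (8 * ln z) \<ge> real k + 1" for z zn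
  proof -
    define x where "x = z ^ k"
    have x2: "x \<ge> 2"
    proof -
      have "z ^ 1 \<le> z ^ k" using z k by (intro power_increasing) auto
      then have "z \<le> x" unfolding x_def by simp
      then show ?thesis using z by linarith
    qed
    have x0: "x > 0" using x2 by simp
    have lz: "ln z \<ge> 1" using z exp_le by (subst ln_ge_iff) auto
    have lx: "ln x = real k * ln z" unfolding x_def using z by (simp add: ln_realpow)
    have lx_z: "ln x \<ge> ln z" using lx k lz by (simp add: mult_le_cancel_right1)
    have xpow: "x powr (1 / real k) = z" "z ^ (k + 1) = x powr (1 + 1 / real k)"
    proof -
      have "x = z powr real k" unfolding x_def using z by (simp add: powr_realpow)
      then show "x powr (1 / real k) = z" using k z by (simp add: powr_powr)
      then show "z ^ (k + 1) = x powr (1 + 1 / real k)" using x0 by (simp add: powr_add x_def)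
    qed
    define Pz where "Pz = {p::nat. prime p \<and> real p \<le> z}"
    have Pz: "finite Pz" unfolding Pz_def by simp
    define n where "n = card Pz"
    have n: "real n \<ge> z / (8 * ln z)"
      using prime_count_lower[of z] z unfolding n_def Pz_def prime_count_def by simp
    then have "real n \<ge> real (k + 1)" using z by simp
    then have nk: "k + 1 \<le> n" by (simp only: of_nat_le_iff)
    define Ms where "Ms = {S. S \<subseteq> Pz \<and> card S = k + 1}"
    have Ms: "finite Ms" unfolding Ms_def using Pz by simp
    define G where "G = Prod ` Ms"
    have "inj_on Prod Ms"
    proof (rule inj_on_inverseI)
      fix S assume "S \<in> Ms"
      then have "finite S" "\<And>p. p \<in> S \<Longrightarrow> prime p"
        using Pz finite_subset[of S Pz] by (auto simp: Ms_def Pz_def)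
      then show "prime_factors (\<Prod>S) = S" by (rule prime_factors_prod_primes)
    qed
    then have cG: "card G = n choose (k + 1)"
      unfolding G_def n_def using n_subsets[OF Pz, of "k + 1"] by (simp add: card_image Ms_def)
    \<comment> \<open>At most x + 1 products are discarded, whereas in all there are about z x up to
      a power of log z.\<close>
    define G' where "G' = {m \<in> G. real m > x + 1}"
    have Gsmall: "card (G - G') \<le> zn ^ k + 1"
    proof -
      have "G - G' \<subseteq> {1..zn ^ k + 1}"
      proof
        fix m assume m: "m \<in> G - G'"
        then have "real m \<le> real (zn ^ k + 1)" using z by (auto simp: G'_def x_def)
        then have "m \<le> zn ^ k + 1" by (simp only: of_nat_le_iff)
        moreover obtain S where S: "S \<subseteq> Pz" "m = \<Prod>S" using m by (auto simp: G_def Ms_def)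
        have "\<Prod>S > 0" using S by (intro prod_pos prime_gt_0_nat) (auto simp: Pz_def)
        ultimately show "m \<in> {1..zn ^ k + 1}" using S by simp
      qed
      then show ?thesis using card_mono[of "{1..zn ^ k + 1}" "G - G'"] by simp
    qed
    have G'G: "G' \<subseteq> G" "finite G" unfolding G'_def G_def using Ms by auto
    have "card G = card G' + card (G - G')"
      using G'G by (metis card_Diff_subset finite_subset le_add_diff_inverse card_mono)
    then have "n choose (k + 1) \<le> card G' + (zn ^ k + 1)" using Gsmall cG by linarith
    then have "real (n choose (k + 1)) \<le> real (card G' + (zn ^ k + 1))" by (simp only: of_nat_le_iff)
    also have "\<dots> = real (card G') + (x + 1)" using z by (simp add: x_def)
    finally have "real (card G') \<ge> real (n choose (k + 1)) - (x + 1)" by linarith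
    moreover have "(z / (8 * ln z) / (real k + 1)) ^ (k + 1) \<le> real (n choose (k + 1))"
    proof -
      have "(z / (8 * ln z) / (real k + 1)) ^ (k + 1) \<le> (real n / real (k + 1)) ^ (k + 1)"
        using n z(2) lz by (intro power_mono) (simp_all add: divide_right_mono add.commute del: divide_divide_eq_left)
      also have "\<dots> \<le> real (n choose (k + 1))" by (rule binomial_ge_n_over_k_pow_k[OF nk])
      finally show ?thesis .
    qed
    ultimately have cG': "real (card G') \<ge> (z / (8 * ln z) / (real k + 1)) ^ (k + 1) - 2 * x"
      using x2 by linarith
    have Gprop: "m \<ge> 1 \<and> real m \<le> z ^ (k + 1) \<and> real (largest_prime_factor m) \<le> z" if mG: "m \<in> G" for m
    proof -
      obtain S where S: "S \<subseteq> Pz" "card S = k + 1" "m = \<Prod>S"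
        using mG unfolding G_def Ms_def by blast
      have fS: "finite S" using S Pz finite_subset by auto
      have pS: "prime p" "real p \<le> z" if "p \<in> S" for p using S that by (auto simp: Pz_def)
      have m1: "m \<ge> 1" using S fS pS by (auto simp: Suc_le_eq intro!: prod_pos prime_gt_0_nat)
      have "real m = (\<Prod>p\<in>S. real p)" using S by simp
      also have "\<dots> \<le> (\<Prod>p\<in>S. z)" using pS by (intro prod_mono) auto
      also have "\<dots> = z ^ (k + 1)" using S by simp
      finally have m2: "real m \<le> z ^ (k + 1)" .
      have "real (largest_prime_factor m) \<le> z"
      proof (cases "m \<le> 1")
        case False
        have pf: "prime_factors m = S" using S fS pS prime_factors_prod_primes by auto
        have "Max S \<in> S" using fS S by (intro Max_in) auto
        then show ?thesis using False pf pS by (simp add: largest_prime_factor_def)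
      qed (use z in \<open>simp add: largest_prime_factor_def\<close>)
      then show ?thesis using m1 m2 by simp
    qed
    have z0: "z > 0" using z by simp
    have "real (card G') * (real (prime_count x) / z ^ (k + 1)) = (\<Sum>m\<in>G'. real (prime_count x) / z ^ (k + 1))"
      by simp
    also have "\<dots> \<le> (\<Sum>m\<in>G'. \<bar>real (prime_count_cong x m (- 1)) - real (prime_count x) / real (totient m)\<bar>)"
    proof (rule sum_mono)
      fix m assume m: "m \<in> G'"
      \<comment> \<open>A prime p \<le> x in this class would make \<open>m\<close> divide p + 1,
        which is at most x + 1 < m. Hence the whole expected count \<pi>(x)/\<phi>(m) is
        error.\<close>
      have "{p::nat. prime p \<and> real p \<le> x \<and> [int p = - 1] (mod int m)} = {}"
      proof (rule ccontr)
        assume "\<not> ?thesis"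
        then obtain p :: nat where p: "prime p" "real p \<le> x" "[int p = - 1] (mod int m)" by auto
        have "int m dvd int p + 1" using p(3) by (simp add: cong_iff_dvd_diff)
        then have "int m \<le> int p + 1" by (rule zdvd_imp_le) simp
        then have "real m \<le> x + 1" using p(2) by linarith
        then show False using m by (simp add: G'_def)
      qed
      then have "prime_count_cong x m (- 1) = 0" unfolding prime_count_cong_def by (simp only: card.empty)
      moreover have "real (totient m) \<le> z ^ (k + 1)" "totient m > 0"
        using Gprop[of m] m totient_le[of m] by (auto simp: G'_def)
      ultimately show "real (prime_count x) / z ^ (k + 1) \<le>
          \<bar>real (prime_count_cong x m (- 1)) - real (prime_count x) / real (totient m)\<bar>"
        by (simp add: frac_le)
    qed
    also have "\<dots> \<le> (\<Sum>m | m \<ge> 1 \<and> real m \<le> x powr (\<gamma> - \<epsilon>) \<and>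
                real (largest_prime_factor m) \<le> x powr \<delta> \<and> coprime (int m) 1.
            \<bar>real (prime_count_cong x m (- 1)) - real (prime_count x) / real (totient m)\<bar>)"
    proof (rule sum_mono2[OF finite_hypothesis_Z_moduli])
      have a: "z ^ (k + 1) \<le> x powr (\<gamma> - \<epsilon>)"
        unfolding xpow(2) \<epsilon>(2) using k x2 by (intro powr_mono) auto
      have b: "z \<le> x powr \<delta>" using powr_mono[of "1 / real k" \<delta> x] k x2 xpow(1) by simp
      show "G' \<subseteq> {m. m \<ge> 1 \<and> real m \<le> x powr (\<gamma> - \<epsilon>) \<and>
                real (largest_prime_factor m) \<le> x powr \<delta> \<and> coprime (int m) 1}"
        using G'G Gprop a b by fastforce
    qed auto
    also have "\<dots> \<le> C * (x / (ln x) powr (real k + 3))" using C[OF x2] .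
    also have "\<dots> \<le> \<bar>C\<bar> * (x / (ln x) powr (real k + 3))"
      using x0 by (intro mult_right_mono) auto
    finally have h1: "real (card G') * (real (prime_count x) / z ^ (k + 1)) \<le> \<bar>C\<bar> * (x / (ln x) powr (real k + 3))" .
    have lx0: "ln x > 0" using lz lx_z by linarith
    have "real (card G') * (x / (8 * ln x) / z ^ (k + 1)) \<le> real (card G') * (real (prime_count x) / z ^ (k + 1))"
      using prime_count_lower[OF x2] z0 by (intro mult_left_mono divide_right_mono) auto
    then have "real (card G') * (x / (8 * ln x) / z ^ (k + 1)) \<le> \<bar>C\<bar> * (x / (ln x) powr (real k + 3))"
      using h1 by linarith
    moreover have "(ln x) powr (real k + 3) = ln x * ln x ^ (k + 2)"
      using lx0 powr_realpow[OF lx0, of "k + 3"] by (simp add: algebra_simps numeral_3_eq_3)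
    ultimately have "real (card G') / z ^ (k + 1) \<le> 8 * \<bar>C\<bar> / ln x ^ (k + 2)"
      using x0 lx0 z0 by (simp add: field_simps)
    also have "\<dots> \<le> 8 * \<bar>C\<bar> / ln z ^ (k + 2)"
      using lx_z lz by (intro divide_left_mono power_mono mult_pos_pos zero_less_power) auto
    finally have h2: "real (card G') / z ^ (k + 1) \<le> 8 * \<bar>C\<bar> / ln z ^ (k + 2)" .
    have "((z / (8 * ln z) / (real k + 1)) ^ (k + 1) - 2 * x) / z ^ (k + 1) \<le> 8 * \<bar>C\<bar> / ln z ^ (k + 2)"
      using h2 cG' z0 divide_right_mono[OF cG', of "z ^ (k + 1)"] by simp
    then have "((z / (8 * ln z) / (real k + 1)) ^ (k + 1) - 2 * x) / z ^ (k + 1) * ln z ^ (k + 1)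
        \<le> 8 * \<bar>C\<bar> / ln z ^ (k + 2) * ln z ^ (k + 1)"
      using lz by (intro mult_right_mono) auto
    also have "\<dots> = 8 * \<bar>C\<bar> / ln z" using lz by simp
    also have "((z / (8 * ln z) / (real k + 1)) ^ (k + 1) - 2 * x) / z ^ (k + 1) * ln z ^ (k + 1) =
       (1 / (8 * (real k + 1))) ^ (k + 1) - 2 * ln z ^ (k + 1) / z"
    proof -
      have "(z / (8 * ln z) / (real k + 1)) ^ (k + 1) = (1 / (8 * (real k + 1))) ^ (k + 1) * z ^ (k + 1) / ln z ^ (k + 1)"
        by (simp only: power_divide power_mult_distrib) (simp add: field_simps)
      moreover have "(Q * (z * x) / L - 2 * x) / (z * x) * L = Q - 2 * L / z" if "L > 0" for Q L
        using that x0 z0 by (simp add: field_simps)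
      moreover have "z ^ (k + 1) = z * x" by (simp add: x_def)
      ultimately show ?thesis using lz by (simp only: zero_less_power)
    qed
    finally show ?thesis .
  qed
  have "((\<lambda>z. (1 / (8 * (real k + 1))) ^ (k + 1) - 2 * ln z ^ (k + 1) / z - 8 * \<bar>C\<bar> / ln z)
      \<longlongrightarrow> (1 / (8 * (real k + 1))) ^ (k + 1)) at_top"
    by real_asymp
  then have "eventually (\<lambda>z::real. 0 < (1 / (8 * (real k + 1))) ^ (k + 1) - 2 * ln z ^ (k + 1) / z - 8 * \<bar>C\<bar> / ln z) at_top"
    by (rule order_tendstoD) simp
  moreover have "eventually (\<lambda>z::real. z / (8 * ln z) \<ge> real k + 1) at_top" by real_asymp
  ultimately have "eventually (\<lambda>z::real. 0 < (1 / (8 * (real k + 1))) ^ (k + 1) - 2 * ln z ^ (k + 1) / z - 8 * \<bar>C\<bar> / ln z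
      \<and> z / (8 * ln z) \<ge> real k + 1 \<and> z \<ge> 3) at_top"
    using eventually_ge_at_top[of "3::real"] by eventually_elim auto
  then have "eventually (\<lambda>n. 0 < (1 / (8 * (real k + 1))) ^ (k + 1) - 2 * ln (real n) ^ (k + 1) / real n - 8 * \<bar>C\<bar> / ln (real n)
      \<and> real n / (8 * ln (real n)) \<ge> real k + 1 \<and> real n \<ge> 3) sequentially"
    by (rule eventually_compose_filterlim[OF _ filterlim_real_sequentially])
  then obtain n where "0 < (1 / (8 * (real k + 1))) ^ (k + 1) - 2 * ln (real n) ^ (k + 1) / real n - 8 * \<bar>C\<bar> / ln (real n)"
      "real n / (8 * ln (real n)) \<ge> real k + 1" "real n \<ge> 3"
    using eventually_happens'[OF sequentially_bot] by blast
  with main[of "real n" n] show False by linarith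
qed

section \<open>Smoothness of sums of independent variables\<close>

lemma integrable_pmf_bounded:
  fixes f :: "'a \<Rightarrow> real"
  assumes "\<And>x. \<bar>f x\<bar> \<le> B"
  shows "integrable (measure_pmf p) f"
  using assms by (intro measure_pmf.integrable_const_bound[where B = B]) auto

lemma abs_expectation_pmf_le:
  fixes f :: "'a \<Rightarrow> real"
  assumes "\<And>x. \<bar>f x\<bar> \<le> B"
  shows "\<bar>measure_pmf.expectation p f\<bar> \<le> B"
proof -
  have "\<bar>measure_pmf.expectation p f\<bar> \<le> measure_pmf.expectation p (\<lambda>x. \<bar>f x\<bar>)"
    using integral_norm_bound[of "measure_pmf p" f] by simp
  also have "\<dots> \<le> measure_pmf.expectation p (\<lambda>x. B)"
    using assms by (intro integral_mono integrable_abs integrable_pmf_bounded[of f B]) auto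
  finally show ?thesis by simp
qed

lemma expectation_bind_pmf_bounded:
  fixes f :: "'b \<Rightarrow> real"
  assumes "\<And>x. \<bar>f x\<bar> \<le> B"
  shows "measure_pmf.expectation (bind_pmf p k) f
       = measure_pmf.expectation p (\<lambda>x. measure_pmf.expectation (k x) f)"
  unfolding measure_pmf_bind
  by (rule integral_bind[where K = "count_space UNIV" and B' = 1 and B = B])
     (auto simp: assms measure_pmf.emeasure_space_1 measure_pmf_in_subprob_algebra
           intro!: measurable_measure_pmf measurable_count_space
           simp: measure_pmf.emeasure_le_1)

lemma expectation_pair_pmf_bounded:
  fixes f :: "'a \<times> 'b \<Rightarrow> real"
  assumes "\<And>x. \<bar>f x\<bar> \<le> B"
  shows "measure_pmf.expectation (pair_pmf p q) f
       = measure_pmf.expectation p (\<lambda>x. measure_pmf.expectation q (\<lambda>y. f (x, y)))"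
  unfolding pair_pmf_def expectation_bind_pmf_bounded[of f, OF assms] by simp

lemma expectation_Pi_pmf_insert:
  fixes F :: "('a \<Rightarrow> 'b) \<Rightarrow> real"
  assumes "finite A" "x \<notin> A" "\<And>z. \<bar>F z\<bar> \<le> B"
  shows "measure_pmf.expectation (Pi_pmf (insert x A) d p) F
       = measure_pmf.expectation (p x) (\<lambda>y. measure_pmf.expectation (Pi_pmf A d p) (\<lambda>z. F (z(x := y))))"
  unfolding Pi_pmf_insert'[OF assms(1,2)] expectation_bind_pmf_bounded[of F, OF assms(3)] by simp

text \<open>The mean of f(s + B) for B the number of heads among \<open>j\<close> fair coins; in the
  induction below, \<open>j\<close> counts the coins already split off.\<close>

definition binomial_average :: "nat \<Rightarrow> (nat \<Rightarrow> real) \<Rightarrow> nat \<Rightarrow> real" where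
  "binomial_average j f s = (\<Sum>i\<le>j. real (j choose i) * f (s + i)) / 2 ^ j"

lemma binomial_average_0 [simp]: "binomial_average 0 f s = f s"
  by (simp add: binomial_average_def)

lemma binomial_average_Suc:
  "binomial_average (Suc j) f s = (binomial_average j f s + binomial_average j f (Suc s)) / 2"
proof -
  have "(\<Sum>i\<le>Suc j. real (Suc j choose i) * f (s + i))
      = f s + (\<Sum>i\<le>j. real (Suc j choose Suc i) * f (s + Suc i))"
    by (subst sum.atMost_Suc_shift) simp
  also have "\<dots> = f s + (\<Sum>i\<le>j. real (j choose Suc i) * f (s + Suc i)) + (\<Sum>i\<le>j. real (j choose i) * f (Suc s + i))"
    by (simp add: algebra_simps sum.distrib)
  also have "f s + (\<Sum>i\<le>j. real (j choose Suc i) * f (s + Suc i)) = (\<Sum>i\<le>Suc j. real (j choose i) * f (s + i))"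
    by (subst sum.atMost_Suc_shift) simp
  also have "\<dots> = (\<Sum>i\<le>j. real (j choose i) * f (s + i))" by simp
  finally show ?thesis by (simp add: binomial_average_def field_simps)
qed

text \<open>Up to the normalisation \<open>2 ^ M\<close> this is four times the variance M/4 of the
  number of heads, read off from the moments of the Bernstein polynomials at 1/2.\<close>

lemma sum_binomial_variance:
  "(\<Sum>k\<le>M. real (M choose k) * (2 * real k - real M)\<^sup>2) = 2 ^ M * real M"
proof -
  have B: "Bernstein M k (1/2) = real (M choose k) / 2 ^ M" if "k \<le> M" for k
    using that by (simp add: Bernstein_def power_one_over power_add[symmetric] divide_simps)
  have "(\<Sum>k\<le>M. real (M choose k) * (2 * real k - real M)\<^sup>2) / 2 ^ M
    = (\<Sum>k\<le>M. (2 * real k - real M)\<^sup>2 * Bernstein M k (1/2))"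
    by (subst sum_divide_distrib) (intro sum.cong, auto simp: B)
  also have "\<dots> = (\<Sum>k\<le>M. 4 * (real k * (real k - 1) * Bernstein M k (1/2))
      + (4 - 4 * real M) * (real k * Bernstein M k (1/2)) + (real M)\<^sup>2 * Bernstein M k (1/2))"
    by (intro sum.cong refl) (simp add: power2_eq_square algebra_simps)
  also have "\<dots> = 4 * (\<Sum>k\<le>M. real k * (real k - 1) * Bernstein M k (1/2))
      + (4 - 4 * real M) * (\<Sum>k\<le>M. real k * Bernstein M k (1/2)) + (real M)\<^sup>2 * (\<Sum>k\<le>M. Bernstein M k (1/2))"
    by (simp only: sum.distrib sum_distrib_left)
  also have "\<dots> = real M"
    by (simp only: sum_kk_Bernstein sum_k_Bernstein sum_Bernstein) (simp add: power2_eq_square algebra_simps)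
  finally show ?thesis by (simp add: field_simps)
qed

text \<open>Summation by parts moves the difference from \<open>f\<close> to the weights, where (j
  choose (k-1)) - (j choose k) = (M choose k)(2k - M)/M with M = j + 1. What remains is a mean
  absolute deviation, bounded by the variance through d \<le> (d^2/\<tau> + \<tau>)/2.\<close>

lemma binomial_average_diff:
  assumes "\<And>k. \<bar>f k\<bar> \<le> 1" "\<tau> > 0"
  shows "\<bar>binomial_average j (\<lambda>k. f (Suc k) - f k) s\<bar> \<le> \<tau> / (real j + 1) + 1 / \<tau>"
proof -
  define M where "M = Suc j"
  have M: "real M > 0" by (simp add: M_def)
  have c: "(if k = 0 then 0 else real (j choose (k - 1))) - real (j choose k)
      = real (M choose k) * (2 * real k - real M) / real M" if "k \<le> M" for k
  proof (cases k)
    case 0 then show ?thesis using M by (simp add: M_def field_simps)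
  next
    case (Suc l)
    have l: "l \<le> j" using that Suc by (simp add: M_def)
    have e1: "real (Suc l) * real (Suc j choose Suc l) = real (Suc j) * real (j choose l)"
      using Suc_times_binomial[of l j] by (metis of_nat_mult)
    have e2: "real (Suc j choose Suc l) = real (j choose l) + real (j choose Suc l)" by simp
    show ?thesis using e1 e2 M by (simp add: Suc M_def field_simps del: binomial_Suc_Suc)
  qed
  have "(\<Sum>i\<le>j. real (j choose i) * (f (Suc (s + i)) - f (s + i)))
      = (\<Sum>i\<le>j. real (j choose i) * f (s + Suc i)) - (\<Sum>i\<le>j. real (j choose i) * f (s + i))"
    by (simp add: right_diff_distrib sum_subtractf)
  also have "(\<Sum>i\<le>j. real (j choose i) * f (s + Suc i)) = (\<Sum>k\<le>M. (if k = 0 then 0 else real (j choose (k - 1))) * f (s + k))"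
    unfolding M_def by (subst sum.atMost_Suc_shift) simp
  also have "(\<Sum>i\<le>j. real (j choose i) * f (s + i)) = (\<Sum>k\<le>M. real (j choose k) * f (s + k))"
    unfolding M_def by simp
  also have "(\<Sum>k\<le>M. (if k = 0 then 0 else real (j choose (k - 1))) * f (s + k)) - (\<Sum>k\<le>M. real (j choose k) * f (s + k))
     = (\<Sum>k\<le>M. real (M choose k) * (2 * real k - real M) / real M * f (s + k))"
    unfolding sum_subtractf[symmetric]
    by (intro sum.cong refl) (simp only: left_diff_distrib[symmetric] c atMost_iff)
  finally have eq: "binomial_average j (\<lambda>k. f (Suc k) - f k) s
     = (\<Sum>k\<le>M. real (M choose k) * (2 * real k - real M) / real M * f (s + k)) / 2 ^ j"
    by (simp add: binomial_average_def)
  have "\<bar>\<Sum>k\<le>M. real (M choose k) * (2 * real k - real M) / real M * f (s + k)\<bar>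
     \<le> (\<Sum>k\<le>M. \<bar>real (M choose k) * (2 * real k - real M) / real M * f (s + k)\<bar>)" by (rule sum_abs)
  also have "\<dots> \<le> (\<Sum>k\<le>M. real (M choose k) * ((2 * real k - real M)\<^sup>2 / \<tau> + \<tau>) / (2 * real M))"
  proof (rule sum_mono)
    fix k
    define d where "d = \<bar>2 * real k - real M\<bar>"
    have "0 \<le> (d - \<tau>)\<^sup>2" by simp
    then have "2 * d * \<tau> \<le> d\<^sup>2 + \<tau> * \<tau>" by (simp add: power2_eq_square algebra_simps)
    then have d: "d \<le> (d\<^sup>2 / \<tau> + \<tau>) / 2" using assms(2) by (simp add: field_simps)
    have "\<bar>real (M choose k) * (2 * real k - real M) / real M * f (s + k)\<bar>
       = real (M choose k) * d / real M * \<bar>f (s + k)\<bar>" by (simp add: abs_mult d_def)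
    also have "\<dots> \<le> real (M choose k) * d / real M * 1"
      using assms(1) by (intro mult_left_mono) (auto simp: d_def)
    also have "\<dots> \<le> real (M choose k) * ((d\<^sup>2 / \<tau> + \<tau>) / 2) / real M * 1"
      using d by (intro mult_right_mono divide_right_mono mult_left_mono) auto
    also have "\<dots> = real (M choose k) * ((2 * real k - real M)\<^sup>2 / \<tau> + \<tau>) / (2 * real M)"
      by (simp add: d_def)
    finally show "\<bar>real (M choose k) * (2 * real k - real M) / real M * f (s + k)\<bar>
       \<le> real (M choose k) * ((2 * real k - real M)\<^sup>2 / \<tau> + \<tau>) / (2 * real M)" .
  qed
  also have "\<dots> = ((\<Sum>k\<le>M. real (M choose k) * (2 * real k - real M)\<^sup>2) / \<tau> + \<tau> * (\<Sum>k\<le>M. real (M choose k))) / (2 * real M)"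
    by (simp add: sum_divide_distrib sum_distrib_left sum.distrib algebra_simps add_divide_distrib)
  also have "(\<Sum>k\<le>M. real (M choose k)) = 2 ^ M"
    using choose_row_sum[of M] by (metis of_nat_numeral of_nat_power of_nat_sum)
  also have "((\<Sum>k\<le>M. real (M choose k) * (2 * real k - real M)\<^sup>2) / \<tau> + \<tau> * 2 ^ M) / (2 * real M)
     = 2 ^ j * (\<tau> / (real j + 1) + 1 / \<tau>)"
  proof -
    have "((2 * P * r) / \<tau> + \<tau> * (2 * P)) / (2 * r) = P * (\<tau> / r + 1 / \<tau>)" if "r > 0" for P r :: real
      using that assms(2) by (simp add: field_simps)
    from this[of "real M" "2 ^ j"] show ?thesis
      unfolding sum_binomial_variance by (simp add: M_def add.commute)
  qed
  finally show ?thesis unfolding eq by (simp add: abs_divide pos_divide_le_eq mult.commute)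
qed

text \<open>Taking mass \<beta> away from each of the points 0 and 1 leaves a nonnegative measure of
  total mass 1 - 2\<beta>. Positivity is applied to both c - G and c + G.\<close>

lemma expectation_remove_atoms:
  fixes G :: "nat \<Rightarrow> real"
  assumes "\<And>k. \<bar>G k\<bar> \<le> c" "\<beta> \<le> pmf D 0" "\<beta> \<le> pmf D 1"
  shows "\<bar>measure_pmf.expectation D G - \<beta> * (G 0 + G 1)\<bar> \<le> (1 - 2 * \<beta>) * c"
proof -
  have pos: "\<beta> * (h 0 + h 1) \<le> measure_pmf.expectation D h"
    if h: "\<And>k. 0 \<le> h k" "\<And>k. h k \<le> 2 * c" for h :: "nat \<Rightarrow> real"
  proof -
    have "\<beta> * (h 0 + h 1) \<le> pmf D 0 * h 0 + pmf D 1 * h 1"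
      using assms h by (auto simp: distrib_left intro!: add_mono mult_right_mono)
    also have "\<dots> = (\<Sum>a\<in>{0,1}. (h a * indicator {0,1} a) * pmf D a)" by simp
    also have "\<dots> = measure_pmf.expectation D (\<lambda>k. h k * indicator {0,1} k)"
      by (intro integral_measure_pmf_real[symmetric]) (auto simp: indicator_def split: if_splits)
    also have "\<dots> \<le> measure_pmf.expectation D h"
      using h order_trans[OF h(1) h(2)]
      by (intro integral_mono integrable_pmf_bounded[where B = "2 * c"]) (auto simp: indicator_def)
    finally show ?thesis .
  qed
  have G: "- c \<le> G k" "G k \<le> c" for k using assms(1)[of k] by (auto simp: abs_le_iff)
  have int: "integrable (measure_pmf D) G" using assms(1) by (rule integrable_pmf_bounded)
  have G': "0 \<le> c - G k" "c - G k \<le> 2 * c" "0 \<le> c + G k" "c + G k \<le> 2 * c" for k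
    using G[of k] by linarith+
  have "\<beta> * ((c - G 0) + (c - G 1)) \<le> measure_pmf.expectation D (\<lambda>k. c - G k)"
    by (rule pos) (rule G')+
  moreover have "\<beta> * ((c + G 0) + (c + G 1)) \<le> measure_pmf.expectation D (\<lambda>k. c + G k)"
    by (rule pos) (rule G')+
  moreover have "measure_pmf.expectation D (\<lambda>k. c - G k) = c - measure_pmf.expectation D G"
    "measure_pmf.expectation D (\<lambda>k. c + G k) = c + measure_pmf.expectation D G"
    using int by simp_all
  ultimately show ?thesis by (simp add: abs_le_iff algebra_simps)
qed

lemma abs_binomial_average_le:
  assumes "\<And>k. \<bar>f k\<bar> \<le> B"
  shows "\<bar>binomial_average j f s\<bar> \<le> B"
proof (induction j arbitrary: s)
  case (Suc j)
  show ?case unfolding binomial_average_Suc using Suc[of s] Suc[of "Suc s"] by (simp add: abs_le_iff field_simps)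
qed (use assms in auto)

text \<open>A law with mass at least \<open>\<beta>\<close> at both \<open>0\<close> and \<open>1\<close> contains a fair coin with weight \<open>2\<beta>\<close>. The free parameter
  \<open>\<tau>\<close> linearises \<open>1 / sqrt\<close>, so that the bound is preserved under mixtures in the induction.\<close>

lemma shift_expectation_aux:
  fixes D :: "'a \<Rightarrow> nat pmf" and \<beta> :: "'a \<Rightarrow> real"
  assumes "finite T" "\<And>k. \<bar>f k\<bar> \<le> 1" "\<tau> > 0"
    and "\<And>q. q \<in> T \<Longrightarrow> 0 \<le> \<beta> q \<and> \<beta> q \<le> pmf (D q) 0 \<and> \<beta> q \<le> pmf (D q) 1"
  shows "\<bar>measure_pmf.expectation (Pi_pmf T 0 D)
            (\<lambda>z. binomial_average j (\<lambda>k. f (Suc k) - f k) (s + (\<Sum>q\<in>T. z q)))\<bar>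
         \<le> \<tau> / ((\<Sum>q\<in>T. \<beta> q) + real j + 1) + 1 / \<tau>"
  using assms(1,4)
proof (induction T arbitrary: j s rule: finite_induct)
  case empty
  show ?case using binomial_average_diff[OF assms(2,3), where j = j and s = s] by simp
next
  case (insert x T)
  let ?\<Delta> = "\<lambda>k. f (Suc k) - f k"
  have b\<Delta>: "\<bar>?\<Delta> k\<bar> \<le> 2" for k using assms(2)[of k] assms(2)[of "Suc k"] by linarith
  have bb: "\<bar>binomial_average j ?\<Delta> k\<bar> \<le> 2" for j k by (rule abs_binomial_average_le[OF b\<Delta>])
  define \<Lambda> where "\<Lambda> = (\<Sum>q\<in>T. \<beta> q)"
  define J where "J = (\<lambda>L j. \<tau> / (L + real j + 1) + 1 / \<tau>)"
  define G where "G = (\<lambda>y. measure_pmf.expectation (Pi_pmf T 0 D) (\<lambda>z. binomial_average j ?\<Delta> (s + y + (\<Sum>q\<in>T. z q))))"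
  have \<Lambda>0: "\<Lambda> \<ge> 0" unfolding \<Lambda>_def using insert.prems by (intro sum_nonneg) auto
  have b: "0 \<le> \<beta> x" "\<beta> x \<le> pmf (D x) 0" "\<beta> x \<le> pmf (D x) 1" using insert.prems by auto
  have "pmf (D x) 0 + pmf (D x) 1 = (\<Sum>k\<in>{0,1}. pmf (D x) k)" by simp
  also have "\<dots> \<le> 1" by (metis finite.emptyI finite_insert measure_measure_pmf_finite measure_pmf.prob_le_1)
  finally have b2: "2 * \<beta> x \<le> 1" using b by linarith
  have "measure_pmf.expectation (Pi_pmf (insert x T) 0 D)
            (\<lambda>z. binomial_average j ?\<Delta> (s + (\<Sum>q\<in>insert x T. z q)))
     = measure_pmf.expectation (D x) (\<lambda>y. measure_pmf.expectation (Pi_pmf T 0 D)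
          (\<lambda>z. binomial_average j ?\<Delta> (s + (\<Sum>q\<in>insert x T. (z(x := y)) q))))"
    using insert.hyps bb by (intro expectation_Pi_pmf_insert) auto
  also have "\<dots> = measure_pmf.expectation (D x) G"
  proof -
    have "(\<Sum>q\<in>insert x T. (z(x := y)) q) = y + (\<Sum>q\<in>T. z q)" for z :: "'a \<Rightarrow> nat" and y
      using insert.hyps by (simp, intro sum.cong) auto
    then show ?thesis by (simp add: G_def add.assoc)
  qed
  finally have eq: "measure_pmf.expectation (Pi_pmf (insert x T) 0 D)
            (\<lambda>z. binomial_average j ?\<Delta> (s + (\<Sum>q\<in>insert x T. z q))) = measure_pmf.expectation (D x) G" .
  have G: "\<bar>G y\<bar> \<le> J \<Lambda> j" for y
    unfolding G_def J_def \<Lambda>_def using insert.IH[of j "s + y"] insert.prems by auto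
  \<comment> \<open>Pascal's rule: the values 0 and 1 with equal weights act as one more fair coin,
    so the induction hypothesis is used with \<open>Suc j\<close>.\<close>
  have "G 0 + G 1 = 2 * measure_pmf.expectation (Pi_pmf T 0 D) (\<lambda>z. binomial_average (Suc j) ?\<Delta> (s + (\<Sum>q\<in>T. z q)))"
    unfolding G_def binomial_average_Suc
    by (subst Bochner_Integration.integral_add[symmetric])
       (auto intro!: integrable_pmf_bounded[OF bb] simp del: Bochner_Integration.integral_add)
  then have "\<bar>G 0 + G 1\<bar> \<le> 2 * J \<Lambda> (Suc j)"
    using insert.IH[of "Suc j" s] insert.prems by (simp add: J_def \<Lambda>_def abs_mult)
  then have g2: "\<bar>\<beta> x * (G 0 + G 1)\<bar> \<le> \<beta> x * (2 * J \<Lambda> (Suc j))"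
    using b by (simp add: abs_mult mult_left_mono)
  have g1: "\<bar>measure_pmf.expectation (D x) G - \<beta> x * (G 0 + G 1)\<bar> \<le> (1 - 2 * \<beta> x) * J \<Lambda> j"
    using G b by (intro expectation_remove_atoms) auto
  have "\<bar>measure_pmf.expectation (D x) G\<bar> \<le> (1 - 2 * \<beta> x) * J \<Lambda> j + \<beta> x * (2 * J \<Lambda> (Suc j))"
    using g1 g2 by linarith
  also have "\<dots> \<le> J (\<Lambda> + \<beta> x) j"
  proof -
    define w where "w = \<Lambda> + real j + 1"
    define c where "c = \<beta> x"
    have w: "w \<ge> 1" using \<Lambda>0 by (simp add: w_def)
    have c: "c \<ge> 0" "2 * c \<le> 1" using b b2 by (auto simp: c_def)
    \<comment> \<open>By convexity the mixture is at least 1/(w + 2c), so the full gain 2c cannot be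
      kept. Half of it can, because w \<ge> 1.\<close>
    have "(1 - 2 * c) / w + 2 * c / (w + 1) \<le> 1 / (w + c)"
    proof -
      have "1 / (w + c) - ((1 - 2 * c) / w + 2 * c / (w + 1)) = c * (w - 1 + 2 * c) / (w * (w + 1) * (w + c))"
        using w c by (simp add: divide_simps) (simp add: algebra_simps power2_eq_square)
      also have "\<dots> \<ge> 0" using w c by (intro divide_nonneg_nonneg mult_nonneg_nonneg) auto
      finally show ?thesis by linarith
    qed
    then have "\<tau> * ((1 - 2 * c) / w + 2 * c / (w + 1)) \<le> \<tau> * (1 / (w + c))"
      using assms(3) by (intro mult_left_mono) auto
    moreover have "J \<Lambda> j = \<tau> / w + 1 / \<tau>" "J \<Lambda> (Suc j) = \<tau> / (w + 1) + 1 / \<tau>" "J (\<Lambda> + \<beta> x) j = \<tau> / (w + c) + 1 / \<tau>"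
      by (simp_all add: J_def w_def c_def algebra_simps)
    moreover have "(1 - 2 * c) * (\<tau> / w + 1 / \<tau>) + c * (2 * (\<tau> / (w + 1) + 1 / \<tau>))
        = \<tau> * ((1 - 2 * c) / w + 2 * c / (w + 1)) + 1 / \<tau>"
    proof -
      have "(1 - 2 * c) * (A + t) + c * (2 * (B + t)) = ((1 - 2 * c) * A + 2 * c * B) + t" for A B t :: real
        by (simp add: algebra_simps)
      moreover have "\<tau> * ((1 - 2 * c) / w + 2 * c / (w + 1)) = (1 - 2 * c) * (\<tau> / w) + 2 * c * (\<tau> / (w + 1))"
        by (simp add: distrib_left mult.commute)
      ultimately show ?thesis by (simp only:)
    qed
    ultimately show ?thesis by (simp add: c_def[symmetric])
  qed
  finally show ?case unfolding eq using insert.hyps by (simp add: J_def \<Lambda>_def add.commute)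
qed

lemma shift_expectation_bound:
  fixes D :: "'a \<Rightarrow> nat pmf" and \<beta> :: "'a \<Rightarrow> real"
  assumes "finite T" "\<And>k. \<bar>f k\<bar> \<le> 1"
    and "\<And>q. q \<in> T \<Longrightarrow> 0 \<le> \<beta> q \<and> \<beta> q \<le> pmf (D q) 0 \<and> \<beta> q \<le> pmf (D q) 1"
  shows "\<bar>measure_pmf.expectation (Pi_pmf T 0 D) (\<lambda>z. f (Suc (\<Sum>q\<in>T. z q)) - f (\<Sum>q\<in>T. z q))\<bar>
         \<le> 2 / sqrt (1 + (\<Sum>q\<in>T. \<beta> q))"
proof -
  have s0: "(\<Sum>q\<in>T. \<beta> q) \<ge> 0" using assms(3) by (intro sum_nonneg) auto
  define w where "w = 1 + (\<Sum>q\<in>T. \<beta> q)"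
  have "\<bar>measure_pmf.expectation (Pi_pmf T 0 D) (\<lambda>z. f (Suc (\<Sum>q\<in>T. z q)) - f (\<Sum>q\<in>T. z q))\<bar>
      \<le> sqrt w / w + 1 / sqrt w"
    using shift_expectation_aux[OF assms(1,2) _ assms(3), where \<tau> = "sqrt w" and j = 0 and s = 0] s0
    by (simp add: w_def add.commute)
  also have "sqrt w / w = 1 / sqrt w"
    using s0 by (simp add: w_def field_simps)
  finally show ?thesis by (simp add: w_def)
qed

section \<open>Changing the law at one prime\<close>

text \<open>The law of the exponent of \<open>q\<close>: \<open>e\<close> is the probability that
  \<open>q\<close> divides, and each further factor has conditional probability 1/q. Random integers
  have e = 1/q; shifted primes have e = 1/(q - 1), or 0 if \<open>q\<close> divides
  \<open>a\<close>. Thus the two models differ in \<open>e\<close> only.\<close>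

definition inflated_geometric :: "real \<Rightarrow> nat \<Rightarrow> nat pmf" where
  "inflated_geometric e q =
     bind_pmf (bernoulli_pmf e)
       (\<lambda>b. if b then map_pmf Suc (geometric_pmf (1 - 1 / real q)) else return_pmf 0)"

lemma expectation_inflated_geometric:
  assumes "0 \<le> e" "e \<le> 1" "\<And>k. \<bar>h k\<bar> \<le> B"
  shows "measure_pmf.expectation (inflated_geometric e q) h =
     (1 - e) * h 0 + e * measure_pmf.expectation (geometric_pmf (1 - 1 / real q)) (\<lambda>k. h (Suc k))"
  unfolding inflated_geometric_def expectation_bind_pmf_bounded[of h, OF assms(3)]
  using assms(1,2) by simp

lemma prob_inflated_geometric_ge:
  assumes "0 \<le> e" "e \<le> 1" "q \<ge> 2"
  shows "measure_pmf.prob (inflated_geometric e q) {Suc i..} = e / real q ^ i"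
proof -
  have g: "measure_pmf.prob (geometric_pmf (1 - 1 / real q)) {i..} = (1 / real q) ^ i"
  proof (induction i)
    case (Suc i)
    have "{i..} = insert i {Suc i..}" by auto
    then have "measure_pmf.prob (geometric_pmf (1 - 1 / real q)) {i..}
       = pmf (geometric_pmf (1 - 1 / real q)) i + measure_pmf.prob (geometric_pmf (1 - 1 / real q)) {Suc i..}"
      by (simp add: measure_pmf.finite_measure_Union[of "{i}" _ "{Suc i..}", simplified] measure_pmf_single)
    then show ?case using Suc assms by (simp add: field_simps)
  qed simp
  have "measure_pmf.prob (inflated_geometric e q) {Suc i..}
     = measure_pmf.expectation (inflated_geometric e q) (indicator {Suc i..})" by simp
  also have "\<dots> = e * measure_pmf.expectation (geometric_pmf (1 - 1 / real q)) (\<lambda>k. indicator {Suc i..} (Suc k))"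
    using assms by (subst expectation_inflated_geometric[where B = 1]) (auto simp: indicator_def)
  also have "(\<lambda>k. indicator {Suc i..} (Suc k) :: real) = indicator {i..}"
    by (auto simp: indicator_def fun_eq_iff)
  finally show ?thesis by (simp add: g power_one_over field_simps)
qed

lemma abs_diff_le_mult_of_steps:
  fixes h :: "nat \<Rightarrow> real"
  assumes "\<And>k. \<bar>h (Suc k) - h k\<bar> \<le> c"
  shows "\<bar>h k - h 0\<bar> \<le> real k * c"
proof (induction k)
  case (Suc k)
  then show ?case using assms[of k] by (simp add: algebra_simps abs_le_iff)
qed simp

text \<open>The expectation is affine in \<open>e\<close> with slope m - h(0), where m is the mean
  of h(\<phi>(k)) given k \<ge> 1. The slope is at most c times the conditional mean of k, and that
  mean is at most 2. The hypotheses on \<open>\<phi>\<close> allow both the exponent itself and the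
  indicator that it is positive.\<close>

lemma expectation_inflated_geometric_diff:
  assumes e: "0 \<le> e" "e \<le> 1" "0 \<le> e'" "e' \<le> 1" and q: "q \<ge> 2"
    and h: "\<And>k. \<bar>h k\<bar> \<le> 1" "\<And>k. \<bar>h (Suc k) - h k\<bar> \<le> c"
    and \<phi>: "\<phi> 0 = 0" "\<And>k. \<phi> k \<le> k"
  shows "\<bar>measure_pmf.expectation (inflated_geometric e' q) (\<lambda>k. h (\<phi> k))
        - measure_pmf.expectation (inflated_geometric e q) (\<lambda>k. h (\<phi> k))\<bar> \<le> \<bar>e' - e\<bar> * (2 * c)"
proof -
  define p where "p = 1 - 1 / real q"
  have p: "0 < p" "p \<le> 1" "1 / 2 \<le> p" using q by (auto simp: p_def field_simps)
  define m where "m = measure_pmf.expectation (geometric_pmf p) (\<lambda>k. h (\<phi> (Suc k)))"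
  have c0: "c \<ge> 0" using h(2)[of 0] by linarith
  have int: "integrable (geometric_pmf p) (\<lambda>k. h (\<phi> (Suc k)))"
    by (rule integrable_pmf_bounded[where B = 1]) (rule h)
  have intr: "integrable (geometric_pmf p) (\<lambda>k. (real k + 1) * c)"
    using integrable_real_geometric_pmf[of p] p by (intro integrable_mult_left integrable_add) auto
  have "\<bar>h (\<phi> (Suc k)) - h 0\<bar> \<le> (real k + 1) * c" for k
  proof -
    have "\<bar>h (\<phi> (Suc k)) - h 0\<bar> \<le> real (\<phi> (Suc k)) * c" by (rule abs_diff_le_mult_of_steps) (rule h(2))
    also have "\<dots> \<le> (real k + 1) * c"
    proof (rule mult_right_mono[OF _ c0])
      show "real (\<phi> (Suc k)) \<le> real k + 1" using \<phi>(2)[of "Suc k"] by linarith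
    qed
    finally show ?thesis .
  qed
  then have "\<bar>measure_pmf.expectation (geometric_pmf p) (\<lambda>k. h (\<phi> (Suc k)) - h 0)\<bar>
      \<le> measure_pmf.expectation (geometric_pmf p) (\<lambda>k. (real k + 1) * c)"
    using int intr by (intro order_trans[OF integral_abs_bound] integral_mono integrable_abs) auto
  also have "measure_pmf.expectation (geometric_pmf p) (\<lambda>k. (real k + 1) * c) = ((1 - p) / p + 1) * c"
    using integrable_real_geometric_pmf[of p] expectation_geometric_pmf[of p] p by simp
  also have "\<dots> \<le> 2 * c" using p c0 by (intro mult_right_mono) (auto simp: field_simps)
  also have "measure_pmf.expectation (geometric_pmf p) (\<lambda>k. h (\<phi> (Suc k)) - h 0) = m - h 0"
    using int by (simp add: m_def)
  finally have mh: "\<bar>m - h 0\<bar> \<le> 2 * c" .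
  have "measure_pmf.expectation (inflated_geometric e' q) (\<lambda>k. h (\<phi> k))
      - measure_pmf.expectation (inflated_geometric e q) (\<lambda>k. h (\<phi> k)) = (e' - e) * (m - h 0)"
    using e h(1) \<phi>(1)
    by (simp add: expectation_inflated_geometric[where B = 1] m_def p_def algebra_simps)
  then show ?thesis using mh by (simp add: abs_mult mult_left_mono)
qed

lemma pmf_map_inflated_geometric_0:
  assumes "0 \<le> e" "e \<le> 1" "\<phi> 0 = (0::nat)" "\<And>k. \<phi> (Suc k) \<noteq> 0"
  shows "pmf (map_pmf \<phi> (inflated_geometric e q)) 0 = 1 - e"
proof -
  have "pmf (map_pmf \<phi> (inflated_geometric e q)) (0::nat)
      = measure_pmf.expectation (inflated_geometric e q) (indicator (\<phi> -` {0}))"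
    by (simp add: pmf_map)
  also have "\<dots> = 1 - e"
  proof -
    have "(\<lambda>k. indicator (\<phi> -` {0}) (Suc k) :: real) = (\<lambda>_. 0)"
      using assms(4) by (auto simp: indicator_def fun_eq_iff)
    then show ?thesis
      using assms(1-3) by (subst expectation_inflated_geometric[where B = 1]) (auto simp: indicator_def)
  qed
  finally show ?thesis .
qed

lemma pmf_map_inflated_geometric_1:
  assumes "0 \<le> e" "e \<le> 1" "q \<ge> 2" "\<phi> 0 = 0" "\<phi> (Suc 0) = (1::nat)"
  shows "pmf (map_pmf \<phi> (inflated_geometric e q)) 1 \<ge> e / 2"
proof -
  have "e / 2 \<le> e * (1 - 1 / real q)" using assms by (simp add: field_simps mult_left_mono)
  also have "1 - 1 / real q = pmf (geometric_pmf (1 - 1 / real q)) 0" using assms by simp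
  also have "\<dots> = measure_pmf.expectation (geometric_pmf (1 - 1 / real q)) (indicator {0})"
    by (simp add: measure_pmf_single)
  also have "\<dots> \<le> measure_pmf.expectation (geometric_pmf (1 - 1 / real q)) (\<lambda>k. indicator (\<phi> -` {1}) (Suc k))"
    using assms by (intro integral_mono integrable_pmf_bounded[where B = 1]) (auto simp: indicator_def)
  also have "e * \<dots> = measure_pmf.expectation (inflated_geometric e q) (indicator (\<phi> -` {1}))"
    using assms by (subst expectation_inflated_geometric[where B = 1]) (auto simp: indicator_def)
  also have "\<dots> = pmf (map_pmf \<phi> (inflated_geometric e q)) 1" by (simp add: pmf_map)
  finally show ?thesis using assms by (simp add: mult_left_mono)
qed

text \<open>Condition on the coordinates in \<open>A\<close> and apply the shift bound to those in
  \<open>T\<close>. Resetting the coordinates outside \<open>A\<close> to 0 makes the first argument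
  of \<open>g\<close> independent of the summands indexed by \<open>T\<close>.\<close>

lemma shift_expectation_union:
  fixes D :: "'a \<Rightarrow> nat pmf" and g :: "('a \<Rightarrow> nat) \<Rightarrow> nat \<Rightarrow> real"
  assumes "finite A" "finite T" "A \<inter> T = {}" and g: "\<And>w k. \<bar>g w k\<bar> \<le> 1"
    and \<phi>: "\<phi> 0 = (0::nat)"
    and \<beta>: "\<And>q. q \<in> T \<Longrightarrow> 0 \<le> \<beta> q \<and> \<beta> q \<le> pmf (map_pmf \<phi> (D q)) 0 \<and> \<beta> q \<le> pmf (map_pmf \<phi> (D q)) 1"
  defines "h \<equiv> \<lambda>k. measure_pmf.expectation (Pi_pmf (A \<union> T) 0 D)
            (\<lambda>z. g (\<lambda>x. if x \<in> A then z x else 0) ((\<Sum>q\<in>T. \<phi> (z q)) + k))"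
  shows "\<bar>h (Suc k) - h k\<bar> \<le> 2 / sqrt (1 + (\<Sum>q\<in>T. \<beta> q))"
proof -
  have h_eq: "h k = measure_pmf.expectation (Pi_pmf A 0 D) (\<lambda>w. measure_pmf.expectation (Pi_pmf T 0 D)
      (\<lambda>z. g (\<lambda>x. if x \<in> A then w x else 0) ((\<Sum>q\<in>T. \<phi> (z q)) + k)))" for k
  proof -
    have s: "(\<Sum>q\<in>T. \<phi> (if q \<in> A then w q else z q)) = (\<Sum>q\<in>T. \<phi> (z q))" for w z :: "'a \<Rightarrow> nat"
      using assms(3) by (intro sum.cong) auto
    have "h k = measure_pmf.expectation (pair_pmf (Pi_pmf A 0 D) (Pi_pmf T 0 D))
       (\<lambda>(w, z). g (\<lambda>x. if x \<in> A then w x else 0) ((\<Sum>q\<in>T. \<phi> (z q)) + k))"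
      unfolding h_def Pi_pmf_union[OF assms(1,2,3)] by (simp add: case_prod_unfold s cong: if_cong)
    then show ?thesis
      by (subst (asm) expectation_pair_pmf_bounded[where B = 1]) (use g in auto)
  qed
  define S where "S = (\<lambda>w k. measure_pmf.expectation (Pi_pmf T 0 D)
      (\<lambda>z. g (\<lambda>x. if x \<in> A then w x else 0) ((\<Sum>q\<in>T. \<phi> (z q)) + k)))"
  have hS: "h k = measure_pmf.expectation (Pi_pmf A 0 D) (\<lambda>w. S w k)" for k
    unfolding h_eq S_def ..
  have S1: "\<bar>S w k\<bar> \<le> 1" for w k unfolding S_def by (rule abs_expectation_pmf_le) (rule g)
  have "\<bar>S w (Suc k) - S w k\<bar> \<le> 2 / sqrt (1 + (\<Sum>q\<in>T. \<beta> q))" for w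
  proof -
    define f where "f = (\<lambda>s. g (\<lambda>x. if x \<in> A then w x else 0) (s + k))"
    have f1: "\<bar>f s\<bar> \<le> 1" for s unfolding f_def by (rule g)
    have "S w (Suc k) - S w k = measure_pmf.expectation (Pi_pmf T 0 D)
        (\<lambda>z. f (Suc (\<Sum>q\<in>T. \<phi> (z q))) - f (\<Sum>q\<in>T. \<phi> (z q)))"
      unfolding S_def f_def
      by (subst Bochner_Integration.integral_diff) (auto intro!: integrable_pmf_bounded[where B = 1] g)
    also have "\<dots> = measure_pmf.expectation (Pi_pmf T 0 (\<lambda>q. map_pmf \<phi> (D q)))
        (\<lambda>z. f (Suc (\<Sum>q\<in>T. z q)) - f (\<Sum>q\<in>T. z q))"
      using assms(2) \<phi> by (subst Pi_pmf_map[where dflt = 0]) auto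
    finally show ?thesis using shift_expectation_bound[OF assms(2) f1 \<beta>] by simp
  qed
  then have "\<bar>measure_pmf.expectation (Pi_pmf A 0 D) (\<lambda>w. S w (Suc k) - S w k)\<bar> \<le> 2 / sqrt (1 + (\<Sum>q\<in>T. \<beta> q))"
    by (rule abs_expectation_pmf_le)
  moreover have "measure_pmf.expectation (Pi_pmf A 0 D) (\<lambda>w. S w (Suc k) - S w k) = h (Suc k) - h k"
    unfolding hS
    by (subst Bochner_Integration.integral_diff) (auto intro!: integrable_pmf_bounded[where B = 1] S1)
  ultimately show ?thesis by simp
qed

text \<open>The sets \<open>T i\<close> being disjoint, the exponent of \<open>q\<close> only shifts
  the sum that belongs to \<open>T j\<close>. After averaging over all other primes the test
  function is therefore Lipschitz in this shift, with the constant supplied by the coins at the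
  primes of \<open>T j\<close> other than \<open>q\<close>.\<close>

lemma replace_one_coordinate:
  fixes T :: "nat \<Rightarrow> nat set" and \<Phi> :: "(nat \<Rightarrow> nat) \<Rightarrow> real" and \<phi> :: "nat \<Rightarrow> nat \<Rightarrow> nat"
  assumes I: "finite I" "\<And>i. i \<in> I \<Longrightarrow> finite (T i)" "disjoint_family_on T I"
    and \<Phi>: "\<And>w. \<bar>\<Phi> w\<bar> \<le> 1"
    and \<phi>: "\<And>i. i \<in> I \<Longrightarrow> \<phi> i 0 = 0" "\<And>i k. i \<in> I \<Longrightarrow> \<phi> i k \<le> k"
      "\<And>i k. i \<in> I \<Longrightarrow> \<phi> i (Suc k) \<noteq> 0"
    and e: "\<And>q. 0 \<le> e q \<and> e q \<le> 1" "0 \<le> e'" "e' \<le> 1"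
    and q: "j \<in> I" "q \<in> T j" "\<And>i r. i \<in> I \<Longrightarrow> r \<in> T i \<Longrightarrow> r \<ge> 2"
    and \<beta>: "\<And>r. r \<in> T j \<Longrightarrow> 0 \<le> \<beta> r \<and> \<beta> r \<le> 1 - e r \<and> \<beta> r \<le> e r / 2"
  defines "F \<equiv> \<lambda>z. \<Phi> (\<lambda>i\<in>I. \<Sum>r\<in>T i. \<phi> i (z r))" and "U \<equiv> \<Union>i\<in>I. T i"
  shows "\<bar>measure_pmf.expectation (Pi_pmf U 0 (\<lambda>r. inflated_geometric ((e(q := e')) r) r)) F
        - measure_pmf.expectation (Pi_pmf U 0 (\<lambda>r. inflated_geometric (e r) r)) F\<bar>
        \<le> \<bar>e' - e q\<bar> * (4 / sqrt (1 + (\<Sum>r\<in>T j - {q}. \<beta> r)))"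
proof -
  define T' where "T' = T j - {q}"
  define A where "A = U - T j"
  have fin: "finite U" "finite T'" "finite A" using I q by (auto simp: U_def T'_def A_def)
  have U: "U = insert q (A \<union> T')" "q \<notin> A \<union> T'" "A \<inter> T' = {}" using q by (auto simp: U_def T'_def A_def)
  define D where "D = (\<lambda>r. inflated_geometric (e r) r)"
  define g where "g = (\<lambda>w k. \<Phi> (\<lambda>i\<in>I. if i = j then k else \<Sum>r\<in>T i. \<phi> i (w r)))"
  define h where "h = (\<lambda>k. measure_pmf.expectation (Pi_pmf (A \<union> T') 0 D)
            (\<lambda>z. g (\<lambda>x. if x \<in> A then z x else 0) ((\<Sum>q\<in>T'. \<phi> j (z q)) + k)))"
  have F: "F (z(q := y)) = g (\<lambda>x. if x \<in> A then z x else 0) ((\<Sum>q\<in>T'. \<phi> j (z q)) + \<phi> j y)" for z y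
  proof -
    have "(\<Sum>r\<in>T i. \<phi> i ((z(q := y)) r)) =
        (if i = j then (\<Sum>q\<in>T'. \<phi> j (z q)) + \<phi> j y else \<Sum>r\<in>T i. \<phi> i (if r \<in> A then z r else 0))"
      if i: "i \<in> I" for i
    proof (cases "i = j")
      case True
      have "T j = insert q T'" "q \<notin> T'" using q by (auto simp: T'_def)
      then have "(\<Sum>r\<in>T j. \<phi> j ((z(q := y)) r)) = \<phi> j y + (\<Sum>r\<in>T'. \<phi> j ((z(q := y)) r))"
        using fin by simp
      also have "(\<Sum>r\<in>T'. \<phi> j ((z(q := y)) r)) = (\<Sum>r\<in>T'. \<phi> j (z r))"
        by (intro sum.cong) (auto simp: T'_def)
      finally show ?thesis using True by simp
    next
      case False
      have "T i \<inter> T j = {}" using I(3) i q False by (auto simp: disjoint_family_on_def)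
      then have "r \<in> A \<and> r \<noteq> q" if "r \<in> T i" for r using that i q by (auto simp: A_def U_def)
      then show ?thesis using False by (auto intro!: sum.cong)
    qed
    then show ?thesis unfolding F_def g_def by (auto intro!: arg_cong[of _ _ \<Phi>] restrict_ext)
  qed
  have expand: "measure_pmf.expectation (Pi_pmf U 0 D') F
     = measure_pmf.expectation (D' q) (\<lambda>y. h (\<phi> j y))" if D': "\<And>r. r \<noteq> q \<Longrightarrow> D' r = D r" for D'
  proof -
    have "Pi_pmf (A \<union> T') 0 D' = Pi_pmf (A \<union> T') 0 D"
      using U(2) D' by (intro Pi_pmf_cong refl) metis
    moreover have "\<bar>F z\<bar> \<le> 1" for z unfolding F_def by (rule \<Phi>)
    ultimately show ?thesis
      unfolding U(1) h_def using U(2) fin by (subst expectation_Pi_pmf_insert[where B = 1]) (auto simp: F)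
  qed
  have \<phi>1: "\<phi> j (Suc 0) = 1" using \<phi>(2)[of j "Suc 0"] \<phi>(3)[of j 0] q by linarith
  have g1: "\<bar>g w k\<bar> \<le> 1" for w k unfolding g_def by (rule \<Phi>)
  have "\<bar>h (Suc k) - h k\<bar> \<le> 2 / sqrt (1 + (\<Sum>r\<in>T'. \<beta> r))" for k
    unfolding h_def
  proof (rule shift_expectation_union[OF fin(3,2) U(3) g1])
    show "\<phi> j 0 = 0" using \<phi> q by auto
    fix r assume r: "r \<in> T'"
    then have rj: "r \<in> T j" by (auto simp: T'_def)
    have "pmf (map_pmf (\<phi> j) (D r)) 0 = 1 - e r"
      unfolding D_def using e(1)[of r] \<phi> q by (intro pmf_map_inflated_geometric_0) auto
    moreover have "pmf (map_pmf (\<phi> j) (D r)) 1 \<ge> e r / 2"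
      unfolding D_def using e(1)[of r] \<phi> \<phi>1 q rj by (intro pmf_map_inflated_geometric_1) auto
    ultimately show "0 \<le> \<beta> r \<and> \<beta> r \<le> pmf (map_pmf (\<phi> j) (D r)) 0 \<and> \<beta> r \<le> pmf (map_pmf (\<phi> j) (D r)) 1"
      using \<beta>[OF rj] by linarith
  qed
  moreover have "\<bar>h k\<bar> \<le> 1" for k unfolding h_def by (rule abs_expectation_pmf_le) (rule g1)
  ultimately have "\<bar>measure_pmf.expectation (inflated_geometric e' q) (\<lambda>k. h (\<phi> j k))
        - measure_pmf.expectation (inflated_geometric (e q) q) (\<lambda>k. h (\<phi> j k))\<bar>
      \<le> \<bar>e' - e q\<bar> * (2 * (2 / sqrt (1 + (\<Sum>r\<in>T'. \<beta> r))))"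
    using e q \<phi> by (intro expectation_inflated_geometric_diff) auto
  moreover have "measure_pmf.expectation (Pi_pmf U 0 (\<lambda>r. inflated_geometric ((e(q := e')) r) r)) F
     = measure_pmf.expectation (inflated_geometric e' q) (\<lambda>k. h (\<phi> j k))"
    by (subst expand) (auto simp: D_def)
  moreover have "measure_pmf.expectation (Pi_pmf U 0 (\<lambda>r. inflated_geometric (e r) r)) F
     = measure_pmf.expectation (inflated_geometric (e q) q) (\<lambda>k. h (\<phi> j k))"
    by (subst expand) (auto simp: D_def)
  ultimately show ?thesis by (simp add: T'_def)
qed

text \<open>Only \<open>q\<close> and the members of \<open>Bad\<close> carry no coin, and each of
  them contributes at most 1 to H1. For all others 1/(r - 1) \<le> 4/(2r). Hence 1 + H1 is bounded
  by a multiple of 1 plus the sum of the coin weights.\<close>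

lemma shift_weight_le:
  fixes T :: "nat set"
  assumes T: "finite T" "\<And>r. r \<in> T \<Longrightarrow> r \<ge> 2" and Bad: "finite Bad" and q: "q \<in> T"
  shows "1 / sqrt (1 + (\<Sum>r\<in>T - {q}. if r \<in> Bad then 0 else 1 / (2 * real r)))
     \<le> (8 + 2 * real (card Bad)) / (1 + sqrt (H1 T))"
proof -
  define b where "b = real (card Bad)"
  define \<Sigma> where "\<Sigma> = (\<Sum>r\<in>T - {q}. if r \<in> Bad then 0 else 1 / (2 * real r))"
  have \<Sigma>0: "\<Sigma> \<ge> 0" unfolding \<Sigma>_def by (intro sum_nonneg) auto
  have H0: "H1 T \<ge> 0" unfolding H1_def using T(2) by (intro sum_nonneg) fastforce
  have "H1 T \<le> (\<Sum>r\<in>T. (if r \<in> insert q Bad then 1 else 0) + 4 * (if r = q then 0 else if r \<in> Bad then 0 else 1 / (2 * real r)))"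
    unfolding H1_def
  proof (rule sum_mono)
    fix r assume "r \<in> T"
    then have r: "real r \<ge> 2" using T(2)[of r] by simp
    then have "1 / (real r - 1) \<le> 1" "1 / (real r - 1) \<le> 4 * (1 / (2 * real r))"
      by (auto simp: field_simps)
    then show "1 / (real r - 1) \<le> (if r \<in> insert q Bad then 1 else 0) + 4 * (if r = q then 0 else if r \<in> Bad then 0 else 1 / (2 * real r))"
      by auto
  qed
  also have "\<dots> = (\<Sum>r\<in>T. if r \<in> insert q Bad then 1 else 0) + 4 * (\<Sum>r\<in>T. if r = q then 0 else if r \<in> Bad then 0 else 1 / (2 * real r))"
    by (simp add: sum.distrib sum_distrib_left)
  also have "(\<Sum>r\<in>T. if r \<in> insert q Bad then 1 else 0) = real (card (T \<inter> insert q Bad))"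
    using T by (subst sum.inter_restrict[symmetric]) auto
  also have "(\<Sum>r\<in>T. if r = q then 0 else if r \<in> Bad then 0 else 1 / (2 * real r)) = \<Sigma>"
    using T q unfolding \<Sigma>_def by (subst sum.remove[of T q]) (auto intro!: sum.cong)
  also have "card (T \<inter> insert q Bad) \<le> card (insert q Bad)" using Bad by (intro card_mono) auto
  also have "card (insert q Bad) \<le> Suc (card Bad)" by (rule card_insert_le_m1) auto
  finally have h: "1 + H1 T \<le> 2 + b + 4 * \<Sigma>" by (simp add: b_def)
  have b0: "b \<ge> 0" by (simp add: b_def)
  have "(1 + sqrt (H1 T))\<^sup>2 \<le> 2 * (1 + H1 T)"
  proof -
    have "0 \<le> (1 - sqrt (H1 T))\<^sup>2" by simp
    then show ?thesis using H0 by (simp add: power2_eq_square algebra_simps)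
  qed
  also have "\<dots> \<le> (8 + 2 * b) * (1 + \<Sigma>)"
  proof -
    have eq: "(8 + 2 * b) * (1 + \<Sigma>) = 8 + 2 * b + 8 * \<Sigma> + 2 * (b * \<Sigma>)" by (simp add: algebra_simps)
    define P where "P = b * \<Sigma>"
    have "P \<ge> 0" using b0 \<Sigma>0 by (simp add: P_def)
    then show ?thesis unfolding eq P_def[symmetric] using h b0 \<Sigma>0 by simp
  qed
  also have "\<dots> \<le> (8 + 2 * b)\<^sup>2 * (1 + \<Sigma>)"
    using b0 \<Sigma>0 by (intro mult_right_mono) (auto simp: power2_eq_square)
  also have "\<dots> = ((8 + 2 * b) * sqrt (1 + \<Sigma>))\<^sup>2" using \<Sigma>0 by (simp add: power_mult_distrib)
  finally have "1 + sqrt (H1 T) \<le> (8 + 2 * b) * sqrt (1 + \<Sigma>)"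
    by (rule power2_le_imp_le) (use b0 \<Sigma>0 in simp)
  moreover have "sqrt (1 + \<Sigma>) > 0" "1 + sqrt (H1 T) > 0" using \<Sigma>0 H0 by (auto simp: add_pos_nonneg)
  ultimately show ?thesis unfolding \<Sigma>_def[symmetric] b_def[symmetric] by (simp add: field_simps)
qed

text \<open>A hybrid argument: \<open>hyb A\<close> has the new probabilities on \<open>A\<close>
  and the old ones elsewhere, and \<open>A\<close> grows by one prime at a time. The bounds outside
  \<open>Bad\<close> are required for both \<open>e\<close> and \<open>e'\<close> so that every
  hybrid has coins of weight 1/(2r) at those primes.\<close>

lemma compare_models:
  fixes T :: "nat \<Rightarrow> nat set" and \<Phi> :: "(nat \<Rightarrow> nat) \<Rightarrow> real" and \<phi> :: "nat \<Rightarrow> nat \<Rightarrow> nat"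
  assumes I: "finite I" "\<And>i. i \<in> I \<Longrightarrow> finite (T i)" "disjoint_family_on T I"
    and \<Phi>: "\<And>w. \<bar>\<Phi> w\<bar> \<le> 1"
    and \<phi>: "\<And>i. i \<in> I \<Longrightarrow> \<phi> i 0 = 0" "\<And>i k. i \<in> I \<Longrightarrow> \<phi> i k \<le> k"
      "\<And>i k. i \<in> I \<Longrightarrow> \<phi> i (Suc k) \<noteq> 0"
    and T2: "\<And>i r. i \<in> I \<Longrightarrow> r \<in> T i \<Longrightarrow> r \<ge> 2"
    and e: "\<And>q. 0 \<le> e q \<and> e q \<le> 1" "\<And>q. 0 \<le> e' q \<and> e' q \<le> 1"
    and diff: "\<And>i r. i \<in> I \<Longrightarrow> r \<in> T i \<Longrightarrow> \<bar>e' r - e r\<bar> \<le> c / (real r)\<^sup>2"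
    and Bad: "finite Bad" "\<And>i r. i \<in> I \<Longrightarrow> r \<in> T i \<Longrightarrow> r \<notin> Bad \<Longrightarrow>
        1 / real r \<le> e r \<and> e r \<le> 1 / 2 \<and> 1 / real r \<le> e' r \<and> e' r \<le> 1 / 2"
  defines "F \<equiv> \<lambda>z. \<Phi> (\<lambda>i\<in>I. \<Sum>r\<in>T i. \<phi> i (z r))" and "U \<equiv> \<Union>i\<in>I. T i"
  shows "\<bar>measure_pmf.expectation (Pi_pmf U 0 (\<lambda>r. inflated_geometric (e' r) r)) F
        - measure_pmf.expectation (Pi_pmf U 0 (\<lambda>r. inflated_geometric (e r) r)) F\<bar>
        \<le> 4 * c * (8 + 2 * real (card Bad)) * (\<Sum>j\<in>I. H2 (T j) / (1 + sqrt (H1 (T j))))"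
proof -
  define L where "L = 8 + 2 * real (card Bad)"
  define hyb where "hyb = (\<lambda>A q. if q \<in> A then e' q else e q)"
  define E where "E = (\<lambda>A. measure_pmf.expectation (Pi_pmf U 0 (\<lambda>r. inflated_geometric (hyb A r) r)) F)"
  \<comment> \<open>The cost of one prime is written as a sum over all classes so that exchanging
    the summations collects the costs of each class into H2.\<close>
  define w where "w = (\<lambda>q. \<Sum>j\<in>I. if q \<in> T j then 4 * c * L * (1 / (real q)\<^sup>2 / (1 + sqrt (H1 (T j)))) else 0)"
  have fU: "finite U" using I by (auto simp: U_def)
  have c0: "c \<ge> 0" if qU: "q \<in> U" for q
  proof -
    obtain i where "i \<in> I" "q \<in> T i" using qU by (auto simp: U_def)
    with T2[of i q] diff[of i q] have "0 \<le> c / (real q)\<^sup>2" "real q > 0" by auto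
    then show ?thesis by (simp add: zero_le_divide_iff)
  qed
  have H0: "H1 (T j) \<ge> 0" if "j \<in> I" for j
    unfolding H1_def using T2[OF that] by (intro sum_nonneg) fastforce
  have step: "\<bar>E (insert q A) - E A\<bar> \<le> w q" if qA: "q \<in> U" "q \<notin> A" for q A
  proof -
    obtain j where j: "j \<in> I" "q \<in> T j" using qA by (auto simp: U_def)
    define \<beta> where "\<beta> = (\<lambda>r. if r \<in> Bad then 0 else 1 / (2 * real r))"
    have upd: "hyb (insert q A) = (hyb A)(q := e' q)" by (auto simp: hyb_def fun_eq_iff)
    have "\<bar>E (insert q A) - E A\<bar> \<le> \<bar>e' q - hyb A q\<bar> * (4 / sqrt (1 + (\<Sum>r\<in>T j - {q}. \<beta> r)))"
      unfolding E_def upd F_def U_def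
    proof (rule replace_one_coordinate[OF I \<Phi> \<phi> _ _ _ j T2])
      show "0 \<le> hyb A q \<and> hyb A q \<le> 1" for q using e by (auto simp: hyb_def)
      show "0 \<le> e' q" "e' q \<le> 1" using e by auto
      fix r assume r: "r \<in> T j"
      have "real r \<ge> 2" using T2[OF j(1) r] by simp
      then have "1 / (2 * real r) \<le> 1 / 2" by (simp add: field_simps)
      moreover have "1 / real r \<le> hyb A r \<and> hyb A r \<le> 1 / 2" if "r \<notin> Bad"
        using Bad(2)[OF j(1) r that] by (auto simp: hyb_def)
      moreover have "0 \<le> hyb A r \<and> hyb A r \<le> 1" using e by (auto simp: hyb_def)
      ultimately show "0 \<le> \<beta> r \<and> \<beta> r \<le> 1 - hyb A r \<and> \<beta> r \<le> hyb A r / 2"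
        by (auto simp: \<beta>_def)
    qed
    also have "hyb A q = e q" using qA by (simp add: hyb_def)
    also have "\<bar>e' q - e q\<bar> * (4 / sqrt (1 + (\<Sum>r\<in>T j - {q}. \<beta> r)))
        \<le> (c / (real q)\<^sup>2) * (4 * (L / (1 + sqrt (H1 (T j)))))"
    proof (rule mult_mono)
      show "\<bar>e' q - e q\<bar> \<le> c / (real q)\<^sup>2" by (rule diff[OF j])
      have "1 / sqrt (1 + (\<Sum>r\<in>T j - {q}. \<beta> r)) \<le> L / (1 + sqrt (H1 (T j)))"
        unfolding \<beta>_def L_def using shift_weight_le[of "T j" Bad q] I j T2 Bad by auto
      then show "4 / sqrt (1 + (\<Sum>r\<in>T j - {q}. \<beta> r)) \<le> 4 * (L / (1 + sqrt (H1 (T j))))" by simp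
      show "0 \<le> 4 / sqrt (1 + (\<Sum>r\<in>T j - {q}. \<beta> r))"
        by (intro divide_nonneg_nonneg real_sqrt_ge_zero add_nonneg_nonneg sum_nonneg) (auto simp: \<beta>_def)
    qed (use c0 qA in auto)
    also have "\<dots> = (if q \<in> T j then 4 * c * L * (1 / (real q)\<^sup>2 / (1 + sqrt (H1 (T j)))) else 0)"
      using j by simp
    also have "\<dots> \<le> w q"
      unfolding w_def using j I c0 qA H0
      by (intro member_le_sum) (auto simp: L_def intro!: mult_nonneg_nonneg divide_nonneg_nonneg add_nonneg_nonneg)
    finally show ?thesis .
  qed
  have "\<bar>E A - E {}\<bar> \<le> sum w A" if "finite A" "A \<subseteq> U" for A
    using that
  proof (induction A rule: finite_induct)
    case (insert q A)
    have "\<bar>E (insert q A) - E A\<bar> \<le> w q" using insert by (intro step) auto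
    moreover have "\<bar>E A - E {}\<bar> \<le> sum w A" using insert by auto
    ultimately show ?case using insert.hyps by simp
  qed simp
  from this[OF fU] have "\<bar>E U - E {}\<bar> \<le> sum w U" by simp
  also have "sum w U = (\<Sum>j\<in>I. \<Sum>q\<in>U. if q \<in> T j then 4 * c * L * (1 / (real q)\<^sup>2 / (1 + sqrt (H1 (T j)))) else 0)"
    unfolding w_def by (rule sum.swap)
  also have "\<dots> = (\<Sum>j\<in>I. 4 * c * L * (H2 (T j) / (1 + sqrt (H1 (T j)))))"
  proof (rule sum.cong[OF refl])
    fix j assume j: "j \<in> I"
    then have "U \<inter> T j = T j" by (auto simp: U_def)
    then have "(\<Sum>q\<in>U. if q \<in> T j then 4 * c * L * (1 / (real q)\<^sup>2 / (1 + sqrt (H1 (T j)))) else 0)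
      = (\<Sum>q\<in>T j. 4 * c * L * (1 / (real q)\<^sup>2 / (1 + sqrt (H1 (T j)))))"
      using fU by (subst sum.inter_restrict[symmetric]) auto
    then show "(\<Sum>q\<in>U. if q \<in> T j then 4 * c * L * (1 / (real q)\<^sup>2 / (1 + sqrt (H1 (T j)))) else 0)
      = 4 * c * L * (H2 (T j) / (1 + sqrt (H1 (T j))))"
      by (simp only: H2_def sum_divide_distrib sum_distrib_left)
  qed
  also have "\<dots> = 4 * c * L * (\<Sum>j\<in>I. H2 (T j) / (1 + sqrt (H1 (T j))))" by (simp only: sum_distrib_left)
  also have "E U = measure_pmf.expectation (Pi_pmf U 0 (\<lambda>r. inflated_geometric (e' r) r)) F"
    unfolding E_def hyb_def using fU by (intro arg_cong[of _ _ "\<lambda>M. measure_pmf.expectation M F"] Pi_pmf_cong) auto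
  also have "E {} = measure_pmf.expectation (Pi_pmf U 0 (\<lambda>r. inflated_geometric (e r) r)) F"
    unfolding E_def hyb_def by simp
  finally show ?thesis by (simp add: L_def)
qed

section \<open>Truncated expansion over divisors\<close>

text \<open>The list holds the primes still to be processed, in decreasing order; \<open>k\<close> counts the prime factors
  (with multiplicity) of the divisor \<open>m\<close> chosen so far. Up to \<open>cutoff t p k\<close> further factors \<open>p\<close> respect
  the thresholds. The factors \<open>2\<close> come from the differences in the Moebius inversion.\<close>

definition cutoff :: "(nat \<Rightarrow> real) \<Rightarrow> nat \<Rightarrow> nat \<Rightarrow> nat" where
  "cutoff t p k = (LEAST i. t (k + Suc i) < real p)"

text \<open>A divisor d in the tree is counted with weight c^\<omega>(d). The last summand is the
  stopped child, whose final factor exceeds its threshold and which is not expanded further.\<close>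

fun tree_sum :: "(nat \<Rightarrow> real) \<Rightarrow> real \<Rightarrow> nat list \<Rightarrow> nat \<Rightarrow> nat \<Rightarrow> (nat \<Rightarrow> real) \<Rightarrow> real" where
  "tree_sum t c [] k m \<rho> = \<rho> m"
| "tree_sum t c (p # ps) k m \<rho> =
     (\<Sum>i\<le>cutoff t p k. (if i = 0 then 1 else c) * tree_sum t c ps (k + i) (m * p ^ i) \<rho>)
     + c * \<rho> (m * p ^ Suc (cutoff t p k))"

text \<open>The same tree as for \<open>tree_sum\<close> with c = 2, restricted to its stopped
  nodes.\<close>

fun boundary_sum :: "(nat \<Rightarrow> real) \<Rightarrow> nat list \<Rightarrow> nat \<Rightarrow> nat \<Rightarrow> (nat \<Rightarrow> real) \<Rightarrow> real" where
  "boundary_sum t [] k m \<rho> = 0"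
| "boundary_sum t (p # ps) k m \<rho> =
     (\<Sum>i\<le>cutoff t p k. (if i = 0 then 1 else 2) * boundary_sum t ps (k + i) (m * p ^ i) \<rho>)
     + 2 * \<rho> (m * p ^ Suc (cutoff t p k))"

text \<open>Moebius inversion one prime at a time: the coefficient of d is an iterated difference of
  \<open>F\<close> in the exponents of the primes dividing d. At a leaf every listed coordinate has
  been fixed, and the others are 0 as in \<open>exponents\<close>.\<close>

fun tree_expansion ::
  "(nat \<Rightarrow> real) \<Rightarrow> nat list \<Rightarrow> nat \<Rightarrow> nat \<Rightarrow> ((nat \<Rightarrow> nat) \<Rightarrow> real) \<Rightarrow> (nat \<Rightarrow> real) \<Rightarrow> real" where
  "tree_expansion t [] k m F \<rho> = F (\<lambda>_. 0) * \<rho> m"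
| "tree_expansion t (p # ps) k m F \<rho> =
     (\<Sum>i\<le>cutoff t p k. tree_expansion t ps (k + i) (m * p ^ i)
        (\<lambda>v. F (v(p := i)) - (if i = 0 then 0 else F (v(p := i - 1)))) \<rho>)"

definition exponents :: "nat set \<Rightarrow> nat \<Rightarrow> nat \<Rightarrow> nat" where
  "exponents S n = (\<lambda>q. if q \<in> S then multiplicity q n else 0)"

definition dvd_prob :: "nat pmf \<Rightarrow> nat \<Rightarrow> real" where
  "dvd_prob P d = measure_pmf.prob P {n. d dvd n}"

section \<open>Error of the truncated Moebius inversion\<close>

lemma dvd_prob_nonneg: "dvd_prob P d \<ge> 0"
  by (simp add: dvd_prob_def)

lemma sum_telescope_diff:
  fixes G :: "nat \<Rightarrow> real"
  shows "(\<Sum>i\<le>j. G i - (if i = 0 then 0 else G (i - 1))) = G j"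
  by (induction j) auto

lemma expectation_dvd: "measure_pmf.expectation P (\<lambda>n. of_bool (d dvd n)) = dvd_prob P d"
proof -
  have "(\<lambda>n. of_bool (d dvd n) :: real) = indicator {n. d dvd n}" by (auto simp: fun_eq_iff)
  then show ?thesis by (simp only: dvd_prob_def) simp
qed

lemma mult_prime_power_dvd_iff:
  fixes n m p :: nat
  assumes "n > 0" "prime p" "coprime m p"
  shows "m * p ^ i dvd n \<longleftrightarrow> m dvd n \<and> i \<le> multiplicity p n"
proof -
  have "coprime m (p ^ i)" using assms by simp
  then have "m * p ^ i dvd n \<longleftrightarrow> m dvd n \<and> p ^ i dvd n"
    using divides_mult[of m n "p ^ i"] by (auto intro: dvd_mult_left dvd_mult_right)
  also have "p ^ i dvd n \<longleftrightarrow> i \<le> multiplicity p n"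
    using assms by (intro power_dvd_iff_le_multiplicity) auto
  finally show ?thesis .
qed

text \<open>At one prime the differences up to the cutoff J telescope to \<open>F\<close> with
  exponent min(J, e), where e is the true exponent. The result is exact unless m p^(J+1) divides n,
  and then it is off by at most 2B; this is the stopped node. Every difference taken also doubles
  the bound passed on to the remaining primes.\<close>

lemma tree_expansion_error:
  fixes F :: "(nat \<Rightarrow> nat) \<Rightarrow> real"
  assumes "0 \<notin> set_pmf P" "distinct ps" "\<And>p. p \<in> set ps \<Longrightarrow> prime p"
    "\<And>p. p \<in> set ps \<Longrightarrow> coprime m p" "\<And>v. \<bar>F v\<bar> \<le> B"
  shows "\<bar>measure_pmf.expectation P (\<lambda>n. F (exponents (set ps) n) * of_bool (m dvd n))
            - tree_expansion t ps k m F (dvd_prob P)\<bar> \<le> B * boundary_sum t ps k m (dvd_prob P)"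
  using assms(2-)
proof (induction ps arbitrary: k m F B)
  case Nil
  show ?case by (simp add: exponents_def expectation_dvd)
next
  case (Cons p ps)
  define J where "J = cutoff t p k"
  define \<Delta> where "\<Delta> = (\<lambda>i v. F (v(p := i)) - (if i = 0 then 0 else F (v(p := i - 1))))"
  define R where "R = (\<lambda>n. (F ((exponents (set ps) n)(p := multiplicity p n)) - F ((exponents (set ps) n)(p := J)))
      * of_bool (m * p ^ Suc J dvd n))"
  have p: "prime p" "coprime m p" "p \<notin> set ps" using Cons.prems by auto
  have B0: "B \<ge> 0" using Cons.prems(4)[of undefined] by linarith
  have ex: "exponents (set (p # ps)) n = (exponents (set ps) n)(p := multiplicity p n)" for n
    using p by (auto simp: exponents_def fun_eq_iff)
  have \<Delta>b: "\<bar>\<Delta> i v\<bar> \<le> (if i = 0 then 1 else 2) * B" for i v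
  proof -
    have "\<bar>F (v(p := i))\<bar> \<le> B" "\<bar>F (v(p := i - 1))\<bar> \<le> B" using Cons.prems(4) by blast+
    then show ?thesis unfolding \<Delta>_def by auto
  qed
  have pw: "F (exponents (set (p # ps)) n) * of_bool (m dvd n)
      = (\<Sum>i\<le>J. \<Delta> i (exponents (set ps) n) * of_bool (m * p ^ i dvd n)) + R n" if "n > 0" for n
  proof (cases "m dvd n")
    case False
    then have "\<not> m * p ^ i dvd n" for i by (auto dest: dvd_mult_left)
    then show ?thesis using False by (simp add: R_def del: power_Suc)
  next
    case True
    define e where "e = multiplicity p n"
    define v where "v = exponents (set ps) n"
    have dv: "m * p ^ i dvd n \<longleftrightarrow> i \<le> e" for i
      using mult_prime_power_dvd_iff[OF that p(1,2)] True by (simp add: e_def)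
    have "(\<Sum>i\<le>J. \<Delta> i v * of_bool (m * p ^ i dvd n)) = (\<Sum>i\<in>{..J}. if i \<le> e then \<Delta> i v else 0)"
      unfolding dv by (intro sum.cong) auto
    also have "\<dots> = sum (\<lambda>i. \<Delta> i v) ({..J} \<inter> {i. i \<le> e})"
      by (subst sum.inter_restrict) auto
    also have "{..J} \<inter> {i. i \<le> e} = {..min J e}" by auto
    also have "sum (\<lambda>i. \<Delta> i v) {..min J e} = F (v(p := min J e))"
      unfolding \<Delta>_def by (rule sum_telescope_diff)
    finally show ?thesis unfolding ex R_def v_def[symmetric] dv e_def[symmetric] using True
      by (cases "e \<le> J") (auto simp: min_def)
  qed
  have Rb: "\<bar>R n\<bar> \<le> 2 * B * of_bool (m * p ^ Suc J dvd n)" for n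
  proof -
    have "\<bar>F ((exponents (set ps) n)(p := multiplicity p n))\<bar> \<le> B" "\<bar>F ((exponents (set ps) n)(p := J))\<bar> \<le> B"
      using Cons.prems(4) by blast+
    then show ?thesis unfolding R_def by (auto simp: abs_mult)
  qed
  have R2: "\<bar>R n\<bar> \<le> 2 * B" for n using Rb[of n] B0 by (cases "m * p ^ Suc J dvd n") (simp_all del: power_Suc)
  have intR: "integrable (measure_pmf P) R" by (rule integrable_pmf_bounded) (rule R2)
  have int\<Delta>: "integrable (measure_pmf P) (\<lambda>n. \<Delta> i (exponents (set ps) n) * of_bool (m * p ^ i dvd n))" for i
  proof (rule integrable_pmf_bounded[where B = "2 * B"])
    fix n
    have "\<bar>\<Delta> i (exponents (set ps) n) * of_bool (m * p ^ i dvd n)\<bar> \<le> \<bar>\<Delta> i (exponents (set ps) n)\<bar>" by simp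
    also have "\<dots> \<le> 2 * B" using \<Delta>b[of i "exponents (set ps) n"] B0 by (auto split: if_splits)
    finally show "\<bar>\<Delta> i (exponents (set ps) n) * of_bool (m * p ^ i dvd n)\<bar> \<le> 2 * B" .
  qed
  have ER: "\<bar>measure_pmf.expectation P R\<bar> \<le> 2 * B * dvd_prob P (m * p ^ Suc J)"
  proof -
    have "\<bar>measure_pmf.expectation P R\<bar> \<le> measure_pmf.expectation P (\<lambda>n. \<bar>R n\<bar>)" by (rule integral_abs_bound)
    also have "\<dots> \<le> measure_pmf.expectation P (\<lambda>n. 2 * B * of_bool (m * p ^ Suc J dvd n))"
      using intR Rb B0 by (intro integral_mono integrable_abs[OF intR] integrable_pmf_bounded[where B = "2 * B"]) auto
    also have "\<dots> = 2 * B * dvd_prob P (m * p ^ Suc J)" by (simp add: expectation_dvd del: power_Suc)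
    finally show ?thesis .
  qed
  define X where "X = (\<lambda>i. measure_pmf.expectation P (\<lambda>n. \<Delta> i (exponents (set ps) n) * of_bool (m * p ^ i dvd n)))"
  have "measure_pmf.expectation P (\<lambda>n. F (exponents (set (p # ps)) n) * of_bool (m dvd n))
     = measure_pmf.expectation P (\<lambda>n. (\<Sum>i\<le>J. \<Delta> i (exponents (set ps) n) * of_bool (m * p ^ i dvd n)) + R n)"
  proof (rule integral_cong_AE)
    show "AE n in measure_pmf P. F (exponents (set (p # ps)) n) * of_bool (m dvd n)
       = (\<Sum>i\<le>J. \<Delta> i (exponents (set ps) n) * of_bool (m * p ^ i dvd n)) + R n"
      unfolding AE_measure_pmf_iff using assms(1) pw by (metis gr0I)
  qed auto
  also have "\<dots> = (\<Sum>i\<le>J. X i) + measure_pmf.expectation P R"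
    unfolding X_def Bochner_Integration.integral_sum[OF int\<Delta>, symmetric]
    by (rule Bochner_Integration.integral_add[OF Bochner_Integration.integrable_sum[OF int\<Delta>] intR])
  finally have E: "measure_pmf.expectation P (\<lambda>n. F (exponents (set (p # ps)) n) * of_bool (m dvd n))
     = (\<Sum>i\<le>J. X i) + measure_pmf.expectation P R" .
  have IH: "\<bar>X i - tree_expansion t ps (k + i) (m * p ^ i) (\<Delta> i) (dvd_prob P)\<bar>
     \<le> (if i = 0 then 1 else 2) * B * boundary_sum t ps (k + i) (m * p ^ i) (dvd_prob P)" for i
    unfolding X_def
  proof (rule Cons.IH)
    fix q assume q: "q \<in> set ps"
    then have "coprime p q" using Cons.prems(1,2) by (intro primes_coprime) auto
    then show "coprime (m * p ^ i) q" using Cons.prems(3)[of q] q by auto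
  qed (use Cons.prems \<Delta>b in auto)
  have "\<bar>(\<Sum>i\<le>J. X i) - tree_expansion t (p # ps) k m F (dvd_prob P)\<bar>
     = \<bar>\<Sum>i\<le>J. X i - tree_expansion t ps (k + i) (m * p ^ i) (\<Delta> i) (dvd_prob P)\<bar>"
    by (simp add: sum_subtractf \<Delta>_def J_def)
  also have "\<dots> \<le> (\<Sum>i\<le>J. (if i = 0 then 1 else 2) * B * boundary_sum t ps (k + i) (m * p ^ i) (dvd_prob P))"
    by (rule order_trans[OF sum_abs]) (intro sum_mono IH)
  finally have S: "\<bar>(\<Sum>i\<le>J. X i) - tree_expansion t (p # ps) k m F (dvd_prob P)\<bar>
     \<le> (\<Sum>i\<le>J. (if i = 0 then 1 else 2) * B * boundary_sum t ps (k + i) (m * p ^ i) (dvd_prob P))" .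
  have "B * boundary_sum t (p # ps) k m (dvd_prob P) =
     (\<Sum>i\<le>J. (if i = 0 then 1 else 2) * B * boundary_sum t ps (k + i) (m * p ^ i) (dvd_prob P))
      + 2 * B * dvd_prob P (m * p ^ Suc J)"
    by (simp add: J_def distrib_left sum_distrib_left mult_ac)
  then show ?case unfolding E using S ER by linarith
qed

lemma tree_expansion_diff:
  fixes F :: "(nat \<Rightarrow> nat) \<Rightarrow> real"
  assumes "\<And>v. \<bar>F v\<bar> \<le> B"
  shows "\<bar>tree_expansion t ps k m F \<rho> - tree_expansion t ps k m F \<rho>'\<bar> \<le> B * tree_sum t 2 ps k m (\<lambda>d. \<bar>\<rho> d - \<rho>' d\<bar>)"
  using assms
proof (induction ps arbitrary: k m F B)
  case Nil
  have "F (\<lambda>_. 0) * \<rho> m - F (\<lambda>_. 0) * \<rho>' m = F (\<lambda>_. 0) * (\<rho> m - \<rho>' m)" by (simp add: algebra_simps)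
  then show ?case using Nil[of "\<lambda>_. 0"] by (simp add: abs_mult mult_right_mono)
next
  case (Cons p ps)
  define \<Delta> where "\<Delta> = (\<lambda>i v. F (v(p := i)) - (if i = 0 then 0 else F (v(p := i - 1))))"
  have B0: "B \<ge> 0" using Cons.prems[of undefined] by linarith
  have \<Delta>b: "\<bar>\<Delta> i v\<bar> \<le> (if i = 0 then 1 else 2) * B" for i v
  proof -
    have "\<bar>F (v(p := i))\<bar> \<le> B" "\<bar>F (v(p := i - 1))\<bar> \<le> B" using Cons.prems by blast+
    then show ?thesis unfolding \<Delta>_def by auto
  qed
  let ?r = "\<lambda>d. \<bar>\<rho> d - \<rho>' d\<bar>"
  have "\<bar>tree_expansion t (p # ps) k m F \<rho> - tree_expansion t (p # ps) k m F \<rho>'\<bar>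
     \<le> (\<Sum>i\<le>cutoff t p k. \<bar>tree_expansion t ps (k + i) (m * p ^ i) (\<Delta> i) \<rho> - tree_expansion t ps (k + i) (m * p ^ i) (\<Delta> i) \<rho>'\<bar>)"
    by (simp add: \<Delta>_def sum_subtractf[symmetric])
  also have "\<dots> \<le> (\<Sum>i\<le>cutoff t p k. (if i = 0 then 1 else 2) * B * tree_sum t 2 ps (k + i) (m * p ^ i) ?r)"
    by (intro sum_mono Cons.IH) (rule \<Delta>b)
  \<comment> \<open>Adding the stopped node, which the expansion does not contain, lets one
    \<open>tree_sum\<close> control both the expansion and the boundary.\<close>
  also have "\<dots> \<le> (\<Sum>i\<le>cutoff t p k. (if i = 0 then 1 else 2) * B * tree_sum t 2 ps (k + i) (m * p ^ i) ?r)
     + B * (2 * ?r (m * p ^ Suc (cutoff t p k)))"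
    using B0 by simp
  also have "\<dots> = B * tree_sum t 2 (p # ps) k m ?r"
    by (simp add: distrib_left sum_distrib_left mult_ac)
  finally show ?case .
qed

lemma boundary_sum_le_add:
  assumes "\<And>d. \<rho> d \<le> \<rho>1 d + \<rho>2 d"
  shows "boundary_sum t ps k m \<rho> \<le> boundary_sum t ps k m \<rho>1 + boundary_sum t ps k m \<rho>2"
proof (induction ps arbitrary: k m)
  case (Cons p ps)
  have "(\<Sum>i\<le>cutoff t p k. (if i = 0 then 1 else 2) * boundary_sum t ps (k + i) (m * p ^ i) \<rho>)
     \<le> (\<Sum>i\<le>cutoff t p k. (if i = 0 then 1 else 2) * (boundary_sum t ps (k + i) (m * p ^ i) \<rho>1 + boundary_sum t ps (k + i) (m * p ^ i) \<rho>2))"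
    by (intro sum_mono mult_left_mono Cons.IH) auto
  then show ?case using assms[of "m * p ^ Suc (cutoff t p k)"]
    by (simp add: distrib_left sum.distrib)
qed simp

lemma boundary_sum_le_tree_sum:
  assumes "\<And>d. \<rho> d \<ge> 0"
  shows "boundary_sum t ps k m \<rho> \<le> tree_sum t 2 ps k m \<rho>"
  by (induction ps arbitrary: k m) (auto simp: assms intro!: sum_mono mult_left_mono)

lemma tree_sum_le_add:
  assumes "\<And>d. \<rho> d \<le> a * \<rho>1 d + \<rho>2 d" "c \<ge> 0"
  shows "tree_sum t c ps k m \<rho> \<le> a * tree_sum t c ps k m \<rho>1 + tree_sum t c ps k m \<rho>2"
proof (induction ps arbitrary: k m)
  case (Cons p ps)
  have "(\<Sum>i\<le>cutoff t p k. (if i = 0 then 1 else c) * tree_sum t c ps (k + i) (m * p ^ i) \<rho>)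
     \<le> (\<Sum>i\<le>cutoff t p k. (if i = 0 then 1 else c) * (a * tree_sum t c ps (k + i) (m * p ^ i) \<rho>1 + tree_sum t c ps (k + i) (m * p ^ i) \<rho>2))"
    using assms(2) by (intro sum_mono mult_left_mono Cons.IH) auto
  moreover have "c * \<rho> (m * p ^ Suc (cutoff t p k)) \<le> c * (a * \<rho>1 (m * p ^ Suc (cutoff t p k)) + \<rho>2 (m * p ^ Suc (cutoff t p k)))"
    using assms by (intro mult_left_mono) auto
  ultimately show ?case
    by (simp add: distrib_left sum.distrib sum_distrib_left mult_ac del: power_Suc)
qed (use assms in auto)

text \<open>Replaces Cauchy--Schwarz for removing the weight \<open>2\<^bsup>\<omega>(d)\<^esup>\<close> from the remainder sum.\<close>

lemma tree_sum_AM_GM: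
  assumes "\<And>d. \<rho> d \<ge> 0" "\<tau> > 0"
  shows "tree_sum t 2 ps k m \<rho> \<le> \<tau> / 2 * tree_sum t 1 ps k m \<rho> + 1 / (2 * \<tau>) * tree_sum t 4 ps k m \<rho>"
  using assms(2)
proof (induction ps arbitrary: k m \<tau>)
  case Nil
  have "0 \<le> (\<tau> - 1)\<^sup>2" by simp
  then have "1 \<le> \<tau> / 2 + 1 / (2 * \<tau>)" using Nil by (simp add: power2_eq_square field_simps)
  then have "1 * \<rho> m \<le> (\<tau> / 2 + 1 / (2 * \<tau>)) * \<rho> m" using assms(1) by (rule mult_right_mono)
  then show ?case by (simp add: distrib_right)
next
  case (Cons p ps)
  define J where "J = cutoff t p k"
  have "0 \<le> (\<tau> - 2)\<^sup>2" by simp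
  then have "2 \<le> \<tau> / 2 + 2 / \<tau>" using Cons.prems by (simp add: power2_eq_square field_simps)
  then have "2 * \<rho> (m * p ^ Suc J) \<le> (\<tau> / 2 + 2 / \<tau>) * \<rho> (m * p ^ Suc J)" using assms(1) by (rule mult_right_mono)
  then have b: "2 * \<rho> (m * p ^ Suc J) \<le> \<tau> / 2 * (1 * \<rho> (m * p ^ Suc J)) + 1 / (2 * \<tau>) * (4 * \<rho> (m * p ^ Suc J))"
    by (simp add: distrib_right del: power_Suc)
  have "(\<Sum>i\<le>J. (if i = 0 then 1 else 2) * tree_sum t 2 ps (k + i) (m * p ^ i) \<rho>)
    \<le> (\<Sum>i\<le>J. \<tau> / 2 * ((if i = 0 then 1 else 1) * tree_sum t 1 ps (k + i) (m * p ^ i) \<rho>)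
         + 1 / (2 * \<tau>) * ((if i = 0 then 1 else 4) * tree_sum t 4 ps (k + i) (m * p ^ i) \<rho>))"
  proof (rule sum_mono)
    \<comment> \<open>Below a chosen prime the parameter is halved: 2 ((\<tau>/4) S1 + S4/\<tau>) =
      (\<tau>/2) S1 + (4/(2\<tau>)) S4, where S1 and S4 are the sums with c = 1 and c = 4.\<close>
    fix i
    show "(if i = 0 then 1 else 2) * tree_sum t 2 ps (k + i) (m * p ^ i) \<rho>
      \<le> \<tau> / 2 * ((if i = 0 then 1 else 1) * tree_sum t 1 ps (k + i) (m * p ^ i) \<rho>)
         + 1 / (2 * \<tau>) * ((if i = 0 then 1 else 4) * tree_sum t 4 ps (k + i) (m * p ^ i) \<rho>)"
      using Cons.IH[OF Cons.prems, of "k + i" "m * p ^ i"] Cons.IH[of "\<tau> / 2" "k + i" "m * p ^ i"] Cons.prems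
      by auto
  qed
  also have "\<dots> = \<tau> / 2 * (\<Sum>i\<le>J. (if i = 0 then 1 else 1) * tree_sum t 1 ps (k + i) (m * p ^ i) \<rho>)
       + 1 / (2 * \<tau>) * (\<Sum>i\<le>J. (if i = 0 then 1 else 4) * tree_sum t 4 ps (k + i) (m * p ^ i) \<rho>)"
    by (simp only: sum.distrib sum_distrib_left)
  finally show ?case using b unfolding tree_sum.simps J_def[symmetric] distrib_left by linarith
qed

section \<open>Size of the divisors in the tree, and Rankin bounds\<close>

lemma cutoff_props:
  assumes "t N < 2" "k < N" "p \<ge> 2"
  shows "t (k + Suc (cutoff t p k)) < real p" "k + cutoff t p k < N"
    "\<And>i. 1 \<le> i \<Longrightarrow> i \<le> cutoff t p k \<Longrightarrow> real p \<le> t (k + i)"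
proof -
  have ex: "t (k + Suc (N - k - 1)) < real p" using assms by simp
  show "t (k + Suc (cutoff t p k)) < real p" unfolding cutoff_def by (rule LeastI[of _ "N - k - 1"]) (rule ex)
  have "cutoff t p k \<le> N - k - 1" unfolding cutoff_def by (rule Least_le) (rule ex)
  then show "k + cutoff t p k < N" using assms by linarith
  fix i assume i: "1 \<le> i" "i \<le> cutoff t p k"
  then have "\<not> t (k + Suc (i - 1)) < real p" unfolding cutoff_def by (intro not_less_Least) simp
  then show "real p \<le> t (k + i)" using i by simp
qed

definition smooth_upto :: "nat set \<Rightarrow> real \<Rightarrow> nat set" where
  "smooth_upto S X = {d. d \<ge> 1 \<and> real d \<le> X \<and> prime_factors d \<subseteq> S}"

lemma finite_smooth_upto: "finite (smooth_upto S X)"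
  by (rule finite_subset[of _ "{..nat \<lfloor>X\<rfloor>}"]) (auto simp: smooth_upto_def le_nat_floor)

text \<open>By unique factorisation no divisor occurs twice in the tree, so only its size matters.
  The function \<open>X\<close> is a budget: X k bounds what may still be multiplied on after
  \<open>k\<close> factors, and a factor allowed at position k + 1 lowers it from X k to X (k +
  1).\<close>

lemma tree_sum_1_le:
  assumes t: "t N < 2" and ps: "distinct ps" "\<And>p. p \<in> set ps \<Longrightarrow> prime p"
    and X: "\<And>k p. p \<in> set ps \<Longrightarrow> real p \<le> t (Suc k) \<Longrightarrow> real p * X (Suc k) \<le> X k"
      "\<And>k p. p \<in> set ps \<Longrightarrow> real p \<le> X k" "\<And>k. 1 \<le> X k"
    and \<rho>: "\<And>d. \<rho> d \<ge> 0" and "k < N"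
  shows "tree_sum t 1 ps k m \<rho> \<le> (\<Sum>d\<in>smooth_upto (set ps) (X k). \<rho> (m * d))"
  using ps X(1,2) \<open>k < N\<close>
proof (induction ps arbitrary: k m)
  case Nil
  have "smooth_upto {} (X k) = {1}"
    using X(3)[of k] by (auto simp: smooth_upto_def prime_factorization_empty_iff)
  then show ?case by simp
next
  case (Cons p ps)
  define J where "J = cutoff t p k"
  have p: "prime p" "p \<ge> 2" "p \<notin> set ps" using Cons.prems prime_ge_2_nat by auto
  have J: "k + J < N" "\<And>i. 1 \<le> i \<Longrightarrow> i \<le> J \<Longrightarrow> real p \<le> t (k + i)"
    using cutoff_props[where t = t, OF t Cons.prems(5) p(2)] by (auto simp: J_def)
  have pX: "real p ^ i * X (k + i) \<le> X k" if "i \<le> J" for i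
    using that
  proof (induction i)
    case (Suc i)
    have "real p * X (Suc (k + i)) \<le> X (k + i)"
      using Cons.prems(3)[of p "k + i"] J(2)[of "Suc i"] Suc.prems by simp
    then have "real p ^ i * (real p * X (Suc (k + i))) \<le> real p ^ i * X (k + i)" by (intro mult_left_mono) auto
    then show ?case using Suc by (simp add: mult_ac)
  qed simp
  define A where "A = (SIGMA i:{..J}. smooth_upto (set ps) (X (k + i)))"
  define \<psi> where "\<psi> = (\<lambda>(i, d). p ^ i * d)"
  have fA: "finite A" unfolding A_def by (intro finite_SigmaI finite_smooth_upto) auto
  have nd: "\<not> p dvd d" if "d \<in> smooth_upto (set ps) Y" for d Y
    using that p by (auto simp: smooth_upto_def prime_factors_dvd)
  have mul: "multiplicity p (p ^ i * d) = i" if "\<not> p dvd d" for i d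
  proof -
    have "d \<noteq> 0" using that by (intro notI) simp
    then have "multiplicity p (p ^ i * d) = multiplicity p (p ^ i) + multiplicity p d"
      using p by (intro prime_elem_multiplicity_mult_distrib) auto
    then show ?thesis using that p by (simp add: not_dvd_imp_multiplicity_0)
  qed
  have ndA: "\<not> p dvd snd z" if "z \<in> insert (Suc J, 1) A" for z
    using that nd p by (auto simp: A_def)
  have inj: "inj_on \<psi> (insert (Suc J, 1) A)"
  proof (rule inj_onI)
    fix z z' assume z: "z \<in> insert (Suc J, 1) A" "z' \<in> insert (Suc J, 1) A" "\<psi> z = \<psi> z'"
    have "fst z = fst z'" using mul[OF ndA[OF z(1)], of "fst z"] mul[OF ndA[OF z(2)], of "fst z'"] z(3)
      by (simp add: \<psi>_def case_prod_unfold)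
    moreover from this have "snd z = snd z'" using z(3) p by (simp add: \<psi>_def case_prod_unfold)
    ultimately show "z = z'" by (simp add: prod_eq_iff)
  qed
  have img: "\<psi> ` (insert (Suc J, 1) A) \<subseteq> smooth_upto (set (p # ps)) (X k)"
  proof -
    have "\<psi> (i, d) \<in> smooth_upto (set (p # ps)) (X k)" if "(i, d) \<in> A" for i d
    proof -
      have i: "i \<le> J" and d: "d \<ge> 1" "real d \<le> X (k + i)" "prime_factors d \<subseteq> set ps"
        using that by (auto simp: A_def smooth_upto_def)
      have "real p ^ i * real d \<le> real p ^ i * X (k + i)" using d by (intro mult_left_mono) auto
      then have "real (p ^ i * d) \<le> X k" using pX[OF i] by simp
      moreover have "prime_factors (p ^ i * d) \<subseteq> insert p (set ps)"
      proof
        fix x assume "x \<in> prime_factors (p ^ i * d)"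
        then have "prime x" "x dvd p ^ i * d"
          by (auto dest: in_prime_factors_imp_prime in_prime_factors_imp_dvd)
        then have x: "prime x" "x dvd p ^ i \<or> x dvd d" using prime_dvd_multD by blast+
        show "x \<in> insert p (set ps)"
        proof (cases "x dvd d")
          case True
          then have "x \<in> prime_factors d" using x d by (auto simp: in_prime_factors_iff)
          then show ?thesis using d by auto
        next
          case False
          then have "x dvd p" using x prime_dvd_power by blast
          then show ?thesis using primes_dvd_imp_eq[OF x(1) p(1)] by simp
        qed
      qed
      ultimately show ?thesis using d p by (auto simp: \<psi>_def smooth_upto_def)
    qed
    \<comment> \<open>The last factor of a stopped node violates its threshold; the budget always
      leaves room for one such prime.\<close>
    moreover have "\<psi> (Suc J, 1) \<in> smooth_upto (set (p # ps)) (X k)"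
    proof -
      have "real p \<le> X (k + J)" using Cons.prems(4)[of p] by simp
      then have "real p ^ J * real p \<le> real p ^ J * X (k + J)" by (intro mult_left_mono) auto
      then have "real (p ^ Suc J) \<le> X k" using pX[of J] by (simp add: mult.commute)
      moreover have "prime_factors (p ^ Suc J) \<subseteq> insert p (set ps)"
      proof
        fix x assume "x \<in> prime_factors (p ^ Suc J)"
        then have x: "prime x" "x dvd p ^ Suc J"
          using in_prime_factors_imp_prime in_prime_factors_imp_dvd by blast+
        then have "x dvd p" using prime_dvd_power by blast
        then show "x \<in> insert p (set ps)" using primes_dvd_imp_eq[OF x(1) p(1)] by simp
      qed
      ultimately show ?thesis using p by (auto simp: \<psi>_def smooth_upto_def simp del: power_Suc)
    qed
    ultimately show ?thesis by auto
  qed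
  have "tree_sum t 1 (p # ps) k m \<rho> = (\<Sum>i\<le>J. tree_sum t 1 ps (k + i) (m * p ^ i) \<rho>) + \<rho> (m * p ^ Suc J)"
    by (simp add: J_def)
  also have "\<dots> \<le> (\<Sum>i\<le>J. \<Sum>d\<in>smooth_upto (set ps) (X (k + i)). \<rho> (m * p ^ i * d)) + \<rho> (m * p ^ Suc J)"
    using Cons.prems J(1) by (intro add_right_mono sum_mono Cons.IH) auto
  also have "(\<Sum>i\<le>J. \<Sum>d\<in>smooth_upto (set ps) (X (k + i)). \<rho> (m * p ^ i * d)) = (\<Sum>z\<in>A. \<rho> (m * \<psi> z))"
    unfolding A_def by (subst sum.Sigma) (auto simp: finite_smooth_upto \<psi>_def case_prod_unfold mult.assoc)
  also have "\<dots> + \<rho> (m * p ^ Suc J) = (\<Sum>z\<in>insert (Suc J, 1) A. \<rho> (m * \<psi> z))"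
    using fA by (subst sum.insert) (auto simp: A_def \<psi>_def)
  also have "\<dots> = (\<Sum>d\<in>\<psi> ` (insert (Suc J, 1) A). \<rho> (m * d))"
    using inj by (subst sum.reindex) auto
  also have "\<dots> \<le> (\<Sum>d\<in>smooth_upto (set (p # ps)) (X k). \<rho> (m * d))"
    using img \<rho> by (intro sum_mono2 finite_smooth_upto) auto
  finally show ?case .
qed

text \<open>The constant 2 covers both 1/d and 1/\<phi>(d), as q - 1 \<ge> q/2. An upper bound is
  enough for the product estimates below.\<close>

definition quasi_multiplicative :: "(nat \<Rightarrow> real) \<Rightarrow> bool" where
  "quasi_multiplicative g \<longleftrightarrow> (\<forall>m. g m \<ge> 0) \<and>
     (\<forall>m p i. prime p \<longrightarrow> coprime m p \<longrightarrow> i \<ge> 1 \<longrightarrow> g (m * p ^ i) \<le> g m * (2 / real p ^ i))"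

lemma sum_power_le_geometric:
  fixes r :: real
  assumes "0 \<le> r" "r \<le> 3 / 4"
  shows "(\<Sum>i=1..n. r ^ i) \<le> 4 * r"
proof -
  have "(1 - r) * (\<Sum>i=1..n. r ^ i) = r - r ^ Suc n"
  proof (induction n)
    case (Suc n)
    have "(1 - r) * (\<Sum>i=1..Suc n. r ^ i) = (1 - r) * (\<Sum>i=1..n. r ^ i) + (1 - r) * r ^ Suc n"
      by (simp add: distrib_left)
    then show ?case using Suc.IH by (simp add: left_diff_distrib)
  qed simp
  also have "\<dots> \<le> r" using assms by simp
  finally have a: "(1 - r) * (\<Sum>i=1..n. r ^ i) \<le> r" .
  have "(1 / 4) * (\<Sum>i=1..n. r ^ i) \<le> (1 - r) * (\<Sum>i=1..n. r ^ i)"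
    using assms by (intro mult_right_mono sum_nonneg) auto
  then show ?thesis using a by simp
qed

lemma coprime_mult_prime_power:
  assumes "prime (p::nat)" "prime q" "p \<noteq> q" "coprime m q"
  shows "coprime (m * p ^ i) q"
  using assms primes_coprime[of p q] by auto

lemma sum_atMost_split_0:
  fixes f :: "nat \<Rightarrow> real"
  shows "(\<Sum>i\<le>J. f i) = f 0 + (\<Sum>i=1..J. f i)"
  by (induction J) auto

text \<open>Up to the cutoff and including the stopped child, the exponents of one prime form a
  geometric series. With the 2 of \<open>quasi_multiplicative\<close> and the 4 of
  \<open>sum_power_le_geometric\<close> the Euler factor is at most 1 + 8c/p.\<close>

lemma tree_sum_le_prod:
  assumes g: "quasi_multiplicative g" and "c \<ge> 0"
    and "distinct ps" "\<And>p. p \<in> set ps \<Longrightarrow> prime p" "\<And>p. p \<in> set ps \<Longrightarrow> coprime m p"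
  shows "tree_sum t c ps k m g \<le> g m * (\<Prod>p\<in>set ps. 1 + 8 * c / real p)"
  using assms(3-)
proof (induction ps arbitrary: k m)
  case (Cons p ps)
  define J where "J = cutoff t p k"
  define Q where "Q = (\<Prod>p\<in>set ps. 1 + 8 * c / real p)"
  have p: "prime p" "coprime m p" "p \<notin> set ps" "real p \<ge> 2"
    using Cons.prems prime_ge_2_nat[of p] by auto
  have Q1: "Q \<ge> 1" unfolding Q_def using assms(2) by (intro prod_ge_1) auto
  have gm: "g m \<ge> 0" using g by (auto simp: quasi_multiplicative_def)
  have gp: "g (m * p ^ i) \<le> g m * (2 * (1 / real p) ^ i)" if "i \<ge> 1" for i
    using g that p by (auto simp: quasi_multiplicative_def power_one_over)
  have IH: "tree_sum t c ps (k + i) (m * p ^ i) g \<le> g (m * p ^ i) * Q" for i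
    unfolding Q_def
  proof (rule Cons.IH)
    fix q assume q: "q \<in> set ps"
    then show "coprime (m * p ^ i) q" using p Cons.prems by (intro coprime_mult_prime_power) auto
  qed (use Cons.prems in auto)
  have "tree_sum t c (p # ps) k m g = tree_sum t c ps k m g
     + (\<Sum>i=1..J. c * tree_sum t c ps (k + i) (m * p ^ i) g) + c * g (m * p ^ Suc J)"
    unfolding tree_sum.simps J_def[symmetric] sum_atMost_split_0 by simp
  also have "\<dots> \<le> g m * Q + (\<Sum>i=1..J. c * (g m * (2 * (1 / real p) ^ i) * Q)) + c * (g m * (2 * (1 / real p) ^ Suc J) * Q)"
  proof (intro add_mono sum_mono mult_left_mono assms(2))
    show "tree_sum t c ps k m g \<le> g m * Q" using IH[of 0] by simp
    show "tree_sum t c ps (k + i) (m * p ^ i) g \<le> g m * (2 * (1 / real p) ^ i) * Q" if "i \<in> {1..J}" for i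
      using that gp[of i] Q1 by (intro order_trans[OF IH] mult_right_mono) auto
    have "g (m * p ^ Suc J) * 1 \<le> g m * (2 * (1 / real p) ^ Suc J) * Q"
      using gp[of "Suc J"] Q1 gm by (intro mult_mono) auto
    then show "g (m * p ^ Suc J) \<le> g m * (2 * (1 / real p) ^ Suc J) * Q" by simp
  qed
  also have "\<dots> = g m * Q * (1 + 2 * c * (\<Sum>i=1..Suc J. (1 / real p) ^ i))"
    by (simp add: sum_distrib_left sum_distrib_right algebra_simps)
  also have "\<dots> \<le> g m * Q * (1 + 2 * c * (4 * (1 / real p)))"
    using gm Q1 p assms(2)
    by (intro mult_left_mono add_left_mono sum_power_le_geometric) (auto simp: field_simps)
  also have "\<dots> = g m * (\<Prod>p\<in>set (p # ps). 1 + 8 * c / real p)"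
    using p by (simp add: Q_def mult_ac)
  finally show ?case .
qed simp

text \<open>A branch stopped at its \<open>l\<close>-th factor only has prime factors above \<open>t l\<close>; Rankin's trick is applied
  to it with its own parameter \<open>v l\<close>.\<close>

lemma boundary_sum_Rankin:
  assumes g: "quasi_multiplicative g" and t: "t N < 2"
    and ps: "sorted_wrt (>) ps" "\<And>p. p \<in> set ps \<Longrightarrow> prime p"
    and v: "\<And>l. v l > 0" "\<And>l p. p \<in> set ps \<Longrightarrow> l \<le> N \<Longrightarrow> t l < real p \<Longrightarrow> v l \<le> 3 / 4 * real p"
    and m: "\<And>p. p \<in> set ps \<Longrightarrow> coprime m p" and k: "k < N"
  shows "boundary_sum t ps k m g \<le> g m * (\<Sum>l=Suc k..N. v l ^ k / v l ^ l *
           ((\<Prod>p | p \<in> set ps \<and> t l < real p. 1 + 16 * v l / real p) - 1))"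
  using ps v(2) m k
proof (induction ps arbitrary: k m)
  case Nil
  then show ?case by simp
next
  case (Cons p ps)
  define J where "J = cutoff t p k"
  define Q where "Q = (\<lambda>l. \<Prod>p | p \<in> set ps \<and> t l < real p. 1 + 16 * v l / real p)"
  define Q' where "Q' = (\<lambda>l. \<Prod>q | q \<in> set (p # ps) \<and> t l < real q. 1 + 16 * v l / real q)"
  have p: "prime p" "coprime m p" "p \<notin> set ps" "real p \<ge> 2" "p \<ge> 2" and psp: "\<And>q. q \<in> set ps \<Longrightarrow> q < p"
    using Cons.prems prime_ge_2_nat[of p] by auto
  have J: "k + J < N" "t (k + Suc J) < real p"
    using cutoff_props[where t = t, OF t Cons.prems(5) p(5)] by (auto simp: J_def)
  have Q1: "Q l \<ge> 1" for l unfolding Q_def using v(1)[of l] by (intro prod_ge_1) auto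
  have gm: "g m \<ge> 0" "g d \<ge> 0" for d using g by (auto simp: quasi_multiplicative_def)
  have gp: "g (m * p ^ i) \<le> g m * (2 * (1 / real p) ^ i)" if "i \<ge> 1" for i
    using g that p by (auto simp: quasi_multiplicative_def power_one_over)
  define a where "a = (\<lambda>l. v l ^ k / v l ^ l)"
  have a0: "a l > 0" for l using v(1)[of l] by (simp add: a_def)
  have IH: "boundary_sum t ps (k + i) (m * p ^ i) g \<le> g (m * p ^ i) * (\<Sum>l=Suc k..N. a l * v l ^ i * (Q l - 1))"
    if "i \<le> J" for i
  proof -
    have "boundary_sum t ps (k + i) (m * p ^ i) g \<le> g (m * p ^ i) * (\<Sum>l=Suc (k + i)..N. v l ^ (k + i) / v l ^ l * (Q l - 1))"
      unfolding Q_def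
    proof (rule Cons.IH)
      fix q assume q: "q \<in> set ps"
      then show "coprime (m * p ^ i) q" using p Cons.prems by (intro coprime_mult_prime_power) auto
    qed (use Cons.prems J that in auto)
    also have "\<dots> = g (m * p ^ i) * (\<Sum>l=Suc (k + i)..N. a l * v l ^ i * (Q l - 1))"
      by (simp add: a_def power_add)
    also have "\<dots> \<le> g (m * p ^ i) * (\<Sum>l=Suc k..N. a l * v l ^ i * (Q l - 1))"
    proof (intro mult_left_mono sum_mono2 gm)
      show "0 \<le> a l * v l ^ i * (Q l - 1)" for l
        using a0[of l] v(1)[of l] Q1[of l] by (intro mult_nonneg_nonneg) auto
    qed auto
    finally show ?thesis .
  qed
  \<comment> \<open>The 4 is the weight 2 of a difference times the 2 of
    \<open>quasi_multiplicative\<close>.\<close>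
  define s where "s = (\<lambda>l. 1 + 4 * (\<Sum>i=1..J. (v l / real p) ^ i))"
  define x where "x = 4 * (1 / real p) ^ Suc J"
  have "boundary_sum t (p # ps) k m g = boundary_sum t ps k m g
     + (\<Sum>i=1..J. 2 * boundary_sum t ps (k + i) (m * p ^ i) g) + 2 * g (m * p ^ Suc J)"
    unfolding boundary_sum.simps J_def[symmetric] sum_atMost_split_0 by simp
  also have "\<dots> \<le> g m * (\<Sum>l=Suc k..N. a l * (Q l - 1))
     + (\<Sum>i=1..J. 2 * (g m * (2 * (1 / real p) ^ i) * (\<Sum>l=Suc k..N. a l * v l ^ i * (Q l - 1)))) + g m * x"
  proof (intro add_mono sum_mono mult_left_mono)
    show "boundary_sum t ps k m g \<le> g m * (\<Sum>l=Suc k..N. a l * (Q l - 1))" using IH[of 0] by simp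
    show "boundary_sum t ps (k + i) (m * p ^ i) g \<le> g m * (2 * (1 / real p) ^ i) * (\<Sum>l=Suc k..N. a l * v l ^ i * (Q l - 1))"
      if i: "i \<in> {1..J}" for i
    proof (rule order_trans[OF IH mult_right_mono])
      show "0 \<le> (\<Sum>l=Suc k..N. a l * v l ^ i * (Q l - 1))"
        using a0 v(1) Q1 by (intro sum_nonneg mult_nonneg_nonneg) (auto intro: less_imp_le)
    qed (use i gp[of i] in auto)
    have "g m * x = 2 * (g m * (2 * (1 / real p) ^ Suc J))" by (simp add: x_def)
    then show "2 * g (m * p ^ Suc J) \<le> g m * x" using gp[of "Suc J"] by linarith
  qed auto
  also have "(\<Sum>i=1..J. 2 * (g m * (2 * (1 / real p) ^ i) * (\<Sum>l=Suc k..N. a l * v l ^ i * (Q l - 1))))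
     = (\<Sum>i=1..J. \<Sum>l=Suc k..N. g m * (a l * (Q l - 1)) * (4 * (v l / real p) ^ i))"
    by (simp add: sum_distrib_left power_divide mult_ac)
  also have "\<dots> = (\<Sum>l=Suc k..N. \<Sum>i=1..J. g m * (a l * (Q l - 1)) * (4 * (v l / real p) ^ i))"
    by (rule sum.swap)
  also have "g m * (\<Sum>l=Suc k..N. a l * (Q l - 1)) + \<dots> + g m * x
     = g m * ((\<Sum>l=Suc k..N. a l * (s l * (Q l - 1))) + x)"
    by (simp add: s_def sum_distrib_left sum.distrib distrib_left distrib_right mult_ac)
  \<comment> \<open>The child stopped at p has exactly k + J + 1 factors and is charged to this l
    alone, for which the inserted powers of \<open>v l\<close> cancel.\<close>
  also have "x = (\<Sum>l=Suc k..N. if l = k + Suc J then a l * (4 * (v l / real p) ^ Suc J) else 0)"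
  proof -
    have "a (k + Suc J) * (4 * (v (k + Suc J) / real p) ^ Suc J) = x"
      using v(1)[of "k + Suc J"] by (simp add: a_def x_def power_add power_divide field_simps)
    then show ?thesis using J by simp
  qed
  also have "(\<Sum>l=Suc k..N. a l * (s l * (Q l - 1))) + \<dots>
     = (\<Sum>l=Suc k..N. a l * (s l * (Q l - 1) + (if l = k + Suc J then 4 * (v l / real p) ^ Suc J else 0)))"
    unfolding sum.distrib[symmetric] by (intro sum.cong refl) (auto simp: distrib_left)
  also have "g m * \<dots> \<le> g m * (\<Sum>l=Suc k..N. a l * (Q' l - 1))"
  proof (intro mult_left_mono sum_mono gm)
    fix l assume l: "l \<in> {Suc k..N}"
    show "s l * (Q l - 1) + (if l = k + Suc J then 4 * (v l / real p) ^ Suc J else 0) \<le> Q' l - 1"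
    \<comment> \<open>If p is not above t l, neither are the smaller primes still to come, so both
      products are empty; and the stopped child, having p above its own threshold, belongs to
      another l.\<close>
    proof (cases "t l < real p")
      case False
      then have "{q. q \<in> set ps \<and> t l < real q} = {}" "{q. q \<in> set (p # ps) \<and> t l < real q} = {}"
        using psp by force+
      then have "Q l = 1" "Q' l = 1" unfolding Q_def Q'_def by (simp_all only: prod.empty)
      moreover have "l \<noteq> k + Suc J" using False J by auto
      ultimately show ?thesis by simp
    next
      case True
      define r where "r = v l / real p"
      have r: "0 \<le> r" "r \<le> 3 / 4" using v(1)[of l] Cons.prems(3)[of p l] True l p
        by (auto simp: r_def field_simps)
      define y where "y = 4 * r ^ Suc J"
      have y0: "y \<ge> 0" using r by (simp add: y_def)
      have "s l + y = 1 + 4 * (\<Sum>i=1..Suc J. r ^ i)" by (simp add: s_def r_def y_def)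
      also have "\<dots> \<le> 1 + 4 * (4 * r)" using r by (intro add_left_mono mult_left_mono sum_power_le_geometric) auto
      finally have sy: "s l + y \<le> 1 + 16 * r" by simp
      have s1: "s l \<ge> 1" unfolding s_def r_def[symmetric] using r by (simp add: sum_nonneg)
      have "{q. q \<in> set (p # ps) \<and> t l < real q} = insert p {q. q \<in> set ps \<and> t l < real q}"
        using True by auto
      then have Q': "Q' l = (1 + 16 * r) * Q l" unfolding Q_def Q'_def using p by (simp add: r_def)
      have "s l * (Q l - 1) + y \<le> (s l + y) * Q l - 1"
      proof -
        have "y * 1 \<le> y * Q l" using Q1[of l] y0 by (intro mult_left_mono) auto
        then show ?thesis using s1 by (simp add: algebra_simps)
      qed
      also have "\<dots> \<le> (1 + 16 * r) * Q l - 1" using sy Q1[of l] by (intro diff_right_mono mult_right_mono) auto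
      finally have "s l * (Q l - 1) + y \<le> Q' l - 1" by (simp add: Q')
      moreover have "(if l = k + Suc J then 4 * (v l / real p) ^ Suc J else 0) \<le> y"
        using y0 by (auto simp: y_def r_def)
      ultimately show ?thesis by linarith
    qed
  qed (use a0 in \<open>auto intro: less_imp_le\<close>)
  finally show ?case by (simp add: a_def Q'_def)
qed

section \<open>Choice of the thresholds\<close>

lemma sum_inverse_squares_le:
  assumes "K \<ge> 1"
  shows "(\<Sum>l=Suc K..N. 1 / (real l)\<^sup>2) \<le> 1 / real K"
proof (cases "N \<ge> K")
  case True
  then have "(\<Sum>l=Suc K..N. 1 / (real l)\<^sup>2) \<le> 1 / real K - 1 / real N"
  proof (induction N rule: dec_induct)
    case (step n)
    have n: "real n \<ge> 1" using step assms by simp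
    have "(\<Sum>l=Suc K..Suc n. 1 / (real l)\<^sup>2) = (\<Sum>l=Suc K..n. 1 / (real l)\<^sup>2) + 1 / (real (Suc n))\<^sup>2"
      using step by simp
    moreover have "1 / (real n + 1)\<^sup>2 \<le> 1 / real n - 1 / (real n + 1)"
      using n by (simp add: divide_simps power2_eq_square)
    ultimately show ?case using step.IH by (simp add: add.commute)
  qed simp
  moreover have "0 \<le> 1 / real N" by simp
  ultimately show ?thesis by linarith
qed simp

lemma sum_geometric_tail_le:
  fixes r :: real
  assumes "0 \<le> r" "r < 1"
  shows "(\<Sum>l=k..N. r ^ l) \<le> r ^ k / (1 - r)"
proof (cases "k \<le> N")
  case True
  have "(1 - r) * (\<Sum>l=k..N. r ^ l) = r ^ k - r ^ Suc N"
    using sum_gp_multiplied[OF True, of r] by simp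
  also have "\<dots> \<le> r ^ k" using assms by simp
  finally show ?thesis using assms by (simp add: field_simps)
qed (use assms in auto)

lemma prod_one_plus_le_exp:
  fixes f :: "'a \<Rightarrow> real"
  assumes "finite S" "\<And>x. x \<in> S \<Longrightarrow> 0 \<le> f x"
  shows "(\<Prod>x\<in>S. 1 + f x) \<le> exp (\<Sum>x\<in>S. f x)"
proof -
  have "(\<Prod>x\<in>S. 1 + f x) \<le> (\<Prod>x\<in>S. exp (f x))"
    using assms by (intro prod_mono) (auto intro: add_nonneg_nonneg)
  then show ?thesis using assms(1) by (simp add: exp_sum)
qed

lemma prod_primes_le_exp:
  fixes w y c :: real
  assumes "2 \<le> w" "w \<le> y" "c \<ge> 0" "\<And>p. p \<in> S \<Longrightarrow> prime p \<and> w < real p \<and> real p \<le> y"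
  shows "(\<Prod>p\<in>S. 1 + c / real p) \<le> exp (c * (4 * (1 + ln (ln y / ln w))))"
proof -
  have fin: "finite {p. prime p \<and> w < real p \<and> real p \<le> y}"
    by (rule finite_subset[OF _ finite_primes_real_le[of y]]) auto
  have S: "S \<subseteq> {p. prime p \<and> w < real p \<and> real p \<le> y}" using assms(4) by auto
  have "(\<Prod>p\<in>S. 1 + c / real p) \<le> exp (\<Sum>p\<in>S. c / real p)"
    using finite_subset[OF S fin] assms(3) by (intro prod_one_plus_le_exp) auto
  also have "(\<Sum>p\<in>S. c / real p) = c * (\<Sum>p\<in>S. 1 / real p)" by (simp add: sum_distrib_left)
  also have "(\<Sum>p\<in>S. 1 / real p) \<le> (\<Sum>p | prime p \<and> w < real p \<and> real p \<le> y. 1 / real p)"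
    using S fin by (intro sum_mono2) auto
  also have "\<dots> \<le> 4 * (1 + ln (ln y / ln w))" by (rule sum_inverse_primes_le[OF assms(1,2)])
  finally show ?thesis using assms(3) by (simp add: mult_left_mono)
qed

lemma prod_primes_le_exp_all:
  fixes y c :: real
  assumes "2 \<le> y" "c \<ge> 0" "\<And>p. p \<in> S \<Longrightarrow> prime p \<and> real p \<le> y"
  shows "(\<Prod>p\<in>S. 1 + c / real p) \<le> exp (9 * c) * (ln y) powr (4 * c)"
proof -
  have S: "S \<subseteq> {p. prime p \<and> real p \<le> y}" using assms(3) by auto
  have "(\<Prod>p\<in>S. 1 + c / real p) \<le> exp (\<Sum>p\<in>S. c / real p)"
    using finite_subset[OF S finite_primes_real_le] assms(2) by (intro prod_one_plus_le_exp) auto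
  also have "(\<Sum>p\<in>S. c / real p) = c * (\<Sum>p\<in>S. 1 / real p)" by (simp add: sum_distrib_left)
  also have "(\<Sum>p\<in>S. 1 / real p) \<le> (\<Sum>p | prime p \<and> real p \<le> y. 1 / real p)"
    using S by (intro sum_mono2 finite_primes_real_le) auto
  also have "\<dots> \<le> 9 + 4 * ln (ln y)" by (rule sum_inverse_primes_le_all[OF assms(1)])
  also have "exp (c * (9 + 4 * ln (ln y))) = exp (9 * c) * (ln y) powr (4 * c)"
    using assms(1) by (simp add: powr_def exp_add[symmetric] algebra_simps)
  finally show ?thesis using assms(2) by (simp add: mult_left_mono)
qed

text \<open>With w the exponent of y in t_l, the primes in (y^w, y] have reciprocal sum at most 4 (1
  + log (1/w)), where log (1/w) = -log \<theta> + 2 log (l/K). Multiplied by 16 K this gives 64 K (1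
  - log \<theta>), and, since K log (l/K) \<le> l - K, the growth e^(128 (l - K)). The factor K^(-l)
  outweighs both once K is large.\<close>

lemma large_prime_terms:
  fixes y \<theta> :: real and K l :: nat
  assumes y: "2 \<le> y" and \<theta>: "0 < \<theta>" "\<theta> \<le> 1" and K: "1 \<le> K" "K < l"
    and t: "2 \<le> y powr (\<theta> * (real K / real l)\<^sup>2)"
    and S: "\<And>p. p \<in> S \<Longrightarrow> prime p \<and> y powr (\<theta> * (real K / real l)\<^sup>2) < real p \<and> real p \<le> y"
  shows "1 / real K ^ l * (\<Prod>p\<in>S. 1 + 16 * real K / real p)
     \<le> exp (- real K * (ln (real K) - 64 * (1 - ln \<theta>))) * (exp 128 / real K) ^ (l - K)"
proof -
  define w where "w = \<theta> * (real K / real l)\<^sup>2"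
  have "(real K / real l)\<^sup>2 \<le> 1" using K by (simp add: power_le_one)
  then have w: "0 < w" "w \<le> 1" unfolding w_def using \<theta> K mult_le_one[of \<theta> "(real K / real l)\<^sup>2"] by auto
  have wy: "y powr w \<le> y" using powr_mono[OF w(2), of y] y by simp
  have "(\<Prod>p\<in>S. 1 + 16 * real K / real p) \<le> exp (16 * real K * (4 * (1 + ln (ln y / ln (y powr w)))))"
    using t S wy by (intro prod_primes_le_exp) (auto simp: w_def)
  also have "ln y / ln (y powr w) = 1 / w" using y by (simp add: ln_powr)
  also have "ln (1 / w) = - ln \<theta> + 2 * ln (real l / real K)"
    using \<theta> K by (simp add: w_def ln_div ln_mult ln_realpow power2_eq_square)
  also have "exp (16 * real K * (4 * (1 + (- ln \<theta> + 2 * ln (real l / real K)))))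
     \<le> exp (16 * real K * (4 * (1 + (- ln \<theta> + 2 * (real l / real K - 1)))))"
  proof -
    have "ln (real l / real K) \<le> real l / real K - 1" using K by (intro ln_le_minus_one) auto
    then show ?thesis by (auto intro!: mult_left_mono)
  qed
  also have "16 * real K * (4 * (1 + (- ln \<theta> + 2 * (real l / real K - 1))))
     = real K * (64 * (1 - ln \<theta>)) + 128 * real (l - K)"
    using K by (simp add: field_simps of_nat_diff)
  finally have P: "(\<Prod>p\<in>S. 1 + 16 * real K / real p) \<le> exp (real K * (64 * (1 - ln \<theta>)) + 128 * real (l - K))" .
  have "1 / real K ^ l = exp (- real K * ln (real K)) * (1 / real K) ^ (l - K)"
  proof -
    have "real K ^ l = real K ^ K * real K ^ (l - K)" using K by (simp add: power_add[symmetric])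
    moreover have "exp (- real K * ln (real K)) = 1 / real K ^ K"
      using K by (simp add: exp_minus inverse_eq_divide exp_of_nat_mult)
    ultimately show ?thesis by (simp add: power_one_over)
  qed
  then have "1 / real K ^ l * (\<Prod>p\<in>S. 1 + 16 * real K / real p)
    \<le> exp (- real K * ln (real K)) * (1 / real K) ^ (l - K) * exp (real K * (64 * (1 - ln \<theta>)) + 128 * real (l - K))"
    using P by (auto intro!: mult_left_mono)
  also have "\<dots> = exp (- real K * (ln (real K) - 64 * (1 - ln \<theta>))) * (exp 128 / real K) ^ (l - K)"
  proof -
    have "exp (128 * real (l - K)) = exp 128 ^ (l - K)" by (simp add: exp_of_nat2_mult)
    then show ?thesis by (simp add: exp_add exp_diff right_diff_distrib power_divide exp_minus divide_inverse mult_ac power_inverse power_mult_distrib)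
  qed
  finally show ?thesis .
qed

text \<open>With parameter 3/2 the product over all primes up to y costs (log x)^96, where 96 = 4 *
  24 and 24 = 16 * 3/2; likewise 216 = 9 * 24. The constant \<open>C4\<close> is chosen so that
  (2/3)^k1 repays these logarithms and saves A more.\<close>

lemma small_prime_terms:
  fixes x y A C4 :: real
  assumes y: "2 \<le> y" "y \<le> x" and A: "A > 0" and C4: "C4 = (A + 96) / ln (3 / 2)"
    and k1: "k1 = nat \<lceil>C4 * ln (ln x)\<rceil>"
    and S: "\<And>l p. p \<in> S l \<Longrightarrow> prime p \<and> real p \<le> y"
  shows "(\<Sum>l=k1..N. 1 / (3/2::real) ^ l * (\<Prod>p\<in>S l. 1 + 16 * (3/2) / real p)) \<le> 3 * exp 216 / (ln x) powr A"
proof -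
  have lx: "ln y > 0" "ln x \<ge> ln y" using y by auto
  have C0: "C4 > 0" using C4 A by simp
  have "(\<Sum>l=k1..N. 1 / (3/2::real) ^ l * (\<Prod>p\<in>S l. 1 + 16 * (3/2) / real p))
     \<le> (\<Sum>l=k1..N. (2/3::real) ^ l * (exp 216 * (ln x) powr 96))"
  proof (rule sum_mono)
    fix l
    have "(\<Prod>p\<in>S l. 1 + 24 / real p) \<le> exp (9 * 24) * (ln y) powr (4 * 24)"
      using y S by (intro prod_primes_le_exp_all) auto
    also have "\<dots> \<le> exp 216 * (ln x) powr 96" using lx by (auto intro!: powr_mono2)
    finally show "1 / (3/2::real) ^ l * (\<Prod>p\<in>S l. 1 + 16 * (3/2) / real p) \<le> (2/3::real) ^ l * (exp 216 * (ln x) powr 96)"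
      by (auto simp: power_divide intro!: mult_left_mono divide_right_mono)
  qed
  also have "\<dots> = (\<Sum>l=k1..N. (2/3::real) ^ l) * (exp 216 * (ln x) powr 96)" by (simp add: sum_distrib_right)
  also have "\<dots> \<le> ((2/3) ^ k1 / (1 - 2/3)) * (exp 216 * (ln x) powr 96)"
    by (intro mult_right_mono sum_geometric_tail_le) auto
  also have "(2/3::real) ^ k1 \<le> (ln x) powr (- (A + 96))"
  proof -
    have "(2/3::real) ^ k1 = (2/3) powr real k1" by (simp add: powr_realpow)
    also have "\<dots> \<le> (2/3) powr (C4 * ln (ln x))"
      unfolding k1 by (intro powr_mono') (auto simp: real_nat_ceiling_ge)
    also have "\<dots> = exp (C4 * ln (ln x) * ln (2/3))" by (simp add: powr_def)
    also have "ln (2/3::real) = - ln (3/2)" by (simp add: ln_div)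
    also have "C4 * ln (ln x) * (- ln (3/2)) = - (A + 96) * ln (ln x)"
    proof -
      have "C4 * ln (3/2) = A + 96" using C4 by simp
      moreover have "C4 * ln (ln x) * (- ln (3/2)) = - (C4 * ln (3/2)) * ln (ln x)" by simp
      ultimately show ?thesis by (simp only:)
    qed
    also have "exp (- (A + 96) * ln (ln x)) = (ln x) powr (- (A + 96))" using lx by (simp add: powr_def)
    finally show ?thesis .
  qed
  also have "(ln x) powr (- (A + 96)) / (1 - 2/3) * (exp 216 * (ln x) powr 96) = 3 * exp 216 / (ln x) powr A"
  proof -
    have "(ln x) powr (- (A + 96)) * (ln x) powr 96 = 1 / (ln x) powr A"
    proof -
      have "(ln x) powr (- (A + 96)) * (ln x) powr 96 = (ln x) powr (- (A + 96) + 96)"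
        by (rule powr_add[symmetric])
      also have "- (A + 96) + 96 = - A" by simp
      also have "(ln x) powr (- A) = 1 / (ln x) powr A" by (rule powr_minus_divide)
      finally show ?thesis .
    qed
    moreover have "a / (1 - 2/3) * (E * b) = 3 * E * (a * b)" for a b E :: real by simp
    ultimately show ?thesis by (simp only: times_divide_eq_right mult_1_right)
  qed
  finally show ?thesis by (simp add: divide_right_mono mult_right_mono)
qed

lemma sum_large_prime_terms:
  fixes K :: nat
  assumes "real K \<ge> 2 * exp 128"
  shows "(\<Sum>l=Suc K..n. (exp 128 / real K) ^ (l - K)) \<le> 1"
proof -
  define r where "r = exp 128 / real K"
  have K0: "real K > 0" using assms less_le_trans[of 0 "2 * exp (128::real)" "real K"] by simp
  have r: "0 \<le> r" "r \<le> 1 / 2" using assms K0 by (auto simp: r_def field_simps)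
  have "(\<Sum>l=Suc K..n. r ^ (l - K)) = (\<Sum>j=1..n - K. r ^ j)"
    by (rule sum.reindex_bij_witness[of _ "\<lambda>j. j + K" "\<lambda>l. l - K"]) auto
  also have "\<dots> \<le> r ^ 1 / (1 - r)" using r by (intro sum_geometric_tail_le) auto
  also have "\<dots> \<le> 1" using r by (simp add: field_simps)
  finally show ?thesis unfolding r_def .
qed

text \<open>The thresholds serve two opposite aims: large enough that few divisors are stopped, yet
  with product below x^\<beta>. The budget \<open>X\<close> records the second aim in the form used
  by \<open>tree_sum_1_le\<close>.\<close>

lemma sieve_parameters:
  fixes \<alpha> \<beta> A :: real
  assumes "0 < \<alpha>" "\<alpha> < \<beta>" "A > 0"
  shows "\<exists>C U0 X0. C \<ge> 0 \<and> (\<forall>x y ps g. X0 \<le> x \<longrightarrow> 2 \<le> y \<longrightarrow> y \<le> x \<longrightarrow> U0 \<le> ln x / ln y \<longrightarrow>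
     sorted_wrt (>) ps \<longrightarrow> (\<forall>p\<in>set ps. prime p \<and> real p \<le> y) \<longrightarrow>
     quasi_multiplicative g \<longrightarrow> g 1 \<le> 1 \<longrightarrow>
     (\<exists>t N X. t N < 2 \<and> 0 < N \<and>
        (\<forall>k p. p \<in> set ps \<longrightarrow> real p \<le> t (Suc k) \<longrightarrow> real p * X (Suc k) \<le> X k) \<and>
        (\<forall>k p. p \<in> set ps \<longrightarrow> real p \<le> X k) \<and> (\<forall>k. 1 \<le> X k) \<and> X 0 \<le> x powr \<beta> \<and>
        boundary_sum t ps 0 1 g
          \<le> exp (- \<alpha> * (ln x / ln y) * ln (ln x / ln y)) + C / (ln x) powr A))"
proof -
  define \<kappa> where "\<kappa> = (\<alpha> + \<beta>) / 2"
  have \<kappa>: "\<alpha> < \<kappa>" "\<kappa> < \<beta>" "0 < \<kappa>" using assms by (auto simp: \<kappa>_def)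
  \<comment> \<open>The thresholds beyond K add at most \<theta>K to the exponent of y. This choice
    keeps \<kappa>(1 + \<theta>) halfway between \<kappa> and \<beta> at most.\<close>
  define \<theta> where "\<theta> = min 1 ((\<beta> - \<kappa>) / (2 * \<kappa>))"
  have \<theta>: "0 < \<theta>" "\<theta> \<le> 1" using \<kappa> by (auto simp: \<theta>_def)
  have \<theta>\<kappa>: "\<kappa> * (1 + \<theta>) \<le> (\<kappa> + \<beta>) / 2"
  proof -
    have "\<kappa> * \<theta> \<le> \<kappa> * ((\<beta> - \<kappa>) / (2 * \<kappa>))" using \<kappa> by (intro mult_left_mono) (auto simp: \<theta>_def)
    also have "\<dots> = (\<beta> - \<kappa>) / 2" using \<kappa> by simp
    finally show ?thesis by (simp add: distrib_left field_simps)
  qed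
  define c2 where "c2 = 64 * (1 - ln \<theta>)"
  define C4 where "C4 = (A + 96) / ln (3 / 2)"
  have C4: "C4 > 0" using assms by (simp add: C4_def)
  \<comment> \<open>Here K \<ge> \<kappa>u - 1, and the quotient tends to \<kappa> > \<alpha>. The
    excess of \<kappa> over \<alpha> absorbs the factor e^(c2 K) lost in
    \<open>large_prime_terms\<close>.\<close>
  have "eventually (\<lambda>u::real. \<alpha> < (\<kappa> * u - 1) * (ln (\<kappa> * u - 1) - c2) / (u * ln u)) at_top"
  proof (rule order_tendstoD(1))
    show "((\<lambda>u::real. (\<kappa> * u - 1) * (ln (\<kappa> * u - 1) - c2) / (u * ln u)) \<longlongrightarrow> \<kappa>) at_top"
      using \<kappa>(3) by real_asymp
  qed (rule \<kappa>(1))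
  moreover have "eventually (\<lambda>u::real. u \<ge> 2 / \<kappa> \<and> u \<ge> 2 / (\<beta> - \<kappa>) \<and> \<kappa> * u - 1 \<ge> 2 * exp 128 \<and>
      ln (\<kappa> * u - 1) \<ge> c2 \<and> u > 1) at_top"
    using \<kappa>(3) by (intro eventually_conj eventually_ge_at_top eventually_gt_at_top) real_asymp+
  ultimately have "eventually (\<lambda>u::real. \<alpha> < (\<kappa> * u - 1) * (ln (\<kappa> * u - 1) - c2) / (u * ln u) \<and>
      u \<ge> 2 / \<kappa> \<and> u \<ge> 2 / (\<beta> - \<kappa>) \<and> \<kappa> * u - 1 \<ge> 2 * exp 128 \<and> ln (\<kappa> * u - 1) \<ge> c2 \<and> u > 1) at_top"
    by eventually_elim simp
  then obtain U0 where U0: "\<And>u::real. u \<ge> U0 \<Longrightarrow> \<alpha> < (\<kappa> * u - 1) * (ln (\<kappa> * u - 1) - c2) / (u * ln u) \<and>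
      u \<ge> 2 / \<kappa> \<and> u \<ge> 2 / (\<beta> - \<kappa>) \<and> \<kappa> * u - 1 \<ge> 2 * exp 128 \<and> ln (\<kappa> * u - 1) \<ge> c2 \<and> u > 1"
    unfolding eventually_at_top_linorder by blast
  define c3 where "c3 = \<theta> * \<kappa> / 2"
  have c3: "c3 > 0" using \<theta> \<kappa> by (simp add: c3_def)
  \<comment> \<open>This makes t_l at least 2 (C4 log log x + 1) for K < l < k1, hence well above K,
    as admissibility of the Rankin parameter K demands.\<close>
  have "eventually (\<lambda>x::real. c3 * ln x / (C4 * ln (ln x) + 1)\<^sup>2 \<ge> ln (2 * (C4 * ln (ln x) + 1)) \<and> ln (ln x) \<ge> 0) at_top"
    using c3 C4 by (intro eventually_conj) real_asymp+
  then obtain X0 where X0: "\<And>x::real. x \<ge> X0 \<Longrightarrow>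
      c3 * ln x / (C4 * ln (ln x) + 1)\<^sup>2 \<ge> ln (2 * (C4 * ln (ln x) + 1)) \<and> ln (ln x) \<ge> 0"
    unfolding eventually_at_top_linorder by blast
  have "\<exists>t N X. t N < 2 \<and> 0 < N \<and>
        (\<forall>k p. p \<in> set ps \<longrightarrow> real p \<le> t (Suc k) \<longrightarrow> real p * X (Suc k) \<le> X k) \<and>
        (\<forall>k p. p \<in> set ps \<longrightarrow> real p \<le> X k) \<and> (\<forall>k. 1 \<le> X k) \<and> X 0 \<le> x powr \<beta> \<and>
        boundary_sum t ps 0 1 g
          \<le> exp (- \<alpha> * (ln x / ln y) * ln (ln x / ln y)) + (3 * exp 216) / (ln x) powr A"
    if x: "X0 \<le> x" and y: "2 \<le> y" "y \<le> x" and u: "U0 \<le> ln x / ln y"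
      and ps: "sorted_wrt (>) ps" "\<And>p. p \<in> set ps \<Longrightarrow> prime p \<and> real p \<le> y"
      and g: "quasi_multiplicative g" "g 1 \<le> 1" for x y ps g
  proof -
    define u where "u = ln x / ln y"
    have ly: "ln y > 0" using y by simp
    have lx: "ln x > 0" using y by simp
    have ux: "u * ln y = ln x" using ly by (simp add: u_def)
    have uU: "\<alpha> < (\<kappa> * u - 1) * (ln (\<kappa> * u - 1) - c2) / (u * ln u)"
      "u \<ge> 2 / \<kappa>" "u \<ge> 2 / (\<beta> - \<kappa>)" "\<kappa> * u - 1 \<ge> 2 * exp 128" "ln (\<kappa> * u - 1) \<ge> c2" "u > 1"
      using U0[of u] u by (auto simp: u_def)
    define K where "K = nat \<lfloor>\<kappa> * u\<rfloor>"
    have e128: "exp 128 \<ge> (1::real)" by simp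
    have K: "\<kappa> * u - 1 \<le> real K" "real K \<le> \<kappa> * u"
      unfolding K_def using uU(4) e128 by linarith+
    have Kbig: "real K \<ge> 2 * exp 128" using K uU(4) by linarith
    have K1: "K \<ge> 1" using Kbig e128 by linarith
    have Kx: "real K * ln y \<ge> \<kappa> / 2 * ln x"
    proof -
      have "\<kappa> * u / 2 \<ge> 1" using uU(2) \<kappa> by (simp add: field_simps)
      then have "real K \<ge> \<kappa> * u / 2" using K by linarith
      then have "real K * ln y \<ge> \<kappa> * u / 2 * ln y" using ly by (intro mult_right_mono) auto
      then show ?thesis using ux by (simp add: mult_ac)
    qed
    \<comment> \<open>The square is a compromise: the exponents beyond K have a sum of order K,
      while log (1/w) grows only like log (l/K).\<close>
    define w where "w = (\<lambda>l. if l \<le> K then 1 else \<theta> * (real K / real l)\<^sup>2)"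
    define t where "t = (\<lambda>l. y powr w l)"
    have w0: "w l \<ge> 0" for l using \<theta> by (simp add: w_def)
    \<comment> \<open>Chosen so that t_l < 2 for every l \<ge> N, whence no branch can have N
      factors without being stopped.\<close>
    define M where "M = real K + \<theta> * (real K)\<^sup>2 * ln y / ln 2 + 1"
    obtain N :: nat where N: "M < real N" using reals_Archimedean2 by blast
    have "0 \<le> \<theta> * (real K)\<^sup>2 * ln y / ln 2" using \<theta> ly by simp
    then have NK: "K < N" "N \<ge> 1" "\<theta> * (real K)\<^sup>2 * ln y / ln 2 < real N" using N unfolding M_def by linarith+
    have tN: "t l < 2" if l: "N \<le> l" for l
    proof -
      have l1: "real l \<ge> 1" "real l \<ge> real N" using NK l by auto
      have "w l * ln y = \<theta> * (real K)\<^sup>2 * ln y / (real l * real l)"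
        using l NK by (simp add: w_def power_divide power2_eq_square)
      also have "\<dots> \<le> \<theta> * (real K)\<^sup>2 * ln y / (1 * real l)"
        using l1 \<theta> ly by (intro divide_left_mono mult_right_mono) auto
      also have "\<dots> < ln 2"
      proof -
        have "\<theta> * (real K)\<^sup>2 * ln y < real N * ln 2" using NK(3) by (simp add: field_simps)
        also have "\<dots> \<le> real l * ln 2" using l1 by (intro mult_right_mono) auto
        finally show ?thesis using l1 by (simp add: field_simps)
      qed
      finally have "exp (w l * ln y) < exp (ln 2)" by (simp only: exp_less_cancel_iff)
      then show ?thesis using y by (simp add: t_def powr_def)
    qed
    \<comment> \<open>The product of the thresholds still to come, times one extra y for the final
      factor of a stopped branch.\<close>
    define X where "X = (\<lambda>k. y * exp (ln y * (\<Sum>l=Suc k..N. w l)))"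
    have Xy: "y \<le> X k" for k
      unfolding X_def using y ly w0 by (simp add: sum_nonneg)
    have X1: "real p * X (Suc k) \<le> X k" if p: "p \<in> set ps" "real p \<le> t (Suc k)" for k p
    proof -
      have "real p \<ge> 2" using ps(2)[OF p(1)] prime_ge_2_nat[of p] by auto
      then have "\<not> N \<le> Suc k" using tN[of "Suc k"] p by linarith
      then have "(\<Sum>l=Suc k..N. w l) = w (Suc k) + (\<Sum>l=Suc (Suc k)..N. w l)"
        by (subst sum.atLeast_Suc_atMost) auto
      then have "X k = t (Suc k) * X (Suc k)"
        using y by (simp add: X_def t_def powr_def exp_add distrib_left mult_ac)
      moreover have "X (Suc k) \<ge> 0" using Xy[of "Suc k"] y by linarith
      ultimately show ?thesis using p by (simp add: mult_right_mono)
    qed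
    have X0x: "X 0 \<le> x powr \<beta>"
    proof -
      have "(\<Sum>l=1..N. w l) = (\<Sum>l=1..K. w l) + (\<Sum>l=Suc K..N. w l)"
      proof -
        have "{1..N} = {1..K} \<union> {Suc K..N}" using NK by auto
        then show ?thesis by (simp add: sum.union_disjoint)
      qed
      also have "(\<Sum>l=1..K. w l) = real K" by (simp add: w_def)
      also have "(\<Sum>l=Suc K..N. w l) = \<theta> * (real K)\<^sup>2 * (\<Sum>l=Suc K..N. 1 / (real l)\<^sup>2)"
        unfolding sum_distrib_left by (intro sum.cong) (auto simp: w_def power_divide)
      also have "\<dots> \<le> \<theta> * (real K)\<^sup>2 * (1 / real K)"
        using \<theta> sum_inverse_squares_le[OF K1, of N] by (intro mult_left_mono) auto
      also have "\<dots> = \<theta> * real K" using K1 by (simp add: power2_eq_square)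
      finally have "1 + (\<Sum>l=1..N. w l) \<le> 1 + (1 + \<theta>) * real K" by (simp add: distrib_right)
      also have "(1 + \<theta>) * real K \<le> (1 + \<theta>) * (\<kappa> * u)" using K \<theta> by (intro mult_left_mono) auto
      also have "(1 + \<theta>) * (\<kappa> * u) = \<kappa> * (1 + \<theta>) * u" by simp
      also have "\<dots> \<le> (\<kappa> + \<beta>) / 2 * u" using \<theta>\<kappa> uU(6) by (intro mult_right_mono) auto
      also have "1 + (\<kappa> + \<beta>) / 2 * u \<le> \<beta> * u" using uU(3) \<kappa> by (simp add: field_simps)
      finally have "ln y * (1 + (\<Sum>l=1..N. w l)) \<le> ln y * (\<beta> * u)" using ly by (intro mult_left_mono) auto
      also have "\<dots> = \<beta> * ln x" using ux by (simp add: mult_ac)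
      finally have "exp (ln y * (1 + (\<Sum>l=1..N. w l))) \<le> exp (\<beta> * ln x)" by simp
      then show ?thesis using y lx by (simp add: X_def powr_def exp_add distrib_left)
    qed
    define k1 where "k1 = nat \<lceil>C4 * ln (ln x)\<rceil>"
    have llx: "ln (ln x) \<ge> 0" using X0[OF x] by simp
    have k1: "real k1 \<le> C4 * ln (ln x) + 1" unfolding k1_def
      using llx C4 by (simp add: of_nat_nat)
    \<comment> \<open>The value 3/2 is the largest constant with v \<le> 3/4 p for every prime
      p.\<close>
    define v where "v = (\<lambda>l. if l < k1 then real K else 3 / 2)"
    have v0: "v l > 0" for l using K1 by (simp add: v_def)
    have tl: "2 \<le> t l \<and> real K \<le> 3 / 4 * t l" if l: "K < l" "l < k1" for l
    proof -
      define Lx where "Lx = C4 * ln (ln x) + 1"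
      have Lx: "real l \<le> Lx" "Lx \<ge> 1" using l k1 llx C4 by (auto simp: Lx_def)
      have l0: "real l > 0" using l by simp
      have "ln (2 * Lx) \<le> c3 * ln x / Lx\<^sup>2" using X0[OF x] by (simp add: Lx_def)
      also have "\<dots> \<le> c3 * ln x / (real l)\<^sup>2"
        using Lx l0 c3 lx by (intro divide_left_mono power_mono) auto
      also have "c3 * ln x \<le> \<theta> * (real K * (real K * ln y))"
      proof -
        have "c3 * ln x = \<theta> * (1 * (\<kappa> / 2 * ln x))" by (simp add: c3_def)
        also have "\<dots> \<le> \<theta> * (real K * (real K * ln y))"
        proof (rule mult_left_mono)
          show "1 * (\<kappa> / 2 * ln x) \<le> real K * (real K * ln y)"
            by (rule mult_mono[OF _ Kx]) (use K1 \<kappa> lx in auto)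
        qed (use \<theta> in simp)
        finally show ?thesis .
      qed
      also have "\<theta> * (real K * (real K * ln y)) / (real l)\<^sup>2 = ln y * w l"
        using l by (simp add: w_def power_divide power2_eq_square)
      finally have "ln (2 * Lx) \<le> ln y * w l" by (simp add: divide_right_mono)
      then have "exp (ln (2 * Lx)) \<le> exp (ln y * w l)" by simp
      then have "2 * Lx \<le> t l" using Lx y by (simp add: t_def powr_def mult.commute)
      moreover have "real K \<le> Lx" using l Lx by linarith
      ultimately show ?thesis using Lx by linarith
    qed
    have ty: "t l = y" if "l \<le> K" for l using that y by (simp add: t_def w_def)
    have vt: "v l \<le> 3 / 4 * real p" if p: "p \<in> set ps" "l \<le> N" "t l < real p" for l p
    proof (cases "l < k1")
      case True
      have "\<not> l \<le> K" using ty[of l] p ps(2)[OF p(1)] by auto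
      then have "real K \<le> 3 / 4 * t l" using tl[of l] True by auto
      then show ?thesis using p True by (simp add: v_def)
    next
      case False
      have "real p \<ge> 2" using ps(2)[OF p(1)] prime_ge_2_nat[of p] by auto
      then show ?thesis using False by (simp add: v_def)
    qed
    define S where "S = (\<lambda>l. {p. p \<in> set ps \<and> t l < real p})"
    define P where "P = (\<lambda>l. \<Prod>p\<in>S l. 1 + 16 * v l / real p)"
    have P1: "P l \<ge> 1" for l unfolding P_def using v0[of l] by (intro prod_ge_1) auto
    have "boundary_sum t ps 0 1 g \<le> g 1 * (\<Sum>l=Suc 0..N. v l ^ 0 / v l ^ l * (P l - 1))"
      unfolding P_def S_def
      by (rule boundary_sum_Rankin[where t = t]) (use g ps v0 vt tN NK in auto)
    also have "\<dots> \<le> 1 * (\<Sum>l=Suc 0..N. v l ^ 0 / v l ^ l * (P l - 1))"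
      using g(2) v0 P1 by (intro mult_right_mono sum_nonneg mult_nonneg_nonneg) (auto intro: less_imp_le)
    also have "\<dots> = (\<Sum>l=1..N. 1 / v l ^ l * (P l - 1))" by simp
    \<comment> \<open>For l \<le> K the threshold is y, so no prime exceeds it and the factor P l -
      1 vanishes: this is what the -1 in Rankin's bound is for.\<close>
    also have "\<dots> = (\<Sum>l=Suc K..N. 1 / v l ^ l * (P l - 1))"
    proof (rule sum.mono_neutral_right)
      show "\<forall>l\<in>{1..N} - {Suc K..N}. 1 / v l ^ l * (P l - 1) = 0"
      proof
        fix l assume "l \<in> {1..N} - {Suc K..N}"
        then have "t l = y" using ty by auto
        then have "S l = {}" using ps(2) by (force simp: S_def)
        then show "1 / v l ^ l * (P l - 1) = 0" by (simp add: P_def)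
      qed
    qed auto
    also have "\<dots> \<le> (\<Sum>l=Suc K..N. 1 / v l ^ l * P l)"
      using v0 by (intro sum_mono mult_left_mono) (auto intro: less_imp_le)
    also have "\<dots> \<le> (\<Sum>l=Suc K..N. (if l < k1 then exp (- real K * (ln (real K) - c2)) * (exp 128 / real K) ^ (l - K) else 0)
       + (if k1 \<le> l then 1 / (3/2) ^ l * (\<Prod>p\<in>S l. 1 + 16 * (3/2) / real p) else 0))"
    proof (rule sum_mono)
      fix l assume l: "l \<in> {Suc K..N}"
      show "1 / v l ^ l * P l \<le> (if l < k1 then exp (- real K * (ln (real K) - c2)) * (exp 128 / real K) ^ (l - K) else 0)
       + (if k1 \<le> l then 1 / (3/2) ^ l * (\<Prod>p\<in>S l. 1 + 16 * (3/2) / real p) else 0)"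
      proof (cases "l < k1")
        case True
        have tw: "t l = y powr (\<theta> * (real K / real l)\<^sup>2)" using l by (simp add: t_def w_def)
        have "1 / real K ^ l * (\<Prod>p\<in>S l. 1 + 16 * real K / real p)
           \<le> exp (- real K * (ln (real K) - c2)) * (exp 128 / real K) ^ (l - K)"
          unfolding c2_def using y \<theta> K1 l tl[of l] True ps(2)
          by (intro large_prime_terms) (auto simp: tw[symmetric] S_def)
        then show ?thesis using True by (simp add: v_def P_def)
      next
        case False
        then show ?thesis by (simp add: v_def P_def)
      qed
    qed
    also have "\<dots> = (\<Sum>l=Suc K..N. if l < k1 then exp (- real K * (ln (real K) - c2)) * (exp 128 / real K) ^ (l - K) else 0)
       + (\<Sum>l=Suc K..N. if k1 \<le> l then 1 / (3/2) ^ l * (\<Prod>p\<in>S l. 1 + 16 * (3/2) / real p) else 0)"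
      by (rule sum.distrib)
    also have "(\<Sum>l=Suc K..N. if l < k1 then exp (- real K * (ln (real K) - c2)) * (exp 128 / real K) ^ (l - K) else 0)
       \<le> (\<Sum>l=Suc K..N. exp (- real K * (ln (real K) - c2)) * (exp 128 / real K) ^ (l - K))"
      by (intro sum_mono) auto
    also have "\<dots> = exp (- real K * (ln (real K) - c2)) * (\<Sum>l=Suc K..N. (exp 128 / real K) ^ (l - K))"
      by (simp only: sum_distrib_left)
    also have "\<dots> \<le> exp (- real K * (ln (real K) - c2)) * 1"
      by (intro mult_left_mono sum_large_prime_terms Kbig) auto
    also have "exp (- real K * (ln (real K) - c2)) * 1 \<le> exp (- \<alpha> * u * ln u)"
    proof -
      have ul: "u * ln u > 0" using uU(6) by simp
      have "\<alpha> * (u * ln u) < (\<kappa> * u - 1) * (ln (\<kappa> * u - 1) - c2)"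
        using uU(1) ul by (simp add: pos_less_divide_eq)
      also have "\<dots> \<le> real K * (ln (real K) - c2)"
      proof (rule mult_mono)
        have "0 < \<kappa> * u - 1" using uU(4) e128 by linarith
        then show "ln (\<kappa> * u - 1) - c2 \<le> ln (real K) - c2" using K(1) by (simp add: K1)
      qed (use K uU(5) in auto)
      finally show ?thesis by (simp add: mult_ac)
    qed
    also have "(\<Sum>l=Suc K..N. if k1 \<le> l then 1 / (3/2) ^ l * (\<Prod>p\<in>S l. 1 + 16 * (3/2) / real p) else 0)
       \<le> (\<Sum>l=k1..N. 1 / (3/2) ^ l * (\<Prod>p\<in>S l. 1 + 16 * (3/2) / real p))"
    proof -
      have "(\<Sum>l=Suc K..N. if k1 \<le> l then 1 / (3/2) ^ l * (\<Prod>p\<in>S l. 1 + 16 * (3/2) / real p) else 0)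
        = (\<Sum>l\<in>{Suc K..N} \<inter> {l. k1 \<le> l}. 1 / (3/2) ^ l * (\<Prod>p\<in>S l. 1 + 16 * (3/2) / real p))"
        by (subst sum.inter_restrict) auto
      also have "\<dots> \<le> (\<Sum>l=k1..N. 1 / (3/2) ^ l * (\<Prod>p\<in>S l. 1 + 16 * (3/2) / real p))"
        by (intro sum_mono2) (auto intro!: divide_nonneg_nonneg prod_nonneg)
      finally show ?thesis .
    qed
    also have "\<dots> \<le> 3 * exp 216 / (ln x) powr A"
      using y assms(3) ps(2) by (intro small_prime_terms[OF _ _ _ C4_def k1_def]) (auto simp: S_def)
    finally have "boundary_sum t ps 0 1 g \<le> exp (- \<alpha> * u * ln u) + 3 * exp 216 / (ln x) powr A" by simp
    moreover have "1 \<le> X k" "p \<in> set ps \<Longrightarrow> real p \<le> X k" for k p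
      using Xy[of k] y ps(2)[of p] by auto
    ultimately show ?thesis
      using tN[of N] NK X1 X0x unfolding u_def by (intro exI[of _ t] exI[of _ N] exI[of _ X]) auto
  qed
  then show ?thesis by (intro exI[of _ "3 * exp 216"] exI[of _ U0] exI[of _ X0]) auto
qed

section \<open>Comparison with the Kubilius model\<close>

text \<open>The stopped nodes of \<open>P\<close> are bounded by those of the model plus the
  remainders |P - Q|, so Rankin's trick is applied to the model only. Remainders of weight
  2^\<omega> are split: with weight 1 they go to the level of distribution, and with weight
  4^\<omega> the trivial bounds on both divisor probabilities suffice.\<close>

lemma kubilius_comparison:
  fixes F :: "(nat \<Rightarrow> nat) \<Rightarrow> real"
  assumes P: "0 \<notin> set_pmf P" and Q: "0 \<notin> set_pmf Q" "quasi_multiplicative (dvd_prob Q)"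
    and ps: "distinct ps" "\<And>p. p \<in> set ps \<Longrightarrow> prime p"
    and F: "\<And>v. \<bar>F v\<bar> \<le> 1"
    and t: "t N < 2" "0 < N"
    and X: "\<And>k p. p \<in> set ps \<Longrightarrow> real p \<le> t (Suc k) \<Longrightarrow> real p * X (Suc k) \<le> X k"
      "\<And>k p. p \<in> set ps \<Longrightarrow> real p \<le> X k" "\<And>k. 1 \<le> X k"
    and a: "0 \<le> a" "\<And>d. dvd_prob P d \<le> a * (1 / real d)" and \<tau>: "\<tau> > 0"
  shows "\<bar>measure_pmf.expectation P (\<lambda>n. F (exponents (set ps) n))
        - measure_pmf.expectation Q (\<lambda>n. F (exponents (set ps) n))\<bar>
     \<le> 2 * boundary_sum t ps 0 1 (dvd_prob Q)
       + \<tau> * (\<Sum>d\<in>smooth_upto (set ps) (X 0). \<bar>dvd_prob P d - dvd_prob Q d\<bar>)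
       + (a + 1) / \<tau> * (\<Prod>p\<in>set ps. 1 + 32 / real p)"
proof -
  define r where "r = (\<lambda>d. \<bar>dvd_prob P d - dvd_prob Q d\<bar>)"
  have r0: "r d \<ge> 0" for d by (simp add: r_def)
  define T where "T = tree_sum t 2 ps 0 1 r"
  define \<Pi>p where "\<Pi>p = (\<Prod>p\<in>set ps. 1 + 32 / real p)"
  have \<Pi>0: "\<Pi>p \<ge> 0" unfolding \<Pi>p_def by (intro prod_nonneg) auto
  have e: "\<bar>measure_pmf.expectation M (\<lambda>n. F (exponents (set ps) n)) - tree_expansion t ps 0 1 F (dvd_prob M)\<bar>
      \<le> boundary_sum t ps 0 1 (dvd_prob M)" if "0 \<notin> set_pmf M" for M
    using tree_expansion_error[OF that ps(1), of 1 F 1 t 0] ps(2) F by simp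
  have "\<bar>tree_expansion t ps 0 1 F (dvd_prob P) - tree_expansion t ps 0 1 F (dvd_prob Q)\<bar> \<le> T"
    using tree_expansion_diff[of F 1 t ps 0 1 "dvd_prob P" "dvd_prob Q"] F by (simp add: T_def r_def)
  moreover have "boundary_sum t ps 0 1 (dvd_prob P) \<le> boundary_sum t ps 0 1 (dvd_prob Q) + boundary_sum t ps 0 1 r"
    by (rule boundary_sum_le_add) (simp add: r_def)
  moreover have "boundary_sum t ps 0 1 r \<le> T" unfolding T_def by (rule boundary_sum_le_tree_sum) (rule r0)
  ultimately have main: "\<bar>measure_pmf.expectation P (\<lambda>n. F (exponents (set ps) n))
        - measure_pmf.expectation Q (\<lambda>n. F (exponents (set ps) n))\<bar> \<le> 2 * boundary_sum t ps 0 1 (dvd_prob Q) + 2 * T"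
    using e[OF P] e[OF Q(1)] by linarith
  have "T \<le> \<tau> / 2 * tree_sum t 1 ps 0 1 r + 1 / (2 * \<tau>) * tree_sum t 4 ps 0 1 r"
    unfolding T_def by (rule tree_sum_AM_GM[OF r0 \<tau>])
  moreover have t1: "\<tau> / 2 * tree_sum t 1 ps 0 1 r \<le> \<tau> / 2 * (\<Sum>d\<in>smooth_upto (set ps) (X 0). r d)"
    using tree_sum_1_le[where t = t and N = N and ps = ps and X = X and \<rho> = r and k = 0 and m = 1] t ps X r0 \<tau>
    by (intro mult_left_mono) auto
  moreover have "1 / (2 * \<tau>) * tree_sum t 4 ps 0 1 r \<le> 1 / (2 * \<tau>) * ((a + 1) * \<Pi>p)"
  proof (rule mult_left_mono)
    have q1: "quasi_multiplicative (\<lambda>d. 1 / real d)"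
      by (auto simp: quasi_multiplicative_def intro!: divide_right_mono)
    have "tree_sum t 4 ps 0 1 r \<le> a * tree_sum t 4 ps 0 1 (\<lambda>d. 1 / real d) + tree_sum t 4 ps 0 1 (dvd_prob Q)"
    proof (rule tree_sum_le_add)
      fix d
      show "r d \<le> a * (1 / real d) + dvd_prob Q d"
        using a(2)[of d] dvd_prob_nonneg[of P d] dvd_prob_nonneg[of Q d] by (simp add: r_def)
    qed simp
    also have "tree_sum t 4 ps 0 1 (\<lambda>d. 1 / real d) \<le> 1 / real 1 * (\<Prod>p\<in>set ps. 1 + 8 * 4 / real p)"
      using ps by (intro tree_sum_le_prod q1) auto
    also have "tree_sum t 4 ps 0 1 (dvd_prob Q) \<le> dvd_prob Q 1 * (\<Prod>p\<in>set ps. 1 + 8 * 4 / real p)"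
      using ps by (intro tree_sum_le_prod Q) auto
    also have "dvd_prob Q 1 = 1" by (simp add: dvd_prob_def)
    finally show "tree_sum t 4 ps 0 1 r \<le> (a + 1) * \<Pi>p"
      using a by (simp add: \<Pi>p_def distrib_right mult_left_mono)
  qed (use \<tau> in simp)
  ultimately have "T \<le> \<tau> / 2 * (\<Sum>d\<in>smooth_upto (set ps) (X 0). r d) + 1 / (2 * \<tau>) * ((a + 1) * \<Pi>p)"
    by (meson add_mono order_trans)
  then have "\<bar>measure_pmf.expectation P (\<lambda>n. F (exponents (set ps) n))
        - measure_pmf.expectation Q (\<lambda>n. F (exponents (set ps) n))\<bar>
      \<le> 2 * boundary_sum t ps 0 1 (dvd_prob Q) + 2 * (\<tau> / 2 * (\<Sum>d\<in>smooth_upto (set ps) (X 0). r d) + 1 / (2 * \<tau>) * ((a + 1) * \<Pi>p))"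
    by (intro order_trans[OF main] add_left_mono mult_left_mono) auto
  then show ?thesis by (simp add: r_def \<Pi>p_def)
qed

text \<open>Realising the independent exponents as a random integer lets
  \<open>tree_expansion_error\<close> apply to the model and to the actual integers alike.\<close>

definition prime_model :: "nat set \<Rightarrow> (nat \<Rightarrow> real) \<Rightarrow> nat pmf" where
  "prime_model U e = map_pmf (\<lambda>z. \<Prod>q\<in>U. q ^ z q) (Pi_pmf U 0 (\<lambda>q. inflated_geometric (e q) q))"

section \<open>Divisor probabilities of the model\<close>

lemma multiplicity_prod_prime_powers_in:
  assumes "finite U" "\<And>q. q \<in> U \<Longrightarrow> prime (q::nat)" "p \<in> U"
  shows "multiplicity p (\<Prod>q\<in>U. q ^ z q) = z p"
  using multiplicity_prod_prime_powers[OF assms(1), of p z] assms by auto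

lemma expectation_prime_model:
  fixes F :: "(nat \<Rightarrow> nat) \<Rightarrow> real"
  assumes "finite U" "\<And>q. q \<in> U \<Longrightarrow> prime q"
  shows "measure_pmf.expectation (prime_model U e) (\<lambda>n. F (exponents U n))
       = measure_pmf.expectation (Pi_pmf U 0 (\<lambda>q. inflated_geometric (e q) q)) F"
proof -
  have "measure_pmf.expectation (prime_model U e) (\<lambda>n. F (exponents U n))
     = measure_pmf.expectation (Pi_pmf U 0 (\<lambda>q. inflated_geometric (e q) q)) (\<lambda>z. F (exponents U (\<Prod>q\<in>U. q ^ z q)))"
    by (simp add: prime_model_def)
  also have "\<dots> = measure_pmf.expectation (Pi_pmf U 0 (\<lambda>q. inflated_geometric (e q) q)) F"
  proof (rule integral_cong_AE)
    show "AE z in Pi_pmf U 0 (\<lambda>q. inflated_geometric (e q) q). F (exponents U (\<Prod>q\<in>U. q ^ z q)) = F z"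
      unfolding AE_measure_pmf_iff
    proof
      fix z assume "z \<in> set_pmf (Pi_pmf U 0 (\<lambda>q. inflated_geometric (e q) q))"
      then have "z \<in> {f. \<forall>x. x \<notin> U \<longrightarrow> f x = 0}" by (rule subsetD[OF set_Pi_pmf_subset[OF assms(1)]])
      then have z: "z q = 0" if "q \<notin> U" for q using that by simp
      have "exponents U (\<Prod>q\<in>U. q ^ z q) = z"
      proof
        fix q
        show "exponents U (\<Prod>q\<in>U. q ^ z q) q = z q"
        proof (cases "q \<in> U")
          case True
          have "multiplicity q (\<Prod>q\<in>U. q ^ z q) = z q"
            using assms(1) _ True by (rule multiplicity_prod_prime_powers_in) (rule assms(2))
          then show ?thesis using True by (simp add: exponents_def)
        qed (simp add: exponents_def z)
      qed
      then show "F (exponents U (\<Prod>q\<in>U. q ^ z q)) = F z" by simp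
    qed
  qed auto
  finally show ?thesis .
qed

lemma zero_notin_prime_model:
  assumes "finite U" "\<And>q. q \<in> U \<Longrightarrow> prime q"
  shows "0 \<notin> set_pmf (prime_model U e)"
  using assms(1) assms(2)[of 0] by (auto simp: prime_model_def)

text \<open>The probability that the exponent of \<open>q\<close> is at least \<open>i\<close> in
  the model.\<close>

definition local_tail :: "(nat \<Rightarrow> real) \<Rightarrow> nat \<Rightarrow> nat \<Rightarrow> real" where
  "local_tail e q i = (if i = 0 then 1 else e q / real q ^ (i - 1))"

lemma dvd_prob_prime_model:
  assumes U: "finite U" "\<And>q. q \<in> U \<Longrightarrow> prime q" and e: "\<And>q. 0 \<le> e q \<and> e q \<le> 1" and d: "d > 0"
  shows "dvd_prob (prime_model U e) d =
     (if prime_factors d \<subseteq> U then \<Prod>q\<in>U. local_tail e q (multiplicity q d) else 0)"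
proof -
  let ?N = "\<lambda>z. \<Prod>q\<in>U. q ^ z q"
  have N0: "?N z \<noteq> 0" for z using U(1) U(2)[of 0] by auto
  have Nz: "multiplicity q (?N z) = z q" if "q \<in> U" for q z
    using U(1) _ that by (rule multiplicity_prod_prime_powers_in) (rule U(2))
  have pr: "dvd_prob (prime_model U e) d = measure_pmf.prob (Pi_pmf U 0 (\<lambda>q. inflated_geometric (e q) q)) {z. d dvd ?N z}"
    by (simp add: dvd_prob_def prime_model_def vimage_def)
  show ?thesis
  proof (cases "prime_factors d \<subseteq> U")
    case False
    then obtain p where p: "p \<in> prime_factors d" "p \<notin> U" by auto
    have "\<not> d dvd ?N z" for z
    proof
      assume "d dvd ?N z"
      then have "p dvd ?N z" using p by (auto dest: in_prime_factors_imp_dvd intro: dvd_trans)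
      then obtain q where q: "q \<in> U" "p dvd q ^ z q"
        using prime_dvd_prod_iff[OF U(1), of p "\<lambda>q. q ^ z q"] p in_prime_factors_imp_prime[of p d] by blast
      have pp: "prime p" using p(1) by (rule in_prime_factors_imp_prime)
      have "p = q" using primes_dvd_imp_eq[OF pp U(2)[OF q(1)] prime_dvd_power[OF pp q(2)]] .
      then show False using p q by simp
    qed
    then show ?thesis using False pr by simp
  next
    case True
    have "d dvd ?N z \<longleftrightarrow> z \<in> Pi U (\<lambda>q. {multiplicity q d..})" for z
    proof
      assume "d dvd ?N z"
      then have le: "multiplicity q d \<le> multiplicity q (?N z)" for q
        using N0 by (intro dvd_imp_multiplicity_le) auto
      show "z \<in> Pi U (\<lambda>q. {multiplicity q d..})"
      proof (rule Pi_I)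
        fix q assume "q \<in> U"
        then show "z q \<in> {multiplicity q d..}" using le[of q] Nz[of q z] by simp
      qed
    next
      assume z: "z \<in> Pi U (\<lambda>q. {multiplicity q d..})"
      show "d dvd ?N z"
      proof (rule multiplicity_le_imp_dvd)
        fix p :: nat assume p: "prime p"
        show "multiplicity p d \<le> multiplicity p (?N z)"
        proof (cases "p \<in> U")
          case True
          then show ?thesis using z Nz[OF True, of z] by (auto simp: Pi_def)
        next
          case False
          then have "p \<notin> prime_factors d" using True by auto
          then have "\<not> p dvd d" using p d by (auto simp: in_prime_factors_iff)
          then show ?thesis by (simp add: not_dvd_imp_multiplicity_0)
        qed
      qed (use d in auto)
    qed
    then have "{z. d dvd ?N z} = Pi U (\<lambda>q. {multiplicity q d..})" by auto
    then have "dvd_prob (prime_model U e) d = (\<Prod>q\<in>U. measure_pmf.prob (inflated_geometric (e q) q) {multiplicity q d..})"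
      using U(1) pr by (simp add: measure_Pi_pmf_Pi)
    also have "\<dots> = (\<Prod>q\<in>U. local_tail e q (multiplicity q d))"
    proof (rule prod.cong[OF refl])
      fix q assume "q \<in> U"
      then have "q \<ge> 2" using U prime_ge_2_nat by blast
      then show "measure_pmf.prob (inflated_geometric (e q) q) {multiplicity q d..} = local_tail e q (multiplicity q d)"
        using e[of q] prob_inflated_geometric_ge[of "e q" q "multiplicity q d - 1"]
        by (cases "multiplicity q d") (auto simp: local_tail_def)
    qed
    finally show ?thesis using True by simp
  qed
qed

lemma quasi_multiplicative_prime_model:
  assumes U: "finite U" "\<And>q. q \<in> U \<Longrightarrow> prime q" and e: "\<And>q. 0 \<le> e q \<and> e q \<le> 1"
    and e2: "\<And>q. q \<in> U \<Longrightarrow> e q \<le> 2 / real q"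
  shows "quasi_multiplicative (dvd_prob (prime_model U e))"
  unfolding quasi_multiplicative_def
proof (intro conjI allI impI)
  fix m p i :: nat assume p: "prime p" "coprime m p" and i: "i \<ge> 1"
  have m: "m > 0" using p by (cases "m = 0") auto
  have p0: "p > 0" "real p > 0" using p prime_gt_0_nat by auto
  have lt0: "local_tail e q j \<ge> 0" for q j using e[of q] by (simp add: local_tail_def)
  show "dvd_prob (prime_model U e) (m * p ^ i) \<le> dvd_prob (prime_model U e) m * (2 / real p ^ i)"
  proof (cases "prime_factors (m * p ^ i) \<subseteq> U")
    case False
    then have "dvd_prob (prime_model U e) (m * p ^ i) = 0"
      using dvd_prob_prime_model[OF U e, of "m * p ^ i"] m p0 by simp
    then show ?thesis using dvd_prob_nonneg by simp
  next
    case True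
    have pf: "prime_factors (m * p ^ i) = prime_factors m \<union> prime_factors (p ^ i)"
      using m p0 by (intro prime_factors_product) auto
    have "p \<in> prime_factors (p ^ i)" using p i p0 by (auto simp: in_prime_factors_iff)
    then have pU: "p \<in> U" "prime_factors m \<subseteq> U" using True pf by auto
    have npm: "\<not> p dvd m" using coprime_common_divisor[OF p(2), of p] p(1) by auto
    have mp: "multiplicity p (m * p ^ i) = i"
      using p m p0 npm by (subst prime_elem_multiplicity_mult_distrib) (auto simp: not_dvd_imp_multiplicity_0)
    have mq: "multiplicity q (m * p ^ i) = multiplicity q m" if "q \<in> U" "q \<noteq> p" for q
    proof -
      have "multiplicity q (m * p ^ i) = multiplicity q m + multiplicity q (p ^ i)"
        using U that m p0 by (intro prime_elem_multiplicity_mult_distrib) auto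
      moreover have "\<not> q dvd p ^ i"
      proof
        assume "q dvd p ^ i"
        then have "q dvd p" by (rule prime_dvd_power[OF U(2)[OF that(1)]])
        then show False using primes_dvd_imp_eq[OF U(2)[OF that(1)] p(1)] that(2) by simp
      qed
      ultimately show ?thesis by (simp add: not_dvd_imp_multiplicity_0)
    qed
    define R where "R = (\<Prod>q\<in>U - {p}. local_tail e q (multiplicity q m))"
    have R0: "R \<ge> 0" unfolding R_def by (intro prod_nonneg) (use lt0 in auto)
    have "dvd_prob (prime_model U e) (m * p ^ i) = (\<Prod>q\<in>U. local_tail e q (multiplicity q (m * p ^ i)))"
      using dvd_prob_prime_model[OF U e, of "m * p ^ i"] m p0 True by simp
    also have "\<dots> = local_tail e p i * R"
      unfolding R_def using U pU by (subst prod.remove[of U p]) (auto simp: mp mq)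
    also have "\<dots> \<le> 2 / real p ^ i * R"
    proof (rule mult_right_mono[OF _ R0])
      have "local_tail e p i = e p / real p ^ (i - 1)" using i by (simp add: local_tail_def)
      also have "\<dots> \<le> (2 / real p) / real p ^ (i - 1)" using e2[OF pU(1)] p0 by (intro divide_right_mono) auto
      also have "\<dots> = 2 / real p ^ i" using i by (cases i) auto
      finally show "local_tail e p i \<le> 2 / real p ^ i" .
    qed
    also have "R = dvd_prob (prime_model U e) m"
    proof -
      have "dvd_prob (prime_model U e) m = local_tail e p (multiplicity p m) * R"
        unfolding R_def using dvd_prob_prime_model[OF U e m] U pU by (subst prod.remove[of U p, symmetric]) auto
      then show ?thesis using npm by (simp add: not_dvd_imp_multiplicity_0 local_tail_def)
    qed
    finally show ?thesis by (simp add: mult.commute)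
  qed
qed (rule dvd_prob_nonneg)

lemma dvd_prob_prime_model_integers:
  assumes U: "finite U" "\<And>q. q \<in> U \<Longrightarrow> prime q" and d: "d > 0" "prime_factors d \<subseteq> U"
  shows "dvd_prob (prime_model U (\<lambda>q. 1 / real q)) d = 1 / real d"
proof -
  have "dvd_prob (prime_model U (\<lambda>q. 1 / real q)) d = (\<Prod>q\<in>U. local_tail (\<lambda>q. 1 / real q) q (multiplicity q d))"
  proof -
    have "0 \<le> 1 / real q \<and> 1 / real q \<le> 1" for q by (cases q) auto
    from dvd_prob_prime_model[OF U this d(1)] show ?thesis using d by simp
  qed
  also have "\<dots> = (\<Prod>q\<in>U. 1 / real q ^ multiplicity q d)"
    by (intro prod.cong refl) (auto simp: local_tail_def power_eq_if)
  also have "\<dots> = (\<Prod>q\<in>prime_factors d. 1 / real q ^ multiplicity q d)"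
    using U d by (intro prod.mono_neutral_right) (auto simp: in_prime_factors_iff not_dvd_imp_multiplicity_0)
  also have "\<dots> = 1 / real (\<Prod>q\<in>prime_factors d. q ^ multiplicity q d)"
    by (simp add: prod_dividef)
  also have "(\<Prod>q\<in>prime_factors d. q ^ multiplicity q d) = d"
    using prime_factorization_nat[of d] d by simp
  finally show ?thesis .
qed

text \<open>By independence the Euler factors multiply to the main term of Hypothesis Z exactly.
  Setting the probability to 0 at primes dividing \<open>a\<close> reproduces the restriction to
  moduli coprime to \<open>a\<close>.\<close>

lemma dvd_prob_prime_model_shifted:
  fixes a :: int
  assumes U: "finite U" "\<And>q. q \<in> U \<Longrightarrow> prime q" and d: "d > 0" "prime_factors d \<subseteq> U"
  shows "dvd_prob (prime_model U (\<lambda>q. if q \<ge> 2 \<and> \<not> int q dvd a then 1 / (real q - 1) else 0)) d =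
     (if coprime (int d) a then 1 / real (totient d) else 0)"
proof -
  define e where "e = (\<lambda>q::nat. if q \<ge> 2 \<and> \<not> int q dvd a then 1 / (real q - 1) else 0)"
  have e: "0 \<le> e q \<and> e q \<le> 1" for q by (auto simp: e_def field_simps)
  have cop: "coprime (int d) a \<longleftrightarrow> (\<forall>q\<in>prime_factors d. \<not> int q dvd a)"
  proof
    assume c: "coprime (int d) a"
    show "\<forall>q\<in>prime_factors d. \<not> int q dvd a"
    proof
      fix q assume q: "q \<in> prime_factors d"
      then have "int q dvd int d" "prime q" by (auto simp: in_prime_factors_iff)
      then show "\<not> int q dvd a" using coprime_common_divisor[OF c, of "int q"] by auto
    qed
  next
    assume n: "\<forall>q\<in>prime_factors d. \<not> int q dvd a"
    show "coprime (int d) a"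
    proof (rule ccontr)
      assume "\<not> coprime (int d) a"
      then have "gcd (int d) a \<noteq> 1" by (simp add: coprime_iff_gcd_eq_1)
      then have "nat (gcd (int d) a) \<noteq> 1" by linarith
      then obtain q where q: "prime q" "q dvd nat (gcd (int d) a)" using prime_factor_nat by blast
      have "int q dvd int (nat (gcd (int d) a))" using q(2) by (simp only: int_dvd_int_iff)
      then have "int q dvd int d" "int q dvd a" by auto
      then have "q \<in> prime_factors d" using q d by (auto simp: in_prime_factors_iff)
      then show False using n \<open>int q dvd a\<close> by auto
    qed
  qed
  have "dvd_prob (prime_model U e) d = (\<Prod>q\<in>U. local_tail e q (multiplicity q d))"
    using dvd_prob_prime_model[OF U e d(1)] d by simp
  also have "\<dots> = (\<Prod>q\<in>prime_factors d. local_tail e q (multiplicity q d))"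
    using U d by (intro prod.mono_neutral_right) (auto simp: in_prime_factors_iff not_dvd_imp_multiplicity_0 local_tail_def)
  also have "\<dots> = (\<Prod>q\<in>prime_factors d. e q / real q ^ (multiplicity q d - 1))"
  proof (rule prod.cong[OF refl])
    fix q assume "q \<in> prime_factors d"
    then have "multiplicity q d > 0" using d by (auto simp: prime_multiplicity_gt_zero_iff in_prime_factors_iff)
    then show "local_tail e q (multiplicity q d) = e q / real q ^ (multiplicity q d - 1)" by (simp add: local_tail_def)
  qed
  also have "\<dots> = (if coprime (int d) a then 1 / real (totient d) else 0)"
  proof (cases "coprime (int d) a")
    case True
    have "(\<Prod>q\<in>prime_factors d. e q / real q ^ (multiplicity q d - 1))
       = (\<Prod>q\<in>prime_factors d. 1 / real (q ^ (multiplicity q d - 1) * (q - 1)))"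
    proof (rule prod.cong[OF refl])
      fix q assume q: "q \<in> prime_factors d"
      then have "q \<ge> 2" "\<not> int q dvd a" using True cop prime_ge_2_nat by (auto simp: in_prime_factors_iff)
      then show "e q / real q ^ (multiplicity q d - 1) = 1 / real (q ^ (multiplicity q d - 1) * (q - 1))"
        by (simp add: e_def of_nat_diff mult.commute)
    qed
    also have "\<dots> = 1 / real (\<Prod>q\<in>prime_factors d. q ^ (multiplicity q d - 1) * (q - 1))"
      by (simp only: prod_dividef of_nat_prod prod_constant power_one)
    also have "(\<Prod>q\<in>prime_factors d. q ^ (multiplicity q d - 1) * (q - 1)) = totient d"
      using d totient_formula1[of d] by simp
    finally show ?thesis using True by simp
  next
    case False
    then obtain q where "q \<in> prime_factors d" "int q dvd a" using cop by auto
    then have "(\<Prod>q\<in>prime_factors d. e q / real q ^ (multiplicity q d - 1)) = 0"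
      by (intro prod_zero) (auto simp: e_def)
    then show ?thesis using False by simp
  qed
  finally show ?thesis unfolding e_def .
qed

lemma smooth_upto_mono: "X \<le> Y \<Longrightarrow> smooth_upto S X \<subseteq> smooth_upto S Y"
  by (auto simp: smooth_upto_def)

lemma card_smooth_upto_le:
  assumes "X \<ge> 0"
  shows "real (card (smooth_upto S X)) \<le> X"
proof -
  have "smooth_upto S X \<subseteq> {1..nat \<lfloor>X\<rfloor>}" by (auto simp: smooth_upto_def le_nat_floor)
  then have "card (smooth_upto S X) \<le> nat \<lfloor>X\<rfloor>" using card_mono[of "{1..nat \<lfloor>X\<rfloor>}"] by simp
  then show ?thesis using assms by linarith
qed

text \<open>\<open>P\<close> enters through two bounds only: a pointwise one that may lose a
  logarithm, and the total remainder up to level x^\<beta>. The latter must save 2A + 129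
  logarithms, of which A + 129 are spent as \<tau>.\<close>

lemma kubilius_asymptotic:
  fixes \<alpha> \<beta> A :: real
  assumes "0 < \<alpha>" "\<alpha> < \<beta>" "A > 0"
  shows "\<exists>C U0 X0. C \<ge> 0 \<and> (\<forall>x y U P e E0 (F :: (nat \<Rightarrow> nat) \<Rightarrow> real).
     X0 \<le> x \<longrightarrow> 2 \<le> y \<longrightarrow> y \<le> x \<longrightarrow> U0 \<le> ln x / ln y \<longrightarrow>
     finite U \<longrightarrow> (\<forall>q\<in>U. prime q \<and> real q \<le> y) \<longrightarrow> 0 \<notin> set_pmf P \<longrightarrow>
     (\<forall>q. 0 \<le> e q \<and> e q \<le> 1) \<longrightarrow> (\<forall>q\<in>U. e q \<le> 2 / real q) \<longrightarrow>
     (\<forall>d. dvd_prob P d \<le> 32 * ln x * (1 / real d)) \<longrightarrow> (\<forall>v. \<bar>F v\<bar> \<le> 1) \<longrightarrow> E0 \<ge> 0 \<longrightarrow>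
     (\<Sum>d\<in>smooth_upto U (x powr \<beta>). \<bar>dvd_prob P d - dvd_prob (prime_model U e) d\<bar>)
       \<le> E0 / (ln x) powr (2 * A + 129) \<longrightarrow>
     \<bar>measure_pmf.expectation P (\<lambda>n. F (exponents U n))
        - measure_pmf.expectation (Pi_pmf U 0 (\<lambda>q. inflated_geometric (e q) q)) F\<bar>
     \<le> (C + E0) * (exp (- \<alpha> * (ln x / ln y) * ln (ln x / ln y)) + 1 / (ln x) powr A))"
proof -
  obtain C1 U1 X1 where C1: "C1 \<ge> 0" and sieve: "\<forall>x y ps g. X1 \<le> x \<longrightarrow> 2 \<le> y \<longrightarrow> y \<le> x \<longrightarrow> U1 \<le> ln x / ln y \<longrightarrow>
     sorted_wrt (>) ps \<longrightarrow> (\<forall>p\<in>set ps. prime p \<and> real p \<le> y) \<longrightarrow>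
     quasi_multiplicative g \<longrightarrow> g 1 \<le> 1 \<longrightarrow>
     (\<exists>t N X. t N < 2 \<and> 0 < N \<and>
        (\<forall>k p. p \<in> set ps \<longrightarrow> real p \<le> t (Suc k) \<longrightarrow> real p * X (Suc k) \<le> X k) \<and>
        (\<forall>k p. p \<in> set ps \<longrightarrow> real p \<le> X k) \<and> (\<forall>k. 1 \<le> X k) \<and> X 0 \<le> x powr \<beta> \<and>
        boundary_sum t ps 0 1 g
          \<le> exp (- \<alpha> * (ln x / ln y) * ln (ln x / ln y)) + C1 / (ln x) powr A)"
    using sieve_parameters[OF assms] by (elim exE conjE) (rule that)
  define C where "C = 2 + 2 * C1 + 33 * exp 288"
  have C0: "C \<ge> 0" using C1 by (simp add: C_def)
  have main: "\<bar>measure_pmf.expectation P (\<lambda>n. F (exponents U n))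
        - measure_pmf.expectation (Pi_pmf U 0 (\<lambda>q. inflated_geometric (e q) q)) F\<bar>
     \<le> (C + E0) * (exp (- \<alpha> * (ln x / ln y) * ln (ln x / ln y)) + 1 / (ln x) powr A)"
    if x: "max X1 (exp 1) \<le> x" and y: "2 \<le> y" "y \<le> x" and u: "U1 \<le> ln x / ln y"
      and U: "finite U" "\<And>q. q \<in> U \<Longrightarrow> prime q \<and> real q \<le> y" and P: "0 \<notin> set_pmf P"
      and e: "\<And>q. 0 \<le> e q \<and> e q \<le> 1" "\<And>q. q \<in> U \<Longrightarrow> e q \<le> 2 / real q"
      and a: "\<And>d. dvd_prob P d \<le> 32 * ln x * (1 / real d)" and F: "\<And>v. \<bar>F v\<bar> \<le> 1" and E0: "E0 \<ge> 0"
      and r: "(\<Sum>d\<in>smooth_upto U (x powr \<beta>). \<bar>dvd_prob P d - dvd_prob (prime_model U e) d\<bar>)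
       \<le> E0 / (ln x) powr (2 * A + 129)"
    for x y U P e E0 and F :: "(nat \<Rightarrow> nat) \<Rightarrow> real"
  proof -
    define ps where "ps = rev (sorted_list_of_set U)"
    have ps: "set ps = U" "distinct ps" "sorted_wrt (>) ps"
      using U(1) strict_sorted_list_of_set[of U] by (auto simp: ps_def sorted_wrt_rev)
    have Uprime: "\<And>q. q \<in> U \<Longrightarrow> prime q" using U by auto
    define Q where "Q = prime_model U e"
    have Q: "0 \<notin> set_pmf Q" unfolding Q_def by (rule zero_notin_prime_model[OF U(1)]) (rule Uprime)
    have qm: "quasi_multiplicative (dvd_prob Q)"
      unfolding Q_def by (rule quasi_multiplicative_prime_model[OF U(1)]) (use Uprime e in auto)
    have lx: "ln x \<ge> 1"
    proof -
      have "exp 1 \<le> x" using x by simp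
      then show ?thesis using y by (subst ln_ge_iff) auto
    qed
    have Q1: "dvd_prob Q 1 \<le> 1" by (simp add: dvd_prob_def)
    obtain t N X where t: "t N < 2" "0 < N"
        and X: "\<And>k p. p \<in> set ps \<Longrightarrow> real p \<le> t (Suc k) \<Longrightarrow> real p * X (Suc k) \<le> X k"
          "\<And>k p. p \<in> set ps \<Longrightarrow> real p \<le> X k" "\<And>k. 1 \<le> X k" "X 0 \<le> x powr \<beta>"
        and bs: "boundary_sum t ps 0 1 (dvd_prob Q)
          \<le> exp (- \<alpha> * (ln x / ln y) * ln (ln x / ln y)) + C1 / (ln x) powr A"
    proof -
      have "\<forall>p\<in>set ps. prime p \<and> real p \<le> y" using U(2) ps(1) by auto
      moreover have "X1 \<le> x" using x by simp
      ultimately show ?thesis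
        using sieve[rule_format, of x y ps "dvd_prob Q"] y u ps(3) qm Q1 that by auto
    qed
    \<comment> \<open>The term with 1/\<tau> carries (log x)^128 from the product of the 1 + 32/p
      and one more logarithm from the pointwise bound; A are left over.\<close>
    define \<tau> where "\<tau> = (ln x) powr (A + 129)"
    have \<tau>: "\<tau> > 0" using lx by (simp add: \<tau>_def)
    define M where "M = exp (- \<alpha> * (ln x / ln y) * ln (ln x / ln y))"
    define L where "L = 1 / (ln x) powr A"
    have M0: "M \<ge> 0" "L \<ge> 0" by (auto simp: M_def L_def)
    have "\<bar>measure_pmf.expectation P (\<lambda>n. F (exponents (set ps) n))
        - measure_pmf.expectation Q (\<lambda>n. F (exponents (set ps) n))\<bar>
     \<le> 2 * boundary_sum t ps 0 1 (dvd_prob Q)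
       + \<tau> * (\<Sum>d\<in>smooth_upto (set ps) (X 0). \<bar>dvd_prob P d - dvd_prob Q d\<bar>)
       + (32 * ln x + 1) / \<tau> * (\<Prod>p\<in>set ps. 1 + 32 / real p)"
      by (rule kubilius_comparison[where t = t and N = N and X = X])
         (use P Q qm ps Uprime F t X a lx \<tau> in auto)
    also have "\<dots> \<le> 2 * (M + C1 * L) + E0 * L + 33 * exp 288 * L"
    proof (intro add_mono)
      show "2 * boundary_sum t ps 0 1 (dvd_prob Q) \<le> 2 * (M + C1 * L)" using bs by (simp add: M_def L_def)
      have "(\<Sum>d\<in>smooth_upto (set ps) (X 0). \<bar>dvd_prob P d - dvd_prob Q d\<bar>)
          \<le> (\<Sum>d\<in>smooth_upto U (x powr \<beta>). \<bar>dvd_prob P d - dvd_prob Q d\<bar>)"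
        unfolding ps(1) using X(4) by (intro sum_mono2 finite_smooth_upto smooth_upto_mono) auto
      also have "\<dots> \<le> E0 / (ln x) powr (2 * A + 129)" using r by (simp add: Q_def)
      finally have "\<tau> * (\<Sum>d\<in>smooth_upto (set ps) (X 0). \<bar>dvd_prob P d - dvd_prob Q d\<bar>)
          \<le> \<tau> * (E0 / (ln x) powr (2 * A + 129))" using \<tau> by (intro mult_left_mono) auto
      also have "\<dots> = E0 * ((ln x) powr (A + 129) / (ln x) powr (2 * A + 129))" by (simp add: \<tau>_def)
      also have "(ln x) powr (A + 129) / (ln x) powr (2 * A + 129) = L"
      proof -
        have "(ln x) powr (A + 129) / (ln x) powr (2 * A + 129) = (ln x) powr ((A + 129) - (2 * A + 129))"
          by (rule powr_diff[symmetric])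
        also have "(A + 129) - (2 * A + 129) = - A" by simp
        finally show ?thesis by (simp only: L_def powr_minus_divide)
      qed
      finally show "\<tau> * (\<Sum>d\<in>smooth_upto (set ps) (X 0). \<bar>dvd_prob P d - dvd_prob Q d\<bar>) \<le> E0 * L" .
      have "(\<Prod>p\<in>set ps. 1 + 32 / real p) \<le> exp (9 * 32) * (ln y) powr (4 * 32)"
        using y U(2) ps(1) by (intro prod_primes_le_exp_all) auto
      also have "\<dots> \<le> exp 288 * (ln x) powr 128" using y by (auto intro!: powr_mono2)
      finally have pr: "(\<Prod>p\<in>set ps. 1 + 32 / real p) \<le> exp 288 * (ln x) powr 128" .
      have "(32 * ln x + 1) / \<tau> * (\<Prod>p\<in>set ps. 1 + 32 / real p)
          \<le> (33 * (ln x) powr 1) / \<tau> * (exp 288 * (ln x) powr 128)"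
        using lx \<tau> pr by (intro mult_mono divide_right_mono prod_nonneg) auto
      also have "\<dots> = 33 * exp 288 * ((ln x) powr 1 * (ln x) powr 128 / (ln x) powr (A + 129))"
        by (simp only: \<tau>_def) simp
      also have "(ln x) powr 1 * (ln x) powr 128 / (ln x) powr (A + 129) = L"
      proof -
        have "(ln x) powr 1 * (ln x) powr 128 / (ln x) powr (A + 129) = (ln x) powr ((1 + 128) - (A + 129))"
          by (simp only: powr_diff powr_add)
        also have "(1 + 128) - (A + 129) = - A" by simp
        finally show ?thesis by (simp only: L_def powr_minus_divide)
      qed
      finally show "(32 * ln x + 1) / \<tau> * (\<Prod>p\<in>set ps. 1 + 32 / real p) \<le> 33 * exp 288 * L" .
    qed
    also have "\<dots> \<le> (C + E0) * (M + L)"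
    proof -
      have "(C + E0) * (M + L) = 2 * M + 2 * C1 * L + E0 * L + 33 * exp 288 * L
         + (2 * C1 * M + 33 * exp 288 * M + E0 * M + 2 * L)"
        by (simp add: C_def algebra_simps)
      moreover have "0 \<le> 2 * C1 * M + 33 * exp 288 * M + E0 * M + 2 * L"
        using C1 E0 M0 by (intro add_nonneg_nonneg mult_nonneg_nonneg) auto
      moreover have "2 * (M + C1 * L) = 2 * M + 2 * C1 * L" by simp
      ultimately show ?thesis by linarith
    qed
    also have "measure_pmf.expectation Q (\<lambda>n. F (exponents (set ps) n))
        = measure_pmf.expectation (Pi_pmf U 0 (\<lambda>q. inflated_geometric (e q) q)) F"
      unfolding Q_def ps(1) by (rule expectation_prime_model[OF U(1)]) (rule Uprime)
    finally show ?thesis by (simp only: ps(1) M_def L_def)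
  qed
  show ?thesis
    by (intro exI[of _ C] exI[of _ U1] exI[of _ "max X1 (exp 1)"] conjI allI impI C0 main) auto
qed

section \<open>Uniform integers as input of the comparison\<close>

lemma card_multiples:
  assumes "d > 0"
  shows "card {n \<in> {1..N}. d dvd n} = N div d"
proof -
  have "{n \<in> {1..N}. d dvd n} = (\<lambda>k. d * k) ` {1..N div d}"
  proof (intro set_eqI iffI)
    fix n assume "n \<in> {n \<in> {1..N}. d dvd n}"
    then obtain k where k: "n = d * k" "1 \<le> n" "n \<le> N" by (auto elim: dvdE)
    then have "k \<le> N div d" using assms by (simp add: less_eq_div_iff_mult_less_eq mult.commute)
    then show "n \<in> (\<lambda>k. d * k) ` {1..N div d}" using k by (cases "k = 0") auto
  next
    fix n assume "n \<in> (\<lambda>k. d * k) ` {1..N div d}"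
    then obtain k where "k \<in> {1..N div d}" and k: "n = d * k" by blast
    then have "1 \<le> k" "k \<le> N div d" by auto
    moreover from this have "d * k \<le> N" using assms by (simp add: less_eq_div_iff_mult_less_eq mult.commute)
    ultimately show "n \<in> {n \<in> {1..N}. d dvd n}" using k assms by auto
  qed
  then show ?thesis using assms by (simp add: card_image inj_on_def)
qed

lemma dvd_prob_uniform:
  assumes "N > 0" "d > 0"
  shows "dvd_prob (pmf_of_set {1..N}) d = real (N div d) / real N"
proof -
  have "{1..N} \<inter> {n. d dvd n} = {n \<in> {1..N}. d dvd n}" by auto
  then show ?thesis using assms card_multiples[of d N] by (simp add: dvd_prob_def measure_pmf_of_set)
qed

lemma dvd_prob_uniform_error:
  assumes "N > 0" "d > 0"
  shows "dvd_prob (pmf_of_set {1..N}) d \<le> 1 / real d"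
    "\<bar>dvd_prob (pmf_of_set {1..N}) d - 1 / real d\<bar> \<le> 1 / real N"
proof -
  have le: "real (N div d) \<le> real N / real d" by (rule of_nat_div_le_of_nat)
  have ge: "real N / real d - 1 \<le> real (N div d)"
    using floor_divide_of_nat_eq[of N d] by (metis diff_le_eq floor_of_nat less_eq_real_def of_int_of_nat_eq real_of_int_floor_add_one_ge)
  have N: "real N / real d / real N = 1 / real d" using assms by simp
  show "dvd_prob (pmf_of_set {1..N}) d \<le> 1 / real d"
    unfolding dvd_prob_uniform[OF assms] N[symmetric] using le by (rule divide_right_mono) simp
  have "(real N / real d - 1) / real N \<le> real (N div d) / real N" using ge by (rule divide_right_mono) simp
  then have "1 / real d - 1 / real N \<le> real (N div d) / real N" using assms(1) by (simp add: diff_divide_distrib N)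
  moreover have "real (N div d) / real N \<le> 1 / real d"
    unfolding N[symmetric] using le by (rule divide_right_mono) simp
  ultimately show "\<bar>dvd_prob (pmf_of_set {1..N}) d - 1 / real d\<bar> \<le> 1 / real N"
    unfolding dvd_prob_uniform[OF assms] by (simp add: abs_le_iff)
qed

text \<open>Each modulus has a rounding error of at most 1/N, there are at most x^\<beta> moduli,
  and N \<ge> x/2.\<close>

lemma integers_level:
  fixes x \<beta> :: real
  assumes x: "x \<ge> 2" and U: "finite U" "\<And>q. q \<in> U \<Longrightarrow> prime q"
  shows "(\<Sum>d\<in>smooth_upto U (x powr \<beta>).
      \<bar>dvd_prob (pmf_of_set {1..nat \<lfloor>x\<rfloor>}) d - dvd_prob (prime_model U (\<lambda>q. 1 / real q)) d\<bar>) \<le> 2 * x powr (\<beta> - 1)"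
proof -
  define N where "N = nat \<lfloor>x\<rfloor>"
  have N: "N > 0" "real N \<ge> x / 2" using x unfolding N_def by linarith+
  have "(\<Sum>d\<in>smooth_upto U (x powr \<beta>). \<bar>dvd_prob (pmf_of_set {1..N}) d - dvd_prob (prime_model U (\<lambda>q. 1 / real q)) d\<bar>)
     \<le> (\<Sum>d\<in>smooth_upto U (x powr \<beta>). 1 / real N)"
  proof (rule sum_mono)
    fix d assume "d \<in> smooth_upto U (x powr \<beta>)"
    then have d: "d > 0" "prime_factors d \<subseteq> U" by (auto simp: smooth_upto_def)
    have "dvd_prob (prime_model U (\<lambda>q. 1 / real q)) d = 1 / real d"
      using U(1) _ d by (rule dvd_prob_prime_model_integers) (rule U(2))
    then show "\<bar>dvd_prob (pmf_of_set {1..N}) d - dvd_prob (prime_model U (\<lambda>q. 1 / real q)) d\<bar> \<le> 1 / real N"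
      using dvd_prob_uniform_error(2)[OF N(1) d(1)] by simp
  qed
  also have "\<dots> = real (card (smooth_upto U (x powr \<beta>))) / real N" by simp
  also have "\<dots> \<le> x powr \<beta> / (x / 2)"
    using N x by (intro frac_le card_smooth_upto_le) auto
  also have "\<dots> = 2 * x powr (\<beta> - 1)" using x by (simp add: powr_diff)
  finally show ?thesis unfolding N_def .
qed

section \<open>Shifted primes as input of the comparison\<close>

definition shifted_prime_range :: "int \<Rightarrow> real \<Rightarrow> nat set" where
  "shifted_prime_range a x = {p::nat. prime p \<and> \<bar>a\<bar> + 1 < int p \<and> real p \<le> x}"

definition shifted_primes :: "int \<Rightarrow> real \<Rightarrow> nat pmf" where
  "shifted_primes a x = map_pmf (\<lambda>p. nat (int p + a)) (pmf_of_set (shifted_prime_range a x))"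

lemma finite_shifted_prime_range: "finite (shifted_prime_range a x)"
  by (rule finite_subset[OF _ finite_primes_real_le[of x]]) (auto simp: shifted_prime_range_def)

lemma shifted_prime_pos: "p \<in> shifted_prime_range a x \<Longrightarrow> int p + a > 1"
  by (auto simp: shifted_prime_range_def)

lemma card_prime_filter_le:
  fixes a :: int and x :: real
  defines "S \<equiv> shifted_prime_range a x"
  shows "real (card {p \<in> S. Q p}) \<le> real (card {p::nat. prime p \<and> real p \<le> x \<and> Q p})"
    "real (card {p::nat. prime p \<and> real p \<le> x \<and> Q p}) \<le> real (card {p \<in> S. Q p}) + (\<bar>of_int a\<bar> + 1)"
proof -
  have fin: "finite {p::nat. prime p \<and> real p \<le> x \<and> Q p}"
    by (rule finite_subset[OF _ finite_primes_real_le[of x]]) auto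
  have fS: "finite {p \<in> S. Q p}" using finite_shifted_prime_range by (simp add: S_def)
  have "{p \<in> S. Q p} \<subseteq> {p::nat. prime p \<and> real p \<le> x \<and> Q p}" by (auto simp: S_def shifted_prime_range_def)
  then show "real (card {p \<in> S. Q p}) \<le> real (card {p::nat. prime p \<and> real p \<le> x \<and> Q p})"
    using fin by (simp add: card_mono)
  have "{p::nat. prime p \<and> real p \<le> x \<and> Q p} \<subseteq> {p \<in> S. Q p} \<union> {1..nat (\<bar>a\<bar> + 1)}"
    by (auto simp: S_def shifted_prime_range_def not_less le_nat_iff dest: prime_gt_0_nat intro: Suc_leI)
  then have "card {p::nat. prime p \<and> real p \<le> x \<and> Q p} \<le> card ({p \<in> S. Q p} \<union> {1..nat (\<bar>a\<bar> + 1)})"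
    using fS by (intro card_mono) auto
  also have "\<dots> \<le> card {p \<in> S. Q p} + card {1..nat (\<bar>a\<bar> + 1)}" by (rule card_Un_le)
  finally have "card {p::nat. prime p \<and> real p \<le> x \<and> Q p} \<le> card {p \<in> S. Q p} + nat (\<bar>a\<bar> + 1)" by simp
  then have "real (card {p::nat. prime p \<and> real p \<le> x \<and> Q p}) \<le> real (card {p \<in> S. Q p} + nat (\<bar>a\<bar> + 1))"
    by (simp only: of_nat_le_iff)
  then show "real (card {p::nat. prime p \<and> real p \<le> x \<and> Q p}) \<le> real (card {p \<in> S. Q p}) + (\<bar>of_int a\<bar> + 1)"
    by simp
qed

lemma dvd_prob_shifted:
  assumes "shifted_prime_range a x \<noteq> {}"
  shows "dvd_prob (shifted_primes a x) d =
     real (card {p \<in> shifted_prime_range a x. [int p = - a] (mod int d)}) / real (card (shifted_prime_range a x))"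
proof -
  have "shifted_prime_range a x \<inter> {p. d dvd nat (int p + a)} = {p \<in> shifted_prime_range a x. [int p = - a] (mod int d)}"
  proof -
    have "d dvd nat (int p + a) \<longleftrightarrow> [int p = - a] (mod int d)" if "p \<in> shifted_prime_range a x" for p
    proof -
      have "int (nat (int p + a)) = int p + a" using shifted_prime_pos[OF that] by simp
      then have "d dvd nat (int p + a) \<longleftrightarrow> int d dvd int p + a"
        using int_dvd_int_iff[of d "nat (int p + a)"] by simp
      then show ?thesis by (simp add: cong_iff_dvd_diff)
    qed
    then show ?thesis by auto
  qed
  then show ?thesis
    using assms finite_shifted_prime_range[of a x]
    by (simp add: dvd_prob_def shifted_primes_def vimage_def measure_pmf_of_set)
qed

lemma zero_notin_shifted_primes:
  assumes "shifted_prime_range a x \<noteq> {}"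
  shows "0 \<notin> set_pmf (shifted_primes a x)"
proof
  assume "0 \<in> set_pmf (shifted_primes a x)"
  then obtain p where p: "p \<in> shifted_prime_range a x" "nat (int p + a) = 0"
    using assms finite_shifted_prime_range[of a x] by (auto simp: shifted_primes_def)
  show False using shifted_prime_pos[OF p(1)] p(2) by simp
qed

text \<open>Forgetting primality, p + a runs through distinct multiples of d up to 2x. Dividing
  their number, at most 2x/d, by Chebyshev's lower bound loses one logarithm, which is affordable;
  no sieve bound is needed.\<close>

lemma dvd_prob_shifted_le:
  assumes x: "x \<ge> \<bar>of_int a\<bar>" "x \<ge> 2" and s: "real (card (shifted_prime_range a x)) \<ge> x / (16 * ln x)"
  shows "dvd_prob (shifted_primes a x) d \<le> 32 * ln x * (1 / real d)"
proof -
  define S where "S = shifted_prime_range a x"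
  have lx: "ln x > 0" using x by simp
  have "x / (16 * ln x) > 0" using x lx by simp
  then have s0: "real (card S) > 0" using s unfolding S_def by linarith
  then have ne: "S \<noteq> {}" by auto
  show ?thesis
  proof (cases "d = 0")
    case True
    have "{p \<in> S. [int p = - a] (mod int d)} = {}"
      using True by (auto simp: S_def cong_def dest!: shifted_prime_pos)
    then have "dvd_prob (shifted_primes a x) d = 0"
      unfolding dvd_prob_shifted[OF ne[unfolded S_def]] S_def by (simp only: card.empty of_nat_0 div_0)
    then show ?thesis using True by simp
  next
    case False
    define M where "M = nat \<lfloor>x + \<bar>of_int a\<bar>\<rfloor>"
    have M: "real M \<le> 2 * x" using x unfolding M_def by linarith
    have "(\<lambda>p. nat (int p + a)) ` {p \<in> S. [int p = - a] (mod int d)} \<subseteq> {n \<in> {1..M}. d dvd n}"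
    proof
      fix n assume "n \<in> (\<lambda>p. nat (int p + a)) ` {p \<in> S. [int p = - a] (mod int d)}"
      then obtain p where p: "p \<in> S" "[int p = - a] (mod int d)" "n = nat (int p + a)" by auto
      have pos: "int p + a > 1" using p(1) shifted_prime_pos by (simp add: S_def)
      have "int d dvd int p + a" using p(2) by (simp add: cong_iff_dvd_diff)
      moreover have n: "int n = int p + a" using p(3) pos by simp
      ultimately have "d dvd n" using int_dvd_int_iff[of d n] by simp
      moreover have "real p \<le> x" using p(1) by (simp add: S_def shifted_prime_range_def)
      then have "real n \<le> x + \<bar>of_int a\<bar>" using n by linarith
      then have "n \<le> M" unfolding M_def by (rule le_nat_floor)
      ultimately show "n \<in> {n \<in> {1..M}. d dvd n}" using n pos by auto
    qed
    then have "card ((\<lambda>p. nat (int p + a)) ` {p \<in> S. [int p = - a] (mod int d)}) \<le> card {n \<in> {1..M}. d dvd n}"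
      by (intro card_mono) auto
    also have "card {n \<in> {1..M}. d dvd n} = M div d" using False by (intro card_multiples) simp
    also have "card ((\<lambda>p. nat (int p + a)) ` {p \<in> S. [int p = - a] (mod int d)}) = card {p \<in> S. [int p = - a] (mod int d)}"
    proof (rule card_image, rule inj_onI)
      fix p q assume pq: "p \<in> {p \<in> S. [int p = - a] (mod int d)}" "q \<in> {p \<in> S. [int p = - a] (mod int d)}"
        "nat (int p + a) = nat (int q + a)"
      have "int p + a > 1" "int q + a > 1" using pq shifted_prime_pos by (auto simp: S_def)
      then show "p = q" using pq(3) by simp
    qed
    finally have "real (card {p \<in> S. [int p = - a] (mod int d)}) \<le> real (M div d)" by simp
    also have "\<dots> \<le> real M / real d" by (rule of_nat_div_le_of_nat)
    also have "\<dots> \<le> 2 * x / real d" using M by (rule divide_right_mono) simp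
    finally have c: "real (card {p \<in> S. [int p = - a] (mod int d)}) \<le> 2 * x / real d" .
    have "dvd_prob (shifted_primes a x) d \<le> (2 * x / real d) / (x / (16 * ln x))"
      unfolding dvd_prob_shifted[OF ne[unfolded S_def]] S_def[symmetric]
      using c s lx x by (intro frac_le) (auto simp: S_def)
    also have "\<dots> = 32 * ln x * (1 / real d)" using x lx by simp
    finally show ?thesis .
  qed
qed

lemma largest_prime_factor_le:
  assumes "prime_factors d \<subseteq> U" "\<And>q. q \<in> U \<Longrightarrow> real q \<le> y" "y \<ge> 0"
  shows "real (largest_prime_factor d) \<le> y"
proof (cases "d \<le> 1")
  case False
  have "prime_factors d \<noteq> {}" using False by (simp add: prime_factorization_empty_iff)
  then have "Max (prime_factors d) \<in> prime_factors d" by (intro Max_in) auto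
  then show ?thesis using False assms by (auto simp: largest_prime_factor_def)
qed (use assms in \<open>simp add: largest_prime_factor_def\<close>)

text \<open>A common factor of d and \<open>a\<close> that divides p + a also divides p, hence
  equals p. But p > |a| + 1 cannot divide the nonzero number \<open>a\<close>.\<close>

lemma dvd_prob_shifted_not_coprime:
  assumes ne: "shifted_prime_range a x \<noteq> {}" and "a \<noteq> 0" and d: "\<not> coprime (int d) a"
  shows "dvd_prob (shifted_primes a x) d = 0"
proof -
  have "{p \<in> shifted_prime_range a x. [int p = - a] (mod int d)} = {}"
  proof (rule ccontr)
    assume "\<not> ?thesis"
    then obtain p where p: "p \<in> shifted_prime_range a x" "[int p = - a] (mod int d)" by auto
    define g where "g = gcd (int d) a"
    have g: "g dvd int d" "g dvd a" "g \<ge> 0" "g \<noteq> 1" using d by (auto simp: g_def coprime_iff_gcd_eq_1)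
    have "int d dvd int p + a" using p(2) by (simp add: cong_iff_dvd_diff)
    then have "g dvd int p + a" using g(1) dvd_trans by blast
    then have "g dvd int p" using g(2) by (simp add: dvd_add_left_iff)
    moreover have "prime (int p)" using p(1) by (simp add: shifted_prime_range_def)
    ultimately have "g = int p" using g(3,4) by (auto simp: prime_int_iff)
    then have "int p \<le> \<bar>a\<bar>" using g(2) assms(2) dvd_imp_le_int[of a "int p"] by simp
    then show False using p(1) by (simp add: shifted_prime_range_def)
  qed
  then show ?thesis unfolding dvd_prob_shifted[OF ne] by (simp only: card.empty of_nat_0 div_0)
qed

text \<open>Leaving out the primes up to |a| + 1 changes both the count in the residue class and the
  expected count by at most |a| + 1 per modulus, which explains the second term. Dividing by the
  number of primes costs the factor 16 log x.\<close>

lemma shifted_primes_level: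
  fixes x y B C \<beta> \<delta> :: real and a :: int
  defines "e \<equiv> \<lambda>q. if q \<ge> 2 \<and> \<not> int q dvd a then 1 / (real q - 1) else 0"
  assumes x: "x \<ge> 2" and a: "a \<noteq> 0" and s: "real (card (shifted_prime_range a x)) \<ge> x / (16 * ln x)"
    and U: "finite U" "\<And>q. q \<in> U \<Longrightarrow> prime q \<and> real q \<le> x powr \<delta>"
    and Z: "(\<Sum>m | m \<ge> 1 \<and> real m \<le> x powr \<beta> \<and>
                real (largest_prime_factor m) \<le> x powr \<delta> \<and> coprime (int m) a.
            \<bar>real (prime_count_cong x m (- a)) - real (prime_count x) / real (totient m)\<bar>)
         \<le> C * (x / (ln x) powr B)"
  shows "(\<Sum>d\<in>smooth_upto U (x powr \<beta>). \<bar>dvd_prob (shifted_primes a x) d - dvd_prob (prime_model U e) d\<bar>)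
     \<le> 16 * ln x * (C / (ln x) powr B + 2 * (\<bar>of_int a\<bar> + 1) * x powr (\<beta> - 1))"
proof -
  define S where "S = shifted_prime_range a x"
  define s where "s = real (card S)"
  define b :: real where "b = \<bar>of_int a\<bar> + 1"
  have lx: "ln x > 0" using x by simp
  have "x / (16 * ln x) > 0" using x lx by simp
  then have s0: "s > 0" using s unfolding S_def s_def by linarith
  then have ne: "S \<noteq> {}" by (auto simp: s_def)
  define \<pi> where "\<pi> = real (prime_count x)"
  have \<pi>: "s \<le> \<pi>" "\<pi> \<le> s + b"
    using card_prime_filter_le[where a = a and x = x and Q = "\<lambda>_. True"] by (auto simp: s_def S_def \<pi>_def prime_count_def b_def)
  define D where "D = smooth_upto U (x powr \<beta>)"
  define D' where "D' = {d \<in> D. coprime (int d) a}"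
  have fD: "finite D" "finite D'" by (auto simp: D_def D'_def finite_smooth_upto)
  have b0: "b \<ge> 0" by (simp add: b_def)
  define err where "err = (\<lambda>d. \<bar>real (prime_count_cong x d (- a)) - \<pi> / real (totient d)\<bar>)"
  have model: "dvd_prob (prime_model U e) d = (if coprime (int d) a then 1 / real (totient d) else 0)" if "d \<in> D" for d
    unfolding e_def using that U by (intro dvd_prob_prime_model_shifted) (auto simp: D_def smooth_upto_def)
  have "(\<Sum>d\<in>D. \<bar>dvd_prob (shifted_primes a x) d - dvd_prob (prime_model U e) d\<bar>)
     = (\<Sum>d\<in>D'. \<bar>dvd_prob (shifted_primes a x) d - dvd_prob (prime_model U e) d\<bar>)"
  proof (rule sum.mono_neutral_right)
    show "\<forall>d\<in>D - D'. \<bar>dvd_prob (shifted_primes a x) d - dvd_prob (prime_model U e) d\<bar> = 0"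
      using model dvd_prob_shifted_not_coprime[OF ne[unfolded S_def] a] by (auto simp: D'_def)
  qed (use fD in \<open>auto simp: D'_def\<close>)
  also have "\<dots> \<le> (\<Sum>d\<in>D'. (err d + 2 * b) / s)"
  proof (rule sum_mono)
    fix d assume "d \<in> D'"
    then have d: "d \<in> D" "coprime (int d) a" "d \<ge> 1" by (auto simp: D'_def D_def smooth_upto_def)
    define c where "c = real (card {p \<in> S. [int p = - a] (mod int d)})"
    define f where "f = real (totient d)"
    have f: "f \<ge> 1" using d(3) by (simp add: f_def Suc_le_eq)
    have c: "c \<le> real (prime_count_cong x d (- a))" "real (prime_count_cong x d (- a)) \<le> c + b"
      using card_prime_filter_le[where a = a and x = x and Q = "\<lambda>p. [int p = - a] (mod int d)"]
      by (auto simp: c_def S_def prime_count_cong_def b_def)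
    have "b / f \<le> b / 1" using f b0 by (intro divide_left_mono) auto
    moreover have "\<pi> / f - s / f \<le> b / f" "0 \<le> \<pi> / f - s / f"
      using \<pi> f by (simp_all add: diff_divide_distrib[symmetric] divide_right_mono)
    ultimately have cs: "\<bar>c - s / f\<bar> \<le> err d + 2 * b"
      using c b0 unfolding err_def f_def[symmetric] by linarith
    have "\<bar>dvd_prob (shifted_primes a x) d - dvd_prob (prime_model U e) d\<bar> = \<bar>c / s - 1 / f\<bar>"
      using model[OF d(1)] d(2) dvd_prob_shifted[OF ne[unfolded S_def], of d] by (simp add: c_def s_def f_def S_def)
    also have "c / s - 1 / f = (c - s / f) / s" using s0 by (simp add: diff_divide_distrib)
    also have "\<bar>\<dots>\<bar> = \<bar>c - s / f\<bar> / s" using s0 by simp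
    also have "\<dots> \<le> (err d + 2 * b) / s" using cs s0 by (intro divide_right_mono) auto
    finally show "\<bar>dvd_prob (shifted_primes a x) d - dvd_prob (prime_model U e) d\<bar> \<le> (err d + 2 * b) / s" .
  qed
  also have "\<dots> = ((\<Sum>d\<in>D'. err d) + 2 * b * real (card D')) / s"
    by (simp add: sum_divide_distrib[symmetric] sum.distrib mult.commute)
  also have "\<dots> \<le> (C * (x / (ln x) powr B) + 2 * b * x powr \<beta>) / (x / (16 * ln x))"
  proof (rule frac_le)
    have "(\<Sum>d\<in>D'. err d) \<le> (\<Sum>m | m \<ge> 1 \<and> real m \<le> x powr \<beta> \<and>
                real (largest_prime_factor m) \<le> x powr \<delta> \<and> coprime (int m) a. err m)"
    proof (rule sum_mono2[OF finite_hypothesis_Z_moduli])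
      show "D' \<subseteq> {m. m \<ge> 1 \<and> real m \<le> x powr \<beta> \<and>
                real (largest_prime_factor m) \<le> x powr \<delta> \<and> coprime (int m) a}"
        using largest_prime_factor_le[of _ U "x powr \<delta>"] U(2) by (auto simp: D'_def D_def smooth_upto_def)
    qed (simp add: err_def)
    also have "\<dots> \<le> C * (x / (ln x) powr B)" using Z by (simp add: err_def \<pi>_def)
    finally have 1: "(\<Sum>d\<in>D'. err d) \<le> C * (x / (ln x) powr B)" .
    have "real (card D') \<le> real (card D)" using fD by (simp add: card_mono D'_def)
    also have "\<dots> \<le> x powr \<beta>" unfolding D_def by (rule card_smooth_upto_le) simp
    finally have "2 * b * real (card D') \<le> 2 * b * x powr \<beta>" using b0 by (intro mult_left_mono) auto
    with 1 show "(\<Sum>d\<in>D'. err d) + 2 * b * real (card D') \<le> C * (x / (ln x) powr B) + 2 * b * x powr \<beta>" by linarith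
    have "0 \<le> (\<Sum>d\<in>D'. err d)" by (intro sum_nonneg) (simp add: err_def)
    with 1 show "0 \<le> C * (x / (ln x) powr B) + 2 * b * x powr \<beta>" using b0 by (simp add: add_nonneg_nonneg)
    show "0 < x / (16 * ln x)" using x lx by simp
    show "x / (16 * ln x) \<le> s" using s by (simp add: s_def S_def)
  qed
  also have "\<dots> = 16 * ln x * (C / (ln x) powr B + 2 * b * x powr (\<beta> - 1))"
    using x lx by (simp add: powr_diff field_simps)
  finally show ?thesis by (simp add: D_def b_def)
qed

section \<open>Assembly: additive functions, eventual bounds and the final estimate\<close>

lemma small_omega_eq_sum:
  assumes "n > 0" "finite T" "\<And>p. p \<in> T \<Longrightarrow> prime p"
  shows "small_omega n T = (\<Sum>p\<in>T. of_bool (multiplicity p n > 0))"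
proof -
  have "{p \<in> T. p dvd n} = {p \<in> T. multiplicity p n > 0}"
    using assms by (auto simp: prime_multiplicity_gt_zero_iff)
  moreover have "(\<Sum>p\<in>T. of_bool (multiplicity p n > 0)) = card {p \<in> T. multiplicity p n > 0}"
    using assms(2) by (simp add: sum.inter_filter[symmetric] of_bool_def Int_def)
  ultimately show ?thesis by (simp add: small_omega_def)
qed

lemma eventually_level_error_small:
  fixes A b \<beta> :: real
  assumes "\<beta> < 1"
  shows "eventually (\<lambda>x::real. b * (ln x * x powr (\<beta> - 1)) \<le> 1 / (ln x) powr (2 * A + 129)) at_top"
proof -
  define \<eta> where "\<eta> = 1 - \<beta>"
  have \<eta>: "\<eta> > 0" using assms by (simp add: \<eta>_def)
  have "((\<lambda>x::real. b * (ln x * x powr (- \<eta>)) * (ln x) powr (2 * A + 129)) \<longlongrightarrow> 0) at_top"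
    using \<eta> by real_asymp
  then have "eventually (\<lambda>x::real. b * (ln x * x powr (- \<eta>)) * (ln x) powr (2 * A + 129) < 1) at_top"
    by (rule order_tendstoD) simp
  moreover have "eventually (\<lambda>x::real. ln x > 0) at_top" by real_asymp
  ultimately show ?thesis
  proof eventually_elim
    case (elim x)
    have "\<beta> - 1 = - \<eta>" by (simp add: \<eta>_def)
    then show ?case using elim by (simp only:) (simp add: pos_le_divide_eq less_imp_le)
  qed
qed

lemma eventually_shifted_prime_range:
  "eventually (\<lambda>x::real. real (card (shifted_prime_range a x)) \<ge> x / (16 * ln x)) at_top"
proof -
  have "eventually (\<lambda>x::real. x / (16 * ln x) \<ge> \<bar>of_int a\<bar> + 1) at_top" by real_asymp
  then show ?thesis using eventually_ge_at_top[of "2::real"]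
  proof eventually_elim
    case (elim x)
    have "x / (8 * ln x) \<le> real (prime_count x)" using elim(2) by (rule prime_count_lower)
    also have "\<dots> \<le> real (card (shifted_prime_range a x)) + (\<bar>of_int a\<bar> + 1)"
      using card_prime_filter_le(2)[where a = a and x = x and Q = "\<lambda>_. True"] by (simp add: prime_count_def)
    finally have "x / (8 * ln x) \<le> real (card (shifted_prime_range a x)) + (\<bar>of_int a\<bar> + 1)" .
    moreover have "x / (8 * ln x) = 2 * (x / (16 * ln x))" by simp
    ultimately show ?case using elim(1) by linarith
  qed
qed

text \<open>Both kinds of additive function are sums of \<open>\<phi> i\<close> over the exponents,
  with \<open>\<phi> i\<close> the identity or the indicator of positive numbers. In this form the
  event is a function of \<open>exponents\<close> and fits the comparison lemmas.\<close>

lemma prob_eq_expectation_exponents: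
  fixes f :: "nat \<Rightarrow> nat \<Rightarrow> nat" and T :: "nat \<Rightarrow> nat set" and R :: "(nat \<Rightarrow> nat) set"
  assumes P: "0 \<notin> set_pmf P" and T: "\<And>i. i \<in> I \<Longrightarrow> finite (T i)" "\<And>i q. i \<in> I \<Longrightarrow> q \<in> T i \<Longrightarrow> prime q"
    and f: "\<And>i. i \<in> I \<Longrightarrow> f i = (\<lambda>n. small_omega n (T i)) \<or> f i = (\<lambda>n. big_Omega n (T i))"
  defines "\<phi> \<equiv> \<lambda>i k. if f i = (\<lambda>n. big_Omega n (T i)) then k else of_bool (k > 0)"
  shows "measure_pmf.prob P {n. (\<lambda>i\<in>I. f i n) \<in> R}
     = measure_pmf.expectation P (\<lambda>n. of_bool ((\<lambda>i\<in>I. \<Sum>r\<in>T i. \<phi> i (exponents (\<Union>i\<in>I. T i) n r)) \<in> R))"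
proof -
  have "measure_pmf.prob P {n. (\<lambda>i\<in>I. f i n) \<in> R} = measure_pmf.expectation P (indicator {n. (\<lambda>i\<in>I. f i n) \<in> R})"
    by simp
  also have "\<dots> = measure_pmf.expectation P (\<lambda>n. of_bool ((\<lambda>i\<in>I. \<Sum>r\<in>T i. \<phi> i (exponents (\<Union>i\<in>I. T i) n r)) \<in> R))"
  proof (rule integral_cong_AE)
    show "AE n in measure_pmf P. indicator {n. (\<lambda>i\<in>I. f i n) \<in> R} n
       = (of_bool ((\<lambda>i\<in>I. \<Sum>r\<in>T i. \<phi> i (exponents (\<Union>i\<in>I. T i) n r)) \<in> R) :: real)"
      unfolding AE_measure_pmf_iff
    proof
      fix n assume "n \<in> set_pmf P"
      then have n: "n > 0" using P by (cases "n = 0") auto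
      have "(\<lambda>i\<in>I. f i n) = (\<lambda>i\<in>I. \<Sum>r\<in>T i. \<phi> i (exponents (\<Union>i\<in>I. T i) n r))"
      proof (rule restrict_ext)
        fix i assume i: "i \<in> I"
        have ex: "exponents (\<Union>i\<in>I. T i) n r = multiplicity r n" if "r \<in> T i" for r
          using that i by (auto simp: exponents_def)
        show "f i n = (\<Sum>r\<in>T i. \<phi> i (exponents (\<Union>i\<in>I. T i) n r))"
        proof (cases "f i = (\<lambda>n. big_Omega n (T i))")
          case True
          then show ?thesis by (simp add: \<phi>_def ex big_Omega_def)
        next
          case False
          then have "f i n = small_omega n (T i)" using f[OF i] by auto
          also have "\<dots> = (\<Sum>r\<in>T i. of_bool (multiplicity r n > 0))"
            using n T i by (intro small_omega_eq_sum) auto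
          also have "\<dots> = (\<Sum>r\<in>T i. \<phi> i (exponents (\<Union>i\<in>I. T i) n r))"
            by (intro sum.cong refl) (simp only: \<phi>_def False ex if_False)
          finally show ?thesis .
        qed
      qed
      then show "indicator {n. (\<lambda>i\<in>I. f i n) \<in> R} n
       = (of_bool ((\<lambda>i\<in>I. \<Sum>r\<in>T i. \<phi> i (exponents (\<Union>i\<in>I. T i) n r)) \<in> R) :: real)"
        by (simp add: indicator_def)
    qed
  qed auto
  finally show ?thesis .
qed

theorem theorem3:
  fixes \<gamma> A \<alpha> :: real and a :: int
  assumes "\<gamma> > 0" and "hypothesis_Z \<gamma>"
    and "a \<noteq> 0" and "A > 0" and "0 < \<alpha>" and "\<alpha> < \<gamma>"
  shows "\<exists>C::real. \<forall>(x::real) (y::real) (m::nat) (T :: nat \<Rightarrow> nat set)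
           (f :: nat \<Rightarrow> nat \<Rightarrow> nat) (R :: (nat \<Rightarrow> nat) set).
     2 \<le> y \<longrightarrow> y \<le> x \<longrightarrow>
     (\<forall>i\<in>{1..m}. T i \<noteq> {} \<and> T i \<subseteq> {p. prime p \<and> 2 \<le> real p \<and> real p \<le> y}) \<longrightarrow>
     disjoint_family_on T {1..m} \<longrightarrow>
     (\<forall>i\<in>{1..m}. f i = (\<lambda>n. small_omega n (T i)) \<or> f i = (\<lambda>n. big_Omega n (T i))) \<longrightarrow>
     R \<subseteq> ({1..m} \<rightarrow>\<^sub>E UNIV) \<longrightarrow>
     (let u = ln x / ln y in
       \<bar>measure_pmf.prob (pmf_of_set {1..nat \<lfloor>x\<rfloor>})
            {n. (\<lambda>i\<in>{1..m}. f i n) \<in> R}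
         - measure_pmf.prob (pmf_of_set {p::nat. prime p \<and> \<bar>a\<bar> + 1 < int p \<and> real p \<le> x})
            {p. (\<lambda>i\<in>{1..m}. f i (nat (int p + a))) \<in> R}\<bar>
       \<le> C * ((\<Sum>j=1..m. H2 (T j) / (1 + sqrt (H1 (T j))))
                + exp (- \<alpha> * u * ln u) + 1 / (ln x) powr A))"
proof -
  have \<gamma>1: "\<gamma> \<le> 1" by (rule hypothesis_Z_le_1[OF assms(2)])
  \<comment> \<open>The level lies strictly between \<alpha> and \<gamma>: room below for the sieve
    parameters, room above for \<epsilon> = \<gamma> - \<beta> in Hypothesis Z.\<close>
  define \<beta> where "\<beta> = (\<alpha> + \<gamma>) / 2"
  have \<beta>: "\<alpha> < \<beta>" "\<beta> < 1" "\<beta> < \<gamma>" using assms \<gamma>1 by (auto simp: \<beta>_def)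
  obtain \<delta> where \<delta>: "\<delta> > 0" and Z: "\<forall>B\<ge>(1::real). \<forall>a::int. a \<noteq> 0 \<longrightarrow>
       (\<exists>C::real. \<forall>x::real. x \<ge> 2 \<longrightarrow>
         (\<Sum>m | m \<ge> 1 \<and> real m \<le> x powr (\<gamma> - (\<gamma> - \<beta>)) \<and>
                real (largest_prime_factor m) \<le> x powr \<delta> \<and> coprime (int m) a.
            \<bar>real (prime_count_cong x m (- a)) - real (prime_count x) / real (totient m)\<bar>)
         \<le> C * (x / (ln x) powr B))"
  proof -
    have "\<gamma> - \<beta> > 0" using \<beta>(3) by simp
    from assms(2)[unfolded hypothesis_Z_def, THEN spec[of _ "\<gamma> - \<beta>"], THEN mp, OF this]
    show ?thesis by (elim exE conjE) (rule that)
  qed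
  \<comment> \<open>One logarithm more than \<open>kubilius_asymptotic\<close> asks for, since
    normalising by the number of primes costs one.\<close>
  obtain CZ where CZ: "\<And>x::real. x \<ge> 2 \<Longrightarrow>
         (\<Sum>m | m \<ge> 1 \<and> real m \<le> x powr \<beta> \<and>
                real (largest_prime_factor m) \<le> x powr \<delta> \<and> coprime (int m) a.
            \<bar>real (prime_count_cong x m (- a)) - real (prime_count x) / real (totient m)\<bar>)
         \<le> CZ * (x / (ln x) powr (2 * A + 130))"
    using Z[rule_format, of "2 * A + 130" a] assms(3,4) by auto
  obtain CK U0 X0 where CK: "CK \<ge> 0" and kub: "\<forall>x y U P e E0 (F :: (nat \<Rightarrow> nat) \<Rightarrow> real).
     X0 \<le> x \<longrightarrow> 2 \<le> y \<longrightarrow> y \<le> x \<longrightarrow> U0 \<le> ln x / ln y \<longrightarrow>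
     finite U \<longrightarrow> (\<forall>q\<in>U. prime q \<and> real q \<le> y) \<longrightarrow> 0 \<notin> set_pmf P \<longrightarrow>
     (\<forall>q. 0 \<le> e q \<and> e q \<le> 1) \<longrightarrow> (\<forall>q\<in>U. e q \<le> 2 / real q) \<longrightarrow>
     (\<forall>d. dvd_prob P d \<le> 32 * ln x * (1 / real d)) \<longrightarrow> (\<forall>v. \<bar>F v\<bar> \<le> 1) \<longrightarrow> E0 \<ge> 0 \<longrightarrow>
     (\<Sum>d\<in>smooth_upto U (x powr \<beta>). \<bar>dvd_prob P d - dvd_prob (prime_model U e) d\<bar>)
       \<le> E0 / (ln x) powr (2 * A + 129) \<longrightarrow>
     \<bar>measure_pmf.expectation P (\<lambda>n. F (exponents U n))
        - measure_pmf.expectation (Pi_pmf U 0 (\<lambda>q. inflated_geometric (e q) q)) F\<bar>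
     \<le> (CK + E0) * (exp (- \<alpha> * (ln x / ln y) * ln (ln x / ln y)) + 1 / (ln x) powr A)"
    using kubilius_asymptotic[OF assms(5) \<beta>(1) assms(4)] by (elim exE conjE) (rule that)
  \<comment> \<open>16 times the 2 (|a| + 1) of \<open>shifted_primes_level\<close>; it also
    dominates the 2 of \<open>integers_level\<close>.\<close>
  define b :: real where "b = 32 * (\<bar>of_int a\<bar> + 1)"
  have "eventually (\<lambda>x::real. b * (ln x * x powr (\<beta> - 1)) \<le> 1 / (ln x) powr (2 * A + 129) \<and>
      real (card (shifted_prime_range a x)) \<ge> x / (16 * ln x) \<and> x \<ge> X0 \<and> x \<ge> \<bar>of_int a\<bar> \<and> x \<ge> exp 1) at_top"
    by (intro eventually_conj eventually_level_error_small[OF \<beta>(2)] eventually_shifted_prime_range eventually_ge_at_top)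
  then obtain X1 where X1: "\<And>x::real. x \<ge> X1 \<Longrightarrow> b * (ln x * x powr (\<beta> - 1)) \<le> 1 / (ln x) powr (2 * A + 129) \<and>
      real (card (shifted_prime_range a x)) \<ge> x / (16 * ln x) \<and> x \<ge> X0 \<and> x \<ge> \<bar>of_int a\<bar> \<and> x \<ge> exp 1"
    unfolding eventually_at_top_linorder by blast
  define X2 where "X2 = max X1 2"
  \<comment> \<open>The bound u \<ge> 1/\<delta> means y \<le> x^\<delta>, so that divisors composed
    of primes up to y satisfy the smoothness condition of Hypothesis Z.\<close>
  define U1 where "U1 = Max {1, U0, 1 / \<delta>}"
  have U1: "U1 \<ge> 1" "U1 \<ge> U0" "U1 \<ge> 1 / \<delta>" by (auto simp: U1_def)
  \<comment> \<open>Contains the primes dividing \<open>a\<close>, where e2 = 0, and the prime 2,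
    where e2 may be 1 and leave no mass at 0. Its size depends on \<open>a\<close> only.\<close>
  define Bad where "Bad = {..nat \<bar>a\<bar> + 2}"
  define e1 where "e1 = (\<lambda>q::nat. 1 / real q)"
  define e2 where "e2 = (\<lambda>q::nat. if q \<ge> 2 \<and> \<not> int q dvd a then 1 / (real q - 1) else 0)"
  \<comment> \<open>If q does not divide \<open>a\<close>, then 1/(q - 1) - 1/q \<le> 2/q^2; if it
    does, then q \<le> |a| and the difference 1/q is at most |a|/q^2.\<close>
  define c :: real where "c = 2 + \<bar>of_int a\<bar>"
  define CM where "CM = 4 * c * (8 + 2 * real (card Bad))"
  define CE where "CE = (CK + 1) + (CK + (16 * \<bar>CZ\<bar> + 1))"
  \<comment> \<open>The last two summands make the claim trivial for u < U1 and for x < X2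
    respectively.\<close>
  define C where "C = CM + CE + exp (\<alpha> * U1 * ln U1) + (ln X2) powr A"
  have pos: "CM \<ge> 0" "CE \<ge> 0" using CK by (auto simp: CM_def CE_def c_def)
  have e1: "0 \<le> e1 q \<and> e1 q \<le> 1" "e1 q \<le> 2 / real q" for q
    by (cases q, auto simp: e1_def field_simps)+
  have e2: "0 \<le> e2 q \<and> e2 q \<le> 1" "e2 q \<le> 2 / real q" for q
    by (auto simp: e2_def field_simps)
  show ?thesis
  proof (intro exI[of _ C] allI impI)
    fix x y :: real and m :: nat and T :: "nat \<Rightarrow> nat set" and f :: "nat \<Rightarrow> nat \<Rightarrow> nat" and R :: "(nat \<Rightarrow> nat) set"
    assume y: "2 \<le> y" "y \<le> x"
      and T0: "\<forall>i\<in>{1..m}. T i \<noteq> {} \<and> T i \<subseteq> {p. prime p \<and> 2 \<le> real p \<and> real p \<le> y}"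
      and disj: "disjoint_family_on T {1..m}"
      and f: "\<forall>i\<in>{1..m}. f i = (\<lambda>n. small_omega n (T i)) \<or> f i = (\<lambda>n. big_Omega n (T i))"
    define u where "u = ln x / ln y"
    define P1 where "P1 = pmf_of_set {1..nat \<lfloor>x\<rfloor>}"
    define S where "S = shifted_prime_range a x"
    define W where "W = (\<Sum>j=1..m. H2 (T j) / (1 + sqrt (H1 (T j))))"
    define M where "M = exp (- \<alpha> * u * ln u)"
    define L where "L = 1 / (ln x) powr A"
    define p1 where "p1 = measure_pmf.prob P1 {n. (\<lambda>i\<in>{1..m}. f i n) \<in> R}"
    define p2 where "p2 = measure_pmf.prob (pmf_of_set S) {p. (\<lambda>i\<in>{1..m}. f i (nat (int p + a))) \<in> R}"
    have Tp: "prime q" "real q \<le> y" "q \<ge> 2" if "i \<in> {1..m}" "q \<in> T i" for i q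
      using T0 that by force+
    have Tf: "finite (T i)" if "i \<in> {1..m}" for i
      by (rule finite_subset[OF _ finite_primes_real_le[of y]]) (use Tp that in auto)
    have "H1 (T j) \<ge> 0" if "j \<in> {1..m}" for j
      unfolding H1_def
    proof (rule sum_nonneg)
      show "0 \<le> 1 / (real q - 1)" if "q \<in> T j" for q using Tp(3)[OF \<open>j \<in> {1..m}\<close> that] by simp
    qed
    moreover have "H2 (T j) \<ge> 0" for j unfolding H2_def by (intro sum_nonneg) auto
    ultimately have W0: "W \<ge> 0"
      unfolding W_def by (intro sum_nonneg divide_nonneg_nonneg add_nonneg_nonneg real_sqrt_ge_zero) auto
    have ly: "ln y > 0" "ln x \<ge> ln y" using y by auto
    have u1: "u \<ge> 1" using ly by (simp add: u_def)
    have M0: "M > 0" "L > 0" using ly by (auto simp: M_def L_def)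
    have "\<bar>p1 - p2\<bar> \<le> C * (W + M + L)"
    proof (cases "x \<ge> X2 \<and> u \<ge> U1")
      case False
      \<comment> \<open>For small x there may be no prime in the range, and then
        \<open>pmf_of_set\<close> is applied to the empty set. Only the bounds valid for every
        probability are used here.\<close>
      have "0 \<le> p1" "p1 \<le> 1" "0 \<le> p2" "p2 \<le> 1" by (auto simp: p1_def p2_def)
      then have "\<bar>p1 - p2\<bar> \<le> 1" by linarith
      also have "1 \<le> exp (\<alpha> * U1 * ln U1) * M + (ln X2) powr A * L"
      proof (cases "u \<ge> U1")
        case True
        then have "x \<le> X2" using False by simp
        then have "(ln x) powr A \<le> (ln X2) powr A" using y ly assms(4) by (intro powr_mono2) auto
        then have "1 \<le> (ln X2) powr A * L" using ly by (simp add: L_def field_simps)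
        then show ?thesis using M0 by (simp add: add_increasing)
      next
        case False
        have "u * ln u \<le> U1 * ln U1" using False u1 U1 by (intro mult_mono) auto
        then have "\<alpha> * (u * ln u) \<le> \<alpha> * (U1 * ln U1)" using assms(5) by (intro mult_left_mono) auto
        then have "1 \<le> exp (\<alpha> * U1 * ln U1) * M" unfolding M_def by (simp add: exp_add[symmetric] mult_ac)
        moreover have "0 \<le> (ln X2) powr A * L" using M0 by simp
        ultimately show ?thesis by linarith
      qed
      also have "\<dots> \<le> C * (W + M + L)"
      proof -
        have "exp (\<alpha> * U1 * ln U1) * M \<le> C * M" "(ln X2) powr A * L \<le> C * L"
          using pos M0 by (auto simp: C_def intro!: mult_right_mono)
        moreover have "0 \<le> C * W" using pos W0 by (auto simp: C_def)
        ultimately show ?thesis by (simp add: distrib_left)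
      qed
      finally show ?thesis .
    next
      case True
      have x: "x \<ge> X1" "x \<ge> 2" and u: "u \<ge> U1" using True by (auto simp: X2_def)
      note X1' = X1[OF x(1)]
      have lx: "ln x \<ge> 1"
      proof -
        have "exp 1 \<le> x" using X1' by simp
        then show ?thesis using x(2) by (subst ln_ge_iff) auto
      qed
      define U where "U = (\<Union>i\<in>{1..m}. T i)"
      have U: "finite U" "\<forall>q\<in>U. prime q \<and> real q \<le> y" using Tf Tp by (auto simp: U_def)
      define \<phi> where "\<phi> = (\<lambda>i k. if f i = (\<lambda>n. big_Omega n (T i)) then k else of_bool (k > (0::nat)))"
      define \<Phi> :: "(nat \<Rightarrow> nat) \<Rightarrow> real" where "\<Phi> = (\<lambda>w. of_bool (w \<in> R))"
      define F where "F = (\<lambda>z. \<Phi> (\<lambda>i\<in>{1..m}. \<Sum>r\<in>T i. \<phi> i (z r)))"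
      have \<Phi>1: "\<bar>\<Phi> w\<bar> \<le> 1" for w by (simp add: \<Phi>_def)
      have F1: "\<forall>v. \<bar>F v\<bar> \<le> 1" by (simp add: F_def \<Phi>1)
      define P2 where "P2 = shifted_primes a x"
      have card_pos: "real (card S) > 0"
      proof -
        have "x / (16 * ln x) > 0" using x lx by simp
        then show ?thesis using X1' by (simp add: S_def)
      qed
      then have ne: "S \<noteq> {}" by auto
      have P2: "0 \<notin> set_pmf P2" unfolding P2_def by (rule zero_notin_shifted_primes) (use ne in \<open>simp add: S_def\<close>)
      define N where "N = nat \<lfloor>x\<rfloor>"
      have N: "N > 0" using x unfolding N_def by linarith
      have P1: "0 \<notin> set_pmf P1" using N by (simp add: P1_def N_def[symmetric])
      have p1_eq: "p1 = measure_pmf.expectation P1 (\<lambda>n. F (exponents U n))"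
        unfolding p1_def F_def \<Phi>_def \<phi>_def U_def
        by (rule prob_eq_expectation_exponents) (use P1 Tf Tp f in auto)
      have "p2 = measure_pmf.prob P2 {n. (\<lambda>i\<in>{1..m}. f i n) \<in> R}"
        by (simp add: p2_def P2_def shifted_primes_def S_def vimage_def)
      also have "\<dots> = measure_pmf.expectation P2 (\<lambda>n. F (exponents U n))"
        unfolding F_def \<Phi>_def \<phi>_def U_def
        by (rule prob_eq_expectation_exponents) (use P2 Tf Tp f in auto)
      finally have p2_eq: "p2 = measure_pmf.expectation P2 (\<lambda>n. F (exponents U n))" .
      define m1 where "m1 = measure_pmf.expectation (Pi_pmf U 0 (\<lambda>q. inflated_geometric (e1 q) q)) F"
      define m2 where "m2 = measure_pmf.expectation (Pi_pmf U 0 (\<lambda>q. inflated_geometric (e2 q) q)) F"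
      have Xx: "X0 \<le> x" "U0 \<le> ln x / ln y" using X1' U1 u by (auto simp: u_def)
      have err: "b * (ln x * x powr (\<beta> - 1)) \<le> 1 / (ln x) powr (2 * A + 129)" using X1' by simp
      have d1: "\<bar>p1 - m1\<bar> \<le> (CK + 1) * (M + L)"
        unfolding p1_eq m1_def M_def L_def u_def
      proof (rule kub[rule_format, OF Xx(1) y Xx(2) U(1)])
        show "prime q \<and> real q \<le> y" if "q \<in> U" for q using U that by auto
        show "dvd_prob P1 d \<le> 32 * ln x * (1 / real d)" for d
        proof (cases "d = 0")
          case True
          have "{1..N} \<inter> {n. n = 0} = {}" by auto
          then show ?thesis using True N by (simp add: dvd_prob_def P1_def N_def[symmetric] measure_pmf_of_set)
        next
          case False
          have "dvd_prob P1 d \<le> 1 * (1 / real d)"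
            using dvd_prob_uniform_error(1)[of N d] False N by (simp add: P1_def N_def)
          also have "\<dots> \<le> 32 * ln x * (1 / real d)" using lx by (intro mult_right_mono) auto
          finally show ?thesis .
        qed
        have "(\<Sum>d\<in>smooth_upto U (x powr \<beta>). \<bar>dvd_prob P1 d - dvd_prob (prime_model U e1) d\<bar>) \<le> 2 * x powr (\<beta> - 1)"
          unfolding P1_def e1_def using x U by (intro integers_level) auto
        also have "\<dots> \<le> b * (ln x * x powr (\<beta> - 1))"
        proof -
          have "2 * x powr (\<beta> - 1) \<le> b * (1 * x powr (\<beta> - 1))"
            unfolding mult_1 by (rule mult_right_mono) (auto simp: b_def)
          also have "\<dots> \<le> b * (ln x * x powr (\<beta> - 1))"
            using lx by (intro mult_left_mono mult_right_mono) (auto simp: b_def)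
          finally show ?thesis .
        qed
        also note err
        finally show "(\<Sum>d\<in>smooth_upto U (x powr \<beta>). \<bar>dvd_prob P1 d - dvd_prob (prime_model U e1) d\<bar>)
            \<le> 1 / (ln x) powr (2 * A + 129)" .
      qed (use P1 e1 F1 in auto)
      have yx: "y \<le> x powr \<delta>"
      proof -
        have "1 / \<delta> \<le> ln x / ln y" using U1 u by (simp add: u_def)
        then have "ln y \<le> \<delta> * ln x" using \<delta> ly by (simp add: field_simps)
        then have "exp (ln y) \<le> exp (\<delta> * ln x)" by simp
        then show ?thesis using y by (simp add: powr_def)
      qed
      have d2: "\<bar>p2 - m2\<bar> \<le> (CK + (16 * \<bar>CZ\<bar> + 1)) * (M + L)"
        unfolding p2_eq m2_def M_def L_def u_def
      proof (rule kub[rule_format, OF Xx(1) y Xx(2) U(1)])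
        show "prime q \<and> real q \<le> y" if "q \<in> U" for q using U that by auto
        show "dvd_prob P2 d \<le> 32 * ln x * (1 / real d)" for d
          unfolding P2_def using X1' x by (intro dvd_prob_shifted_le) auto
        have "(\<Sum>d\<in>smooth_upto U (x powr \<beta>). \<bar>dvd_prob P2 d - dvd_prob (prime_model U e2) d\<bar>)
           \<le> 16 * ln x * (CZ / (ln x) powr (2 * A + 130) + 2 * (\<bar>of_int a\<bar> + 1) * x powr (\<beta> - 1))"
          unfolding P2_def e2_def
          by (rule shifted_primes_level[OF x(2) assms(3) _ U(1) _ CZ[OF x(2)]]) (use X1' U yx in \<open>auto intro: order_trans\<close>)
        also have "\<dots> = 16 * CZ * (ln x / (ln x) powr (2 * A + 130)) + b * (ln x * x powr (\<beta> - 1))"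
          by (simp add: b_def algebra_simps)
        also have "ln x / (ln x) powr (2 * A + 130) = 1 / (ln x) powr (2 * A + 129)"
        proof -
          have "(ln x) powr (2 * A + 130) = (ln x) powr ((2 * A + 129) + 1)" by (simp add: add.assoc)
          also have "\<dots> = (ln x) powr (2 * A + 129) * ln x" using lx by (simp only: powr_add) simp
          finally show ?thesis using lx by simp
        qed
        also have "16 * CZ * (1 / (ln x) powr (2 * A + 129)) + b * (ln x * x powr (\<beta> - 1))
            \<le> 16 * \<bar>CZ\<bar> * (1 / (ln x) powr (2 * A + 129)) + 1 / (ln x) powr (2 * A + 129)"
          using err by (intro add_mono mult_right_mono) auto
        also have "\<dots> = (16 * \<bar>CZ\<bar> + 1) / (ln x) powr (2 * A + 129)" by (simp add: add_divide_distrib)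
        finally show "(\<Sum>d\<in>smooth_upto U (x powr \<beta>). \<bar>dvd_prob P2 d - dvd_prob (prime_model U e2) d\<bar>)
            \<le> (16 * \<bar>CZ\<bar> + 1) / (ln x) powr (2 * A + 129)" .
      qed (use P2 e2 F1 in auto)
      have d3: "\<bar>m2 - m1\<bar> \<le> CM * W"
        unfolding m1_def m2_def CM_def W_def F_def U_def
      proof (rule compare_models)
        show "disjoint_family_on T {1..m}" by (rule disj)
        show "finite {1..m}" "finite Bad" by (auto simp: Bad_def)
        show "\<bar>e2 q - e1 q\<bar> \<le> c / (real q)\<^sup>2" if iq: "i \<in> {1..m}" "q \<in> T i" for i q
        proof (cases "int q dvd a")
          case True
          have q: "real q \<ge> 2" using Tp(3)[OF iq] by simp
          have "int q \<le> \<bar>a\<bar>" using True assms(3) dvd_imp_le_int[of a "int q"] by simp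
          then have "real q \<le> \<bar>of_int a\<bar>" by linarith
          then have "real q / (real q)\<^sup>2 \<le> c / (real q)\<^sup>2" by (intro divide_right_mono) (auto simp: c_def)
          then show ?thesis using True q by (simp add: e1_def e2_def power2_eq_square)
        next
          case False
          have q: "real q \<ge> 2" "q \<ge> 2" using Tp(3)[OF iq] by auto
          have "e2 q - e1 q = 1 / (real q * (real q - 1))" using False q by (simp add: e1_def e2_def field_simps)
          moreover have "1 / (real q * (real q - 1)) \<le> 2 / (real q)\<^sup>2"
            using q by (simp add: power2_eq_square field_simps)
          moreover have "2 / (real q)\<^sup>2 \<le> c / (real q)\<^sup>2" by (intro divide_right_mono) (auto simp: c_def)
          moreover have "0 \<le> 1 / (real q * (real q - 1))" using q by simp
          ultimately show ?thesis by linarith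
        qed
        show "1 / real q \<le> e1 q \<and> e1 q \<le> 1 / 2 \<and> 1 / real q \<le> e2 q \<and> e2 q \<le> 1 / 2"
          if iq: "i \<in> {1..m}" "q \<in> T i" "q \<notin> Bad" for i q
        proof -
          have q: "q > nat \<bar>a\<bar> + 2" using iq(3) by (simp add: Bad_def)
          have "\<not> int q dvd a" using q assms(3) dvd_imp_le_int[of a "int q"] by auto
          moreover have "real q \<ge> 3" using q by simp
          ultimately show ?thesis using q by (auto simp: e1_def e2_def field_simps)
        qed
      qed (use Tf Tp \<Phi>1 e1 e2 in \<open>auto simp: \<phi>_def\<close>)
      have "\<bar>p1 - p2\<bar> \<le> CM * W + CE * (M + L)"
      proof -
        have "CE * (M + L) = (CK + 1) * (M + L) + (CK + (16 * \<bar>CZ\<bar> + 1)) * (M + L)"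
          unfolding CE_def by (rule distrib_right)
        then show ?thesis using d1 d2 d3 by linarith
      qed
      also have "\<dots> \<le> C * W + C * (M + L)"
        using pos W0 M0 by (intro add_mono mult_right_mono) (auto simp: C_def)
      also have "\<dots> = C * (W + M + L)" by (simp add: distrib_left)
      finally show ?thesis .
    qed
    then show "let u = ln x / ln y in
       \<bar>measure_pmf.prob (pmf_of_set {1..nat \<lfloor>x\<rfloor>})
            {n. (\<lambda>i\<in>{1..m}. f i n) \<in> R}
         - measure_pmf.prob (pmf_of_set {p::nat. prime p \<and> \<bar>a\<bar> + 1 < int p \<and> real p \<le> x})
            {p. (\<lambda>i\<in>{1..m}. f i (nat (int p + a))) \<in> R}\<bar>
       \<le> C * ((\<Sum>j=1..m. H2 (T j) / (1 + sqrt (H1 (T j))))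
                + exp (- \<alpha> * u * ln u) + 1 / (ln x) powr A)"
      unfolding Let_def p1_def p2_def P1_def S_def shifted_prime_range_def W_def M_def L_def u_def .
  qed
qed

end
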